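(* Let $G$ be an amply regular Terwilliger graph such that the Lin–Lu–Yau curvature $\kappa(x,y)$ is positive for every edge $xy$ of $G$. Then $G$ is isomorphic to one of the following graphs: the pentagon, the icosahedron, the line graph of the Petersen graph, the line graph of the Hoffman–Singleton graph, or the line graph of a strongly regular graph with parameters $(3250,57,0,1)$.
   Context: All graphs are finite and simple. A non-complete connected $d$-regular graph on $n$ vertices is amply regular with parameters $(n,d,\alpha,\beta)$ if any two adjacent vertices have exactly $\alpha$ common neighbours and any two vertices at distance $2$ have exactly $\beta$ common neighbours. A strongly regular graph with parameters $(n,d,\alpha,\beta)$ is an amply regular graph with these parameters of diameter $2$. A non-complete graph is Terwilliger if there is $\beta\ge1$ such that for any two vertices at distance $2$, the subgraph induced on their common neighbours is a clique of size $\beta$. Lin–Lu–Yau curvature: for a vertex $x$ and $p\in[0,1]$ let $\mu_x^p(x)=p$, $\mu_x^p(y)=(1-p)/\deg(x)$ for neighbours $y$ of $x$, and $0$ otherwise; $W_1$ is the $L^1$-Wasserstein (optimal transport) distance with respect to the graph distance $d$; $\kappa_p(x,y)=1-W_1(\mu_x^p,\mu_y^p)/d(x,y)$ and $\kappa(x,y)=\lim_{p\to1}\kappa_p(x,y)/(1-p)$. *)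

theory Defs
  imports Complex_Main "Graph_Theory.Graph_Theory"
begin

text \<open>Finite simple graphs are the graphs satisfying \<^const>\<open>pair_graph\<close>: every edge is represented
  by its two opposite arcs.\<close>

section \<open>Amply regular, strongly regular and Terwilliger graphs\<close>

definition gdist :: "'a pair_pre_digraph \<Rightarrow> 'a \<Rightarrow> 'a \<Rightarrow> ereal" where
  "gdist G x y = wf_digraph.\<mu> (with_proj G) (\<lambda>_. 1) x y"

definition diameter :: "'a pair_pre_digraph \<Rightarrow> ereal" where
  "diameter G = (SUP x\<in>pverts G. SUP y\<in>pverts G. gdist G x y)"

definition common_neighbours :: "'a pair_pre_digraph \<Rightarrow> 'a \<Rightarrow> 'a \<Rightarrow> 'a set" where
  "common_neighbours G x y = {z \<in> pverts G. (x, z) \<in> parcs G \<and> (y, z) \<in> parcs G}"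

definition complete_graph :: "'a pair_pre_digraph \<Rightarrow> bool" where
  "complete_graph G \<longleftrightarrow> (\<exists>n. complete_digraph n (with_proj G))"

definition amply_regular :: "'a pair_pre_digraph \<Rightarrow> nat \<Rightarrow> nat \<Rightarrow> nat \<Rightarrow> nat \<Rightarrow> bool" where
  "amply_regular G n d \<alpha> \<beta> \<longleftrightarrow>
     pair_graph G \<and> \<not> complete_graph G \<and> Digraph_Component.connected (with_proj G) \<and>
     card (pverts G) = n \<and>
     (\<forall>x\<in>pverts G. out_degree (with_proj G) x = d) \<and>
     (\<forall>x y. (x, y) \<in> parcs G \<longrightarrow> card (common_neighbours G x y) = \<alpha>) \<and>
     (\<forall>x\<in>pverts G. \<forall>y\<in>pverts G. gdist G x y = 2 \<longrightarrow> card (common_neighbours G x y) = \<beta>)"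

definition strongly_regular :: "'a pair_pre_digraph \<Rightarrow> nat \<Rightarrow> nat \<Rightarrow> nat \<Rightarrow> nat \<Rightarrow> bool" where
  "strongly_regular G n d \<alpha> \<beta> \<longleftrightarrow> amply_regular G n d \<alpha> \<beta> \<and> diameter G = 2"

definition terwilliger :: "'a pair_pre_digraph \<Rightarrow> bool" where
  "terwilliger G \<longleftrightarrow>
     pair_graph G \<and> \<not> complete_graph G \<and>
     (\<exists>\<beta>\<ge>1. \<forall>x\<in>pverts G. \<forall>y\<in>pverts G. gdist G x y = 2 \<longrightarrow>
        complete_digraph \<beta> (with_proj G \<restriction> common_neighbours G x y))"

section \<open>Lin--Lu--Yau curvature\<close>

definition lazy_walk_measure :: "'a pair_pre_digraph \<Rightarrow> real \<Rightarrow> 'a \<Rightarrow> 'a \<Rightarrow> real" where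
  "lazy_walk_measure G p x y =
     (if y = x then p
      else if (x, y) \<in> parcs G then (1 - p) / real (out_degree (with_proj G) x)
      else 0)"

definition transport_plan ::
  "'a pair_pre_digraph \<Rightarrow> ('a \<Rightarrow> real) \<Rightarrow> ('a \<Rightarrow> real) \<Rightarrow> ('a \<Rightarrow> 'a \<Rightarrow> real) \<Rightarrow> bool" where
  "transport_plan G m1 m2 \<pi> \<longleftrightarrow>
     (\<forall>u\<in>pverts G. \<forall>v\<in>pverts G. 0 \<le> \<pi> u v) \<and>
     (\<forall>u\<in>pverts G. (\<Sum>v\<in>pverts G. \<pi> u v) = m1 u) \<and>
     (\<forall>v\<in>pverts G. (\<Sum>u\<in>pverts G. \<pi> u v) = m2 v)"

text \<open>The next three definitions are meant for connected graphs, where all distances are finite and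
  \<^const>\<open>real_of_ereal\<close> loses nothing.\<close>

definition wasserstein1 :: "'a pair_pre_digraph \<Rightarrow> ('a \<Rightarrow> real) \<Rightarrow> ('a \<Rightarrow> real) \<Rightarrow> real" where
  "wasserstein1 G m1 m2 =
     (INF \<pi>\<in>{\<pi>. transport_plan G m1 m2 \<pi>}.
        \<Sum>u\<in>pverts G. \<Sum>v\<in>pverts G. \<pi> u v * real_of_ereal (gdist G u v))"

definition lazy_curvature :: "'a pair_pre_digraph \<Rightarrow> real \<Rightarrow> 'a \<Rightarrow> 'a \<Rightarrow> real" where
  "lazy_curvature G p x y =
     1 - wasserstein1 G (lazy_walk_measure G p x) (lazy_walk_measure G p y) /
         real_of_ereal (gdist G x y)"

definition LLY_curvature :: "'a pair_pre_digraph \<Rightarrow> 'a \<Rightarrow> 'a \<Rightarrow> real" where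
  "LLY_curvature G x y = Lim (at_left 1) (\<lambda>p. lazy_curvature G p x y / (1 - p))"

section \<open>Specific graphs\<close>

definition line_graph :: "'a pair_pre_digraph \<Rightarrow> 'a set pair_pre_digraph" where
  "line_graph G =
     (let E = {{u, v} | u v. (u, v) \<in> parcs G}
      in \<lparr>pverts = E, parcs = {(e, f). e \<in> E \<and> f \<in> E \<and> e \<noteq> f \<and> e \<inter> f \<noteq> {}}\<rparr>)"

text \<open>Below, \<^const>\<open>mk_symmetric\<close> adds the opposite arcs.\<close>

definition pentagon :: "nat pair_pre_digraph" where
  "pentagon = mk_symmetric (with_proj
     \<lparr>pverts = {..<5}, parcs = (\<Union>i<5. {(i, (i + 1) mod 5)})\<rparr>)"

text \<open>The icosahedron as a pentagonal antiprism with rings \<open>(1, i)\<close> and \<open>(2, i)\<close>, capped by the apexes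
  \<open>(0, 0)\<close> and \<open>(3, 0)\<close>.\<close>

definition icosahedron :: "(nat \<times> nat) pair_pre_digraph" where
  "icosahedron = mk_symmetric (with_proj
     \<lparr>pverts = {(0, 0), (3, 0)} \<union> {1, 2} \<times> {..<5},
      parcs = (\<Union>i<5.
        {((0, 0), (1, i)), ((1, i), (1, (i + 1) mod 5)),
         ((1, i), (2, i)), ((1, i), (2, (i + 1) mod 5)),
         ((2, i), (2, (i + 1) mod 5)), ((2, i), (3, 0))})\<rparr>)"

text \<open>The Petersen graph as the Kneser graph of the 2-subsets of a 5-set.\<close>

definition petersen :: "nat set pair_pre_digraph" where
  "petersen =
     (let V = {S. S \<subseteq> {..<5} \<and> card S = 2}
      in \<lparr>pverts = V, parcs = {(S, T). S \<in> V \<and> T \<in> V \<and> S \<inter> T = {}}\<rparr>)"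

text \<open>Robertson's construction of the Hoffman--Singleton graph: five pentagons \<open>P\<^sub>h\<close> with vertices
  \<open>(0, h, j)\<close>, five pentagrams \<open>Q\<^sub>i\<close> with vertices \<open>(1, i, j)\<close>, and vertex \<open>j\<close> of \<open>P\<^sub>h\<close> joined
  to vertex \<open>h i + j\<close> of \<open>Q\<^sub>i\<close>, all modulo 5.\<close>

definition hoffman_singleton :: "(nat \<times> nat \<times> nat) pair_pre_digraph" where
  "hoffman_singleton = mk_symmetric (with_proj
     \<lparr>pverts = {0, 1} \<times> {..<5} \<times> {..<5},
      parcs =
        (\<Union>h<5. \<Union>j<5. {((0, h, j), (0, h, (j + 1) mod 5))}) \<union>
        (\<Union>i<5. \<Union>j<5. {((1, i, j), (1, i, (j + 2) mod 5))}) \<union>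
        (\<Union>h<5. \<Union>i<5. \<Union>j<5. {((0, h, j), (1, i, (h * i + j) mod 5))})\<rparr>)"

end

theory Submission
  imports Defs "HOL-Library.Numeral_Type" "Jordan_Normal_Form.Schur_Decomposition"
begin

text \<open>
  In a Terwilliger graph there are no edges between the private neighbours of the two ends of an edge, so
  transporting the neighbours of one end to those of the other costs at least twice their number. Positive
  curvature therefore gives \<open>d \<le> 2 \<alpha> + 2\<close>, and in the case of equality all private neighbours of the two
  ends can be matched at distance two.

  For \<open>\<beta> \<ge> 2\<close> the local graphs have \<open>d\<close> vertices and degree \<open>\<alpha>\<close>, and any two nonadjacent vertices have
  \<open>\<beta> - 1\<close> common neighbours, which form a clique. All twin classes have the same size \<open>s\<close>, and counting in
  the quotient by twins and in its local graphs leaves only the pentagon. Pairs of twins of local graphs make up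
  triples that are symmetric in their vertices, which forces \<open>s = 1\<close>; the graph is locally a pentagon, hence the
  icosahedron.

  For \<open>\<beta> = 1\<close> every vertex lies in exactly two maximal cliques, and the graph is the line graph of the graph of
  its cliques, which is triangle-free, has no quadrangles, and has diameter two by the equality case above: a Moore
  graph. Its degree is 2, 3, 7 or 57, since the trace of an eigenprojection is an integer.

  In a Moore graph of degree 7 the three vertices joining the opposite pairs of a hexagon have a common neighbour,
  because the second largest eigenvalue is 2. Hence a pentagon with a further neighbour of one of its vertices
  extends to a Petersen subgraph. This splits the graph into pentagons and pentagrams as in Robertson's
  construction, where the matchings between them are translations given by orthomorphisms of \<open>\<int>/5\<close>.
\<close>


section \<open>Finite graphs\<close>

locale finite_graph =
  fixes V :: "'a set" and E :: "'a \<Rightarrow> 'a \<Rightarrow> bool"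
  assumes finite_verts: "finite V"
    and adj_sym: "E u v \<Longrightarrow> E v u"
    and adj_irrefl: "\<not> E v v"
begin

definition nbrs :: "'a \<Rightarrow> 'a set" where
  "nbrs u = {v \<in> V. E u v}"

definition cl_nbrs :: "'a \<Rightarrow> 'a set" where
  "cl_nbrs u = insert u (nbrs u)"

definition private_nbrs :: "'a \<Rightarrow> 'a \<Rightarrow> 'a set" where
  "private_nbrs u v = nbrs u - cl_nbrs v"

definition nonadj :: "'a \<Rightarrow> 'a \<Rightarrow> bool" where
  "nonadj u v \<longleftrightarrow> u \<in> V \<and> v \<in> V \<and> u \<noteq> v \<and> \<not> E u v"

lemma adj_commute: "E u v \<longleftrightarrow> E v u"
  using adj_sym by blast

lemma nonadj_sym: "nonadj u v \<Longrightarrow> nonadj v u"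
  by (auto simp: nonadj_def adj_commute)

lemma nonadjI: "u \<in> V \<Longrightarrow> v \<in> V \<Longrightarrow> u \<noteq> v \<Longrightarrow> \<not> E u v \<Longrightarrow> nonadj u v"
  by (simp add: nonadj_def)

lemma in_nbrs [simp]: "v \<in> nbrs u \<longleftrightarrow> v \<in> V \<and> E u v"
  by (simp add: nbrs_def)

lemma in_cl_nbrs [simp]: "v \<in> cl_nbrs u \<longleftrightarrow> v = u \<or> v \<in> V \<and> E u v"
  by (simp add: cl_nbrs_def)

lemma in_private_nbrs [simp]: "w \<in> private_nbrs u v \<longleftrightarrow> w \<in> V \<and> E u w \<and> w \<noteq> v \<and> \<not> E v w"
  by (auto simp: private_nbrs_def)

lemma finite_nbrs [simp]: "finite (nbrs u)"
  using finite_verts by (simp add: nbrs_def)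

lemma finite_cl_nbrs [simp]: "finite (cl_nbrs u)"
  by (simp add: cl_nbrs_def)

lemma finite_private_nbrs [simp]: "finite (private_nbrs u v)"
  by (simp add: private_nbrs_def)

lemma nbrs_subset: "nbrs u \<subseteq> V"
  by auto

lemma card_cl_nbrs: "card (cl_nbrs u) = Suc (card (nbrs u))"
  by (simp add: cl_nbrs_def adj_irrefl)

lemma card_nbrs_split:
  assumes "v \<in> nbrs u"
  shows "card (nbrs u) = Suc (card (nbrs u \<inter> nbrs v) + card (private_nbrs u v))"
proof -
  have "nbrs u = insert v (nbrs u \<inter> nbrs v) \<union> private_nbrs u v"
    using assms by auto
  moreover have "card (insert v (nbrs u \<inter> nbrs v) \<union> private_nbrs u v)
      = card (insert v (nbrs u \<inter> nbrs v)) + card (private_nbrs u v)"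
    by (rule card_Un_disjoint) auto
  ultimately show ?thesis
    by (simp add: adj_irrefl)
qed

lemma sum_card_nbrs_commute:
  assumes "A \<subseteq> V" "B \<subseteq> V"
  shows "(\<Sum>a\<in>A. card (nbrs a \<inter> B)) = (\<Sum>b\<in>B. card (nbrs b \<inter> A))"
proof -
  have "(\<Sum>a\<in>A. card {b \<in> B. E a b}) = (\<Sum>b\<in>B. card {a \<in> A. E a b})"
    using assms by (intro sum_multicount_gen) (auto intro: finite_subset[OF _ finite_verts])
  moreover have "{b \<in> B. E a b} = nbrs a \<inter> B" "{a \<in> A. E a b} = nbrs b \<inter> A" for a b
    using assms by (auto simp: adj_commute)
  ultimately show ?thesis
    by simp
qed

lemma even_sum_degrees: "even (\<Sum>v\<in>V. card (nbrs v))"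
proof -
  have "even (\<Sum>v\<in>W. card {w \<in> W. E v w})" if "finite W" for W
    using that
  proof (induction W)
    case empty
    show ?case by simp
  next
    case (insert x W)
    have degree: "card {w \<in> insert x W. E v w} = card {w \<in> W. E v w} + of_bool (E v x)" for v
    proof -
      have "{w \<in> insert x W. E v w} = {w \<in> W. E v w} \<union> (if E v x then {x} else {})"
        by auto
      then show ?thesis
        using insert.hyps by (auto simp: card_insert_if)
    qed
    have "(\<Sum>v\<in>W. of_bool (E v x)) = card {w \<in> W. E x w}"
      using insert.hyps by (simp add: adj_commute Int_def)
    then have "(\<Sum>v\<in>insert x W. card {w \<in> insert x W. E v w})
        = 2 * card {w \<in> W. E x w} + (\<Sum>v\<in>W. card {w \<in> W. E v w})"
      using insert.hyps by (simp only: degree sum.distrib sum.insert) (simp add: adj_irrefl)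
    then show ?case
      using insert.IH by simp
  qed
  from this[OF finite_verts] show ?thesis
    by (simp add: nbrs_def)
qed

lemma induced_subgraph:
  assumes "W \<subseteq> V"
  shows "finite_graph W E" and "finite_graph.nbrs W E u = nbrs u \<inter> W"
    and "finite_graph.private_nbrs W E u v = private_nbrs u v \<inter> W"
    and "finite_graph.nonadj W E u v \<longleftrightarrow> nonadj u v \<and> u \<in> W \<and> v \<in> W"
proof -
  show graph: "finite_graph W E"
    by unfold_locales (use assms finite_verts finite_subset adj_sym adj_irrefl in auto)
  show "finite_graph.nbrs W E u = nbrs u \<inter> W"
    using assms by (auto simp: finite_graph.nbrs_def[OF graph])
  then show "finite_graph.private_nbrs W E u v = private_nbrs u v \<inter> W"
    using assms by (auto simp: finite_graph.private_nbrs_def[OF graph] finite_graph.cl_nbrs_def[OF graph]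
        finite_graph.nbrs_def[OF graph])
  show "finite_graph.nonadj W E u v \<longleftrightarrow> nonadj u v \<and> u \<in> W \<and> v \<in> W"
    using assms by (auto simp: finite_graph.nonadj_def[OF graph] nonadj_def)
qed

end

subsection \<open>Isomorphisms\<close>

definition graph_iso ::
  "('b \<Rightarrow> 'a) \<Rightarrow> 'b set \<Rightarrow> ('b \<Rightarrow> 'b \<Rightarrow> bool) \<Rightarrow> 'a set \<Rightarrow> ('a \<Rightarrow> 'a \<Rightarrow> bool) \<Rightarrow> bool" where
  "graph_iso g W F V E \<longleftrightarrow> bij_betw g W V \<and> (\<forall>u\<in>W. \<forall>v\<in>W. F u v \<longleftrightarrow> E (g u) (g v))"

lemma graph_isoI:
  assumes "bij_betw g W V" "\<And>u v. u \<in> W \<Longrightarrow> v \<in> W \<Longrightarrow> F u v \<longleftrightarrow> E (g u) (g v)"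
  shows "graph_iso g W F V E"
  using assms by (simp add: graph_iso_def)

lemma graph_iso_comp:
  assumes "graph_iso g W F V E" "graph_iso h U D W F"
  shows "graph_iso (g \<circ> h) U D V E"
  using assms bij_betw_apply[of h U W] by (auto simp: graph_iso_def intro: bij_betw_trans)

lemma graph_iso_inv_into:
  assumes "graph_iso g W F V E"
  shows "graph_iso (inv_into W g) V E W F"
  using assms bij_betw_inv_into_right[of g W V] bij_betw_apply[of "inv_into W g" V W]
  by (auto simp: graph_iso_def bij_betw_inv_into)

context finite_graph
begin

lemma graph_iso_if_nbrs_image:
  assumes g: "inj_on g W" "g ` W = V"
    and nbrs: "\<And>w. w \<in> W \<Longrightarrow> nbrs (g w) = g ` {w' \<in> W. F w w'}"
  shows "graph_iso g W F V E"
proof (rule graph_isoI)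
  show "bij_betw g W V"
    using g by (simp add: bij_betw_def)
  fix w w' assume w: "w \<in> W" "w' \<in> W"
  then have "E (g w) (g w') \<longleftrightarrow> g w' \<in> nbrs (g w)"
    using g(2) by auto
  then show "F w w' \<longleftrightarrow> E (g w) (g w')"
    using nbrs[OF w(1)] g(1) w by (auto simp: inj_on_def)
qed

lemma graph_iso_if_regular_hom:
  assumes g: "inj_on g W" "g ` W \<subseteq> V" "card W = card V"
    and hom: "\<And>w w'. w \<in> W \<Longrightarrow> w' \<in> W \<Longrightarrow> F w w' \<Longrightarrow> E (g w) (g w')"
    and degree: "\<And>w. w \<in> W \<Longrightarrow> card (nbrs (g w)) \<le> card {w' \<in> W. F w w'}"
  shows "graph_iso g W F V E"
proof (rule graph_iso_if_nbrs_image[OF g(1)])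
  show "g ` W = V"
    using g by (intro card_subset_eq finite_verts) (simp_all add: card_image)
  fix w assume w: "w \<in> W"
  have "inj_on g {w' \<in> W. F w w'}"
    using g(1) by (rule inj_on_subset) blast
  then have "card (nbrs (g w)) \<le> card (g ` {w' \<in> W. F w w'})"
    using degree[OF w] by (simp add: card_image)
  moreover have "g ` {w' \<in> W. F w w'} \<subseteq> nbrs (g w)"
    using g(2) hom[OF w] by auto
  ultimately show "nbrs (g w) = g ` {w' \<in> W. F w w'}"
    by (metis card_seteq finite_nbrs)
qed

end

section \<open>Graphs whose \<open>\<mu>\<close>-graphs are cliques\<close>

text \<open>The \<open>\<mu>\<close>-graph of two vertices at distance two is the subgraph induced on their common neighbours.\<close>

locale clique_mu_graphs = finite_graph +
  fixes \<mu> :: nat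
  assumes card_common_nbrs:
      "nonadj u v \<Longrightarrow> nbrs u \<inter> nbrs v \<noteq> {} \<Longrightarrow> card (nbrs u \<inter> nbrs v) = \<mu>"
    and common_nbrs_clique:
      "nonadj u v \<Longrightarrow> x \<in> nbrs u \<inter> nbrs v \<Longrightarrow> y \<in> nbrs u \<inter> nbrs v \<Longrightarrow> x \<noteq> y \<Longrightarrow> E x y"

locale diam_two_clique_mu_graphs = clique_mu_graphs +
  fixes r :: nat
  assumes regular: "u \<in> V \<Longrightarrow> card (nbrs u) = r"
    and common_nbrs_nonempty: "nonadj u v \<Longrightarrow> nbrs u \<inter> nbrs v \<noteq> {}"
    and not_complete: "\<exists>u v. nonadj u v"

context clique_mu_graphs
begin

lemma local_diam_two:
  assumes x: "x \<in> V" and \<mu>: "\<mu> \<ge> 2"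
    and regular: "\<And>v. v \<in> nbrs x \<Longrightarrow> card (nbrs x \<inter> nbrs v) = s"
    and not_complete: "\<exists>v\<in>nbrs x. private_nbrs x v \<noteq> {}"
  shows "diam_two_clique_mu_graphs (nbrs x) E (\<mu> - 1) s"
proof -
  interpret L: finite_graph "nbrs x" E
    by (rule induced_subgraph(1)[OF nbrs_subset])
  have L_nbrs: "L.nbrs v = nbrs x \<inter> nbrs v" for v
    using induced_subgraph(2)[OF nbrs_subset] by blast
  have L_nonadj: "nonadj u v \<and> x \<in> nbrs u \<inter> nbrs v \<and> L.nbrs u \<inter> L.nbrs v = nbrs u \<inter> nbrs v - {x}"
    if "L.nonadj u v" for u v
  proof -
    have uv: "nonadj u v" "x \<in> nbrs u \<inter> nbrs v"
      using that x adj_sym by (auto simp: nonadj_def L.nonadj_def)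
    then show ?thesis
      using common_nbrs_clique[OF uv] adj_irrefl by (auto simp: L_nbrs)
  qed
  have card_L: "card (L.nbrs u \<inter> L.nbrs v) = \<mu> - 1" if "L.nonadj u v" for u v
    using L_nonadj[OF that] card_common_nbrs[of u v] by (auto simp del: in_nbrs)
  show ?thesis
  proof unfold_locales
    show "card (L.nbrs u \<inter> L.nbrs v) = \<mu> - 1" if "L.nonadj u v" for u v
      by (rule card_L[OF that])
    show "L.nbrs u \<inter> L.nbrs v \<noteq> {}" if "L.nonadj u v" for u v
      using card_L[OF that] \<mu> by (metis card.empty diff_is_0_eq not_less_eq_eq numeral_2_eq_2 One_nat_def)
    show "E y z"
      if "L.nonadj u v" "y \<in> L.nbrs u \<inter> L.nbrs v" "z \<in> L.nbrs u \<inter> L.nbrs v" "y \<noteq> z" for u v y z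
      using that L_nonadj[OF that(1)] common_nbrs_clique[of u v y z] by auto
    show "card (L.nbrs v) = s" if "v \<in> nbrs x" for v
      using regular[OF that] by (simp add: L_nbrs)
    show "\<exists>u v. L.nonadj u v"
    proof -
      obtain v w where "v \<in> nbrs x" "w \<in> private_nbrs x v"
        using not_complete by blast
      then show ?thesis
        by (intro exI[of _ v] exI[of _ w]) (auto simp: L.nonadj_def)
    qed
  qed
qed

end

section \<open>Twins\<close>

lemma card_eq_if_adjacent_degrees_eq:
  assumes fin: "finite A" "finite B"
    and nonempty: "\<And>a. a \<in> A \<Longrightarrow> \<exists>b\<in>B. R a b" "\<And>b. b \<in> B \<Longrightarrow> \<exists>a\<in>A. R a b"
    and degrees: "\<And>a b. a \<in> A \<Longrightarrow> b \<in> B \<Longrightarrow> R a b \<Longrightarrow> card {b' \<in> B. R a b'} = card {a' \<in> A. R a' b}"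
  shows "card A = card B"
proof -
  define p where "p a = card {b \<in> B. R a b}" for a
  define q where "q b = card {a \<in> A. R a b}" for b
  have p_pos: "p a > 0" if "a \<in> A" for a
    using fin nonempty(1)[OF that] by (auto simp: p_def card_gt_0_iff)
  have q_pos: "q b > 0" if "b \<in> B" for b
    using fin nonempty(2)[OF that] by (auto simp: q_def card_gt_0_iff)
  have "real (card A) = (\<Sum>a\<in>A. \<Sum>b\<in>{b \<in> B. R a b}. 1 / real (p a))"
  proof -
    have "(\<Sum>b\<in>{b \<in> B. R a b}. 1 / real (p a)) = 1" if "a \<in> A" for a
      using p_pos[OF that] by (simp add: p_def)
    then show ?thesis
      by (simp only: sum_constant cong: sum.cong)
  qed
  also have "\<dots> = (\<Sum>a\<in>A. \<Sum>b\<in>{b \<in> B. R a b}. 1 / real (q b))"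
    by (intro sum.cong refl) (auto simp: degrees p_def q_def)
  also have "\<dots> = (\<Sum>b\<in>B. \<Sum>a\<in>{a \<in> A. R a b}. 1 / real (q b))"
    using fin by (rule sum.swap_restrict)
  also have "\<dots> = real (card B)"
  proof -
    have "(\<Sum>a\<in>{a \<in> A. R a b}. 1 / real (q b)) = 1" if "b \<in> B" for b
      using q_pos[OF that] by (simp add: q_def)
    then show ?thesis
      by (simp only: sum_constant cong: sum.cong)
  qed
  finally show ?thesis
    by simp
qed

context clique_mu_graphs
begin

lemma trace_on_common_nbrs:
  assumes uv: "nonadj u v" and z: "z \<in> nbrs u - nbrs v" and w: "w \<in> nbrs v - nbrs u" and "E z w"
  shows "nbrs z \<inter> (nbrs u \<inter> nbrs v) = nbrs w \<inter> (nbrs u \<inter> nbrs v)"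
proof -
  have sub: "nbrs z \<inter> (nbrs u \<inter> nbrs v) \<subseteq> nbrs w"
    if "nonadj u v" "z \<in> nbrs u - nbrs v" "w \<in> nbrs v - nbrs u" "E z w" for u v z w
  proof
    fix q assume q: "q \<in> nbrs z \<inter> (nbrs u \<inter> nbrs v)"
    have "nonadj z v"
      using that by (auto simp: nonadj_def adj_commute)
    moreover have "q \<in> nbrs z \<inter> nbrs v" "w \<in> nbrs z \<inter> nbrs v" "w \<noteq> q"
      using q that by auto
    ultimately show "q \<in> nbrs w"
      using common_nbrs_clique[of z v w q] q by auto
  qed
  show ?thesis
    using sub[OF assms] sub[OF nonadj_sym[OF uv] w z adj_sym[OF \<open>E z w\<close>]] by blast
qed

end

context diam_two_clique_mu_graphs
begin

lemma card_common_nbrs_nonadj: "nonadj u v \<Longrightarrow> card (nbrs u \<inter> nbrs v) = \<mu>"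
  using card_common_nbrs common_nbrs_nonempty by blast

lemma mu_pos: "\<mu> > 0"
  using not_complete card_common_nbrs_nonadj common_nbrs_nonempty by (metis card_gt_0_iff finite_Int finite_nbrs)

lemma private_nbrs_disjoint:
  assumes "nonadj u v" "m \<in> nbrs u \<inter> nbrs v"
  shows "private_nbrs u m \<inter> nbrs v = {}"
  using common_nbrs_clique[OF assms] by auto

lemma card_nbrs_in_private:
  assumes uv: "nonadj u v" and m: "m \<in> nbrs u \<inter> nbrs v" and z: "z \<in> private_nbrs u m"
  shows "card (nbrs z \<inter> (nbrs u \<inter> nbrs v)) + card (nbrs z \<inter> private_nbrs v m) = \<mu>"
    and "nbrs z \<inter> private_nbrs v m \<noteq> {}"
proof -
  let ?M = "nbrs u \<inter> nbrs v"
  have z_v: "z \<notin> nbrs v" "nonadj z v"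
    using private_nbrs_disjoint[OF uv m] z uv by (auto simp: nonadj_def adj_commute)
  have m_z: "m \<notin> nbrs z"
    using z by (auto simp: adj_commute)
  have "w \<in> private_nbrs v m" if w: "w \<in> nbrs z \<inter> nbrs v" "w \<notin> ?M" for w
  proof -
    have "nbrs z \<inter> ?M = nbrs w \<inter> ?M"
      by (rule trace_on_common_nbrs[OF uv]) (use w z_v z in auto)
    then have "m \<notin> nbrs w"
      using m m_z by blast
    then show ?thesis
      using w m by (auto simp: adj_commute)
  qed
  moreover have "private_nbrs v m \<subseteq> nbrs v"
    by auto
  ultimately have "nbrs z \<inter> nbrs v = nbrs z \<inter> ?M \<union> nbrs z \<inter> private_nbrs v m"
    by blast
  moreover have "?M \<inter> private_nbrs v m = {}"
    using private_nbrs_disjoint[OF nonadj_sym[OF uv], of m] m by blast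
  ultimately have "card (nbrs z \<inter> nbrs v) = card (nbrs z \<inter> ?M) + card (nbrs z \<inter> private_nbrs v m)"
    by (metis card_Un_disjoint finite_Int finite_nbrs inf.left_commute inf_assoc inf_bot_right)
  then show sum: "card (nbrs z \<inter> ?M) + card (nbrs z \<inter> private_nbrs v m) = \<mu>"
    using card_common_nbrs_nonadj[OF z_v(2)] by simp
  have "nbrs z \<inter> ?M \<subset> ?M"
    using m m_z by blast
  then have "card (nbrs z \<inter> ?M) < \<mu>"
    using card_common_nbrs_nonadj[OF uv] by (metis psubset_card_mono finite_Int finite_nbrs)
  then show "nbrs z \<inter> private_nbrs v m \<noteq> {}"
    using sum by auto
qed

lemma card_private_nbrs_eq_at_nonadj:
  assumes uv: "nonadj u v" and m: "m \<in> nbrs u \<inter> nbrs v"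
  shows "card (private_nbrs u m) = card (private_nbrs v m)"
proof (rule card_eq_if_adjacent_degrees_eq[where R = E])
  let ?A = "private_nbrs u m" and ?B = "private_nbrs v m"
  have vu: "nonadj v u" and m': "m \<in> nbrs v \<inter> nbrs u"
    using nonadj_sym[OF uv] m by auto
  have E_B: "{w \<in> ?B. E z w} = nbrs z \<inter> ?B" for z
    by auto
  have E_A: "{z \<in> ?A. E z w} = nbrs w \<inter> ?A" for w
    by (auto simp: adj_commute)
  show "\<exists>w\<in>?B. E z w" if "z \<in> ?A" for z
    using card_nbrs_in_private(2)[OF uv m that] by auto
  show "\<exists>z\<in>?A. E z w" if "w \<in> ?B" for w
    using card_nbrs_in_private(2)[OF vu m' that] adj_sym by fastforce
  fix z w assume zw: "z \<in> ?A" "w \<in> ?B" "E z w"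
  then have "z \<in> nbrs u - nbrs v" "w \<in> nbrs v - nbrs u"
    using private_nbrs_disjoint[OF uv m] private_nbrs_disjoint[OF vu m'] by (auto simp del: in_private_nbrs simp: private_nbrs_def)
  then have "nbrs z \<inter> (nbrs u \<inter> nbrs v) = nbrs w \<inter> (nbrs v \<inter> nbrs u)"
    using trace_on_common_nbrs[OF uv] zw(3) by (simp add: Int_commute)
  then show "card {w' \<in> ?B. E z w'} = card {z' \<in> ?A. E z' w}"
    unfolding E_A E_B
    using card_nbrs_in_private(1)[OF uv m zw(1)] card_nbrs_in_private(1)[OF vu m' zw(2)] by simp
qed simp_all

lemma card_private_nbrs_commute:
  assumes "u \<in> V" "v \<in> nbrs u"
  shows "card (private_nbrs u v) = card (private_nbrs v u)"
  using card_nbrs_split[of v u] card_nbrs_split[of u v] regular assms by (simp add: adj_commute Int_commute)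

definition twins :: "'a \<Rightarrow> 'a set" where
  "twins u = {v \<in> V. cl_nbrs v = cl_nbrs u}"

definition nontwin_adj :: "'a \<Rightarrow> 'a \<Rightarrow> bool" where
  "nontwin_adj u v \<longleftrightarrow> u \<in> V \<and> v \<in> nbrs u \<and> cl_nbrs u \<noteq> cl_nbrs v"

lemma nontwin_adj_sym: "nontwin_adj u v \<Longrightarrow> nontwin_adj v u"
  by (auto simp: nontwin_adj_def adj_commute)

lemma private_nbrs_empty_iff:
  assumes "u \<in> V" "v \<in> nbrs u"
  shows "private_nbrs u v = {} \<longleftrightarrow> cl_nbrs u = cl_nbrs v"
proof
  assume "private_nbrs u v = {}"
  then have "cl_nbrs u \<subseteq> cl_nbrs v"
    using assms by (auto simp: private_nbrs_def adj_commute cl_nbrs_def)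
  moreover have "card (cl_nbrs u) = card (cl_nbrs v)"
    using assms regular by (simp add: card_cl_nbrs)
  ultimately show "cl_nbrs u = cl_nbrs v"
    by (intro card_subset_eq) auto
next
  assume "cl_nbrs u = cl_nbrs v"
  then show "private_nbrs u v = {}"
    by (auto simp: private_nbrs_def cl_nbrs_def simp del: in_nbrs in_private_nbrs)
qed

lemma nontwin_adj_iff:
  "nontwin_adj u v \<longleftrightarrow> u \<in> V \<and> v \<in> nbrs u \<and> private_nbrs u v \<noteq> {}"
  using private_nbrs_empty_iff[of u v] unfolding nontwin_adj_def by blast

lemma card_private_nbrs_eq_at_vertex:
  assumes x: "nontwin_adj m x" and y: "nontwin_adj m y"
  shows "card (private_nbrs m x) = card (private_nbrs m y)"
proof -
  have m: "m \<in> V" and xy: "x \<in> nbrs m" "y \<in> nbrs m"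
    using x y by (auto simp: nontwin_adj_def)
  have eq_if_not_adj: "card (private_nbrs m p) = card (private_nbrs m q)"
    if "p \<in> nbrs m" "q \<in> nbrs m" "\<not> E p q" for p q
  proof (cases "p = q")
    case False
    then have "card (private_nbrs p m) = card (private_nbrs q m)"
      using card_private_nbrs_eq_at_nonadj[of p q m] that m by (auto simp: nonadj_def adj_commute)
    then show ?thesis
      using card_private_nbrs_commute[OF m] that(1,2) by simp
  qed simp
  obtain x' y' where x': "x' \<in> private_nbrs m x" and y': "y' \<in> private_nbrs m y"
    using x y unfolding nontwin_adj_iff by blast
  have x_x': "card (private_nbrs m x) = card (private_nbrs m x')"
    by (rule eq_if_not_adj) (use x' xy in auto)
  have y_y': "card (private_nbrs m y) = card (private_nbrs m y')"
    by (rule eq_if_not_adj) (use y' xy in auto)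
  have "\<not> (E x y \<and> E x y' \<and> E x' y \<and> E x' y')"
  proof
    assume "E x y \<and> E x y' \<and> E x' y \<and> E x' y'"
    then have "y \<in> nbrs x \<inter> nbrs x'" "y' \<in> nbrs x \<inter> nbrs x'" "nonadj x x'"
      using x' y' xy by (auto simp: nonadj_def)
    then show False
      using common_nbrs_clique[of x x' y y'] y' by auto
  qed
  then show ?thesis
    using eq_if_not_adj[of x y] eq_if_not_adj[of x y'] eq_if_not_adj[of x' y] eq_if_not_adj[of x' y']
      x_x' y_y' x' y' xy by auto
qed

lemma ex_nonadj:
  assumes u: "u \<in> V"
  obtains v where "nonadj u v"
proof (rule ccontr)
  assume "\<not> thesis"
  then have "\<not> nonadj u v" for v
    using that by blast
  then have "V \<subseteq> cl_nbrs u"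
    unfolding nonadj_def using u by fastforce
  then have "card V \<le> Suc r"
    using card_mono[OF finite_cl_nbrs] regular[OF u] by (metis card_cl_nbrs)
  moreover obtain a b where ab: "nonadj a b"
    using not_complete by blast
  then have "cl_nbrs a \<subset> V"
    by (auto simp: nonadj_def adj_irrefl)
  then have "card (cl_nbrs a) < card V"
    using finite_verts by (rule psubset_card_mono[rotated])
  moreover have "card (cl_nbrs a) = Suc r"
    using ab regular by (simp add: card_cl_nbrs nonadj_def)
  ultimately show False
    by simp
qed

lemma nontwin_adj_if_nonadj:
  assumes "nonadj u v" "x \<in> nbrs u \<inter> nbrs v"
  shows "nontwin_adj u x"
proof -
  have "v \<in> cl_nbrs x" "v \<notin> cl_nbrs u"
    using assms by (auto simp: nonadj_def adj_commute)
  then show ?thesis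
    using assms by (auto simp: nontwin_adj_def nonadj_def)
qed

lemma ex_nontwin_adj:
  assumes "u \<in> V"
  obtains x where "nontwin_adj u x"
  using ex_nonadj[OF assms] common_nbrs_nonempty nontwin_adj_if_nonadj by (metis ex_in_conv)

lemma nontwin_adj_path:
  assumes u: "u \<in> V" and v: "v \<in> V"
  shows "nontwin_adj u v \<or> (\<exists>x. nontwin_adj u x \<and> nontwin_adj v x)"
proof -
  consider "cl_nbrs u = cl_nbrs v" | "nontwin_adj u v" | "nonadj u v"
    using u v by (auto simp: nontwin_adj_def nonadj_def)
  then show ?thesis
  proof cases
    case 1
    obtain x where x: "nontwin_adj u x"
      using ex_nontwin_adj[OF u] .
    then have "cl_nbrs u \<noteq> cl_nbrs x" "x \<in> cl_nbrs u"
      by (auto simp: nontwin_adj_def)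
    then have "cl_nbrs v \<noteq> cl_nbrs x" "x \<in> cl_nbrs v"
      by (simp_all add: 1 del: in_cl_nbrs)
    then have "nontwin_adj v x"
      using v by (auto simp: nontwin_adj_def)
    then show ?thesis
      using x by blast
  next
    case 3
    then obtain x where "x \<in> nbrs u \<inter> nbrs v"
      using common_nbrs_nonempty by blast
    then show ?thesis
      using nontwin_adj_if_nonadj[OF 3] nontwin_adj_if_nonadj[OF nonadj_sym[OF 3]] by blast
  qed blast
qed

lemma card_private_nbrs_constant:
  obtains a where "a > 0" "\<And>u v. nontwin_adj u v \<Longrightarrow> card (private_nbrs u v) = a"
proof -
  have commute: "card (private_nbrs u v) = card (private_nbrs v u)" if "nontwin_adj u v" for u v
    using card_private_nbrs_commute[of u v] that by (simp add: nontwin_adj_def)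
  have eq: "card (private_nbrs u v) = card (private_nbrs u' v')"
    if uv: "nontwin_adj u v" "nontwin_adj u' v'" for u v u' v'
  proof -
    consider "nontwin_adj u u'" | x where "nontwin_adj u x" "nontwin_adj u' x"
      using nontwin_adj_path[of u u'] uv by (auto simp: nontwin_adj_def)
    then show ?thesis
    proof cases
      case 1
      then show ?thesis
        using card_private_nbrs_eq_at_vertex[OF uv(1) 1] commute[OF 1]
          card_private_nbrs_eq_at_vertex[OF nontwin_adj_sym[OF 1] uv(2)] by simp
    next
      case 2
      then show ?thesis
        using card_private_nbrs_eq_at_vertex[OF uv(1) 2(1)] commute[OF 2(1)] commute[OF 2(2)]
          card_private_nbrs_eq_at_vertex[OF nontwin_adj_sym[OF 2(1)] nontwin_adj_sym[OF 2(2)]]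
          card_private_nbrs_eq_at_vertex[OF 2(2) uv(2)] by simp
    qed
  qed
  obtain u v where uv: "nontwin_adj u v"
    using not_complete ex_nontwin_adj unfolding nonadj_def by metis
  then have "card (private_nbrs u v) > 0"
    by (simp add: nontwin_adj_iff card_gt_0_iff)
  then show ?thesis
    using that eq uv by blast
qed

lemma sum_card_private_nbrs:
  assumes u: "u \<in> V"
  shows "(\<Sum>v\<in>nbrs u. card (private_nbrs v u)) = (card V - Suc r) * \<mu>"
proof -
  define R where "R = V - cl_nbrs u"
  have card_R: "card R = card V - Suc r"
    unfolding R_def using u regular by (subst card_Diff_subset) (auto simp: card_cl_nbrs)
  have "(\<Sum>v\<in>nbrs u. card (private_nbrs v u)) = (\<Sum>v\<in>nbrs u. card (nbrs v \<inter> R))"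
    by (intro sum.cong arg_cong[of _ _ card]) (auto simp: R_def)
  also have "\<dots> = (\<Sum>w\<in>R. card (nbrs w \<inter> nbrs u))"
    by (rule sum_card_nbrs_commute) (auto simp: R_def)
  also have "\<dots> = (\<Sum>w\<in>R. \<mu>)"
    using u by (intro sum.cong refl card_common_nbrs_nonadj) (auto simp: R_def nonadj_def adj_commute)
  finally show ?thesis
    using card_R by simp
qed

lemma twins_subset:
  assumes "u \<in> V"
  shows "twins u \<subseteq> cl_nbrs u" "u \<in> twins u"
proof -
  show "twins u \<subseteq> cl_nbrs u"
  proof
    fix v assume "v \<in> twins u"
    then have "cl_nbrs v = cl_nbrs u"
      by (simp add: twins_def)
    then show "v \<in> cl_nbrs u"
      by (metis in_cl_nbrs)
  qed
  show "u \<in> twins u"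
    using assms by (simp add: twins_def)
qed

lemma finite_twins [simp]: "finite (twins u)"
  using finite_verts by (simp add: twins_def)

lemma card_nontwins:
  assumes a: "\<And>u v. nontwin_adj u v \<Longrightarrow> card (private_nbrs u v) = a" and u: "u \<in> V"
  shows "(Suc r - card (twins u)) * a = (card V - Suc r) * \<mu>"
proof -
  have "card (private_nbrs v u) = (if v \<in> twins u then 0 else a)" if "v \<in> nbrs u" for v
    using a[of v u] private_nbrs_empty_iff[of v u] u that
    by (auto simp: twins_def nontwin_adj_def adj_commute card_eq_0_iff simp del: in_private_nbrs)
  then have "(\<Sum>v\<in>nbrs u. card (private_nbrs v u)) = (\<Sum>v\<in>nbrs u. if v \<in> twins u then 0 else a)"
    by (intro sum.cong) auto
  also have "\<dots> = (\<Sum>v\<in>cl_nbrs u - twins u. a)"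
    by (rule sum.mono_neutral_cong_right) (use twins_subset[OF u] in \<open>auto simp: cl_nbrs_def simp del: in_nbrs\<close>)
  also have "\<dots> = (Suc r - card (twins u)) * a"
    using twins_subset[OF u] regular[OF u] by (simp add: card_Diff_subset card_cl_nbrs)
  finally show ?thesis
    using sum_card_private_nbrs[OF u] by simp
qed

lemma card_twins_constant:
  obtains s where "s > 0" "\<And>u. u \<in> V \<Longrightarrow> card (twins u) = s"
proof -
  obtain a where a: "a > 0" "\<And>u v. nontwin_adj u v \<Longrightarrow> card (private_nbrs u v) = a"
    using card_private_nbrs_constant by blast
  have bounds: "card (twins u) \<le> Suc r" "card (twins u) > 0" if "u \<in> V" for u
    using card_mono[OF finite_cl_nbrs twins_subset(1)[OF that]] regular[OF that] twins_subset(2)[OF that]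
    by (auto simp: card_cl_nbrs card_gt_0_iff)
  obtain u where u: "u \<in> V"
    using not_complete by (auto simp: nonadj_def)
  have "card (twins v) = card (twins u)" if "v \<in> V" for v
  proof -
    have "(Suc r - card (twins v)) * a = (Suc r - card (twins u)) * a"
      using card_nontwins[OF a(2)] u that by simp
    then show ?thesis
      using a(1) bounds(1)[OF u] bounds(1)[OF that] by simp
  qed
  then show ?thesis
    using that bounds(2)[OF u] by blast
qed

end

locale twin_free_diam_two_clique_mu_graphs = diam_two_clique_mu_graphs +
  fixes b :: nat
  assumes card_private_nbrs: "u \<in> V \<Longrightarrow> v \<in> nbrs u \<Longrightarrow> card (private_nbrs u v) = b"
    and b_pos: "b > 0"

context diam_two_clique_mu_graphs
begin

definition twin_closed :: "'a set \<Rightarrow> bool" where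
  "twin_closed B \<longleftrightarrow> B \<subseteq> V \<and> (\<forall>u\<in>B. twins u \<subseteq> B)"

lemma twins_sym: "u \<in> V \<Longrightarrow> v \<in> twins u \<Longrightarrow> u \<in> twins v"
  by (simp add: twins_def)

lemma twin_closed_Int: "twin_closed A \<Longrightarrow> twin_closed B \<Longrightarrow> twin_closed (A \<inter> B)"
  unfolding twin_closed_def by blast

lemma twin_closed_Diff: "twin_closed A \<Longrightarrow> twin_closed B \<Longrightarrow> twin_closed (A - B)"
  unfolding twin_closed_def using twins_sym by blast

lemma twin_closed_verts: "twin_closed V"
  by (auto simp: twin_closed_def twins_def)

lemma twin_closed_cl_nbrs:
  assumes u: "u \<in> V"
  shows "twin_closed (cl_nbrs u)"
  unfolding twin_closed_def
proof (intro conjI ballI subsetI)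
  fix v w assume "v \<in> cl_nbrs u" "w \<in> twins v"
  then have "cl_nbrs w = cl_nbrs v" "u \<in> cl_nbrs v" "w \<in> V"
    using u by (auto simp: twins_def adj_commute)
  then have "u \<in> cl_nbrs w"
    by simp
  then show "w \<in> cl_nbrs u"
    using \<open>w \<in> V\<close> by (auto simp: adj_commute)
qed (use u in auto)

lemma twin_closed_common_nbrs:
  assumes "nonadj u v"
  shows "twin_closed (nbrs u \<inter> nbrs v)"
proof -
  have "nbrs u \<inter> nbrs v = cl_nbrs u \<inter> cl_nbrs v"
    using assms by (auto simp: nonadj_def adj_commute)
  then show ?thesis
    using assms by (simp add: twin_closed_Int twin_closed_cl_nbrs nonadj_def)
qed

lemma twin_closed_private_nbrs:
  assumes "u \<in> V" "v \<in> nbrs u"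
  shows "twin_closed (private_nbrs u v)"
proof -
  have "private_nbrs u v = cl_nbrs u - cl_nbrs v"
    using assms by (auto simp: adj_commute)
  then show ?thesis
    using assms by (simp add: twin_closed_Diff twin_closed_cl_nbrs)
qed

definition twin_transversal :: "'a set \<Rightarrow> bool" where
  "twin_transversal X \<longleftrightarrow> X \<subseteq> V \<and> inj_on cl_nbrs X \<and> cl_nbrs ` X = cl_nbrs ` V"

lemma ex_twin_transversal:
  obtains X where "twin_transversal X"
proof -
  obtain X where "X \<subseteq> V" "inj_on cl_nbrs X" "cl_nbrs ` V = cl_nbrs ` X"
    using subset_image_inj[of "cl_nbrs ` V" cl_nbrs V] by auto
  then show thesis
    using that by (simp add: twin_transversal_def)
qed

lemma twin_in_transversal:
  assumes "twin_transversal X" "u \<in> V"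
  obtains x where "x \<in> X" "cl_nbrs x = cl_nbrs u"
  using assms unfolding twin_transversal_def by (metis imageE imageI)

lemma card_twin_closed:
  assumes s: "\<forall>u\<in>V. card (twins u) = s" and X: "twin_transversal X" and B: "twin_closed B"
  shows "card B = s * card (B \<inter> X)"
proof -
  have "B = (\<Union>x\<in>B \<inter> X. twins x)"
  proof
    show "B \<subseteq> (\<Union>x\<in>B \<inter> X. twins x)"
    proof
      fix u assume u: "u \<in> B"
      then have "u \<in> V"
        using B by (auto simp: twin_closed_def)
      obtain x where x: "x \<in> X" "cl_nbrs x = cl_nbrs u"
        using twin_in_transversal[OF X \<open>u \<in> V\<close>] .
      then have "x \<in> twins u" "u \<in> twins x"
        using X \<open>u \<in> V\<close> by (auto simp: twins_def twin_transversal_def)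
      then show "u \<in> (\<Union>x\<in>B \<inter> X. twins x)"
        using B u x(1) unfolding twin_closed_def by blast
    qed
  qed (use B in \<open>auto simp: twin_closed_def\<close>)
  also have "card \<dots> = (\<Sum>x\<in>B \<inter> X. card (twins x))"
  proof (rule card_UN_disjoint)
    show "finite (B \<inter> X)"
      using X finite_verts by (auto simp: twin_transversal_def intro: finite_subset)
    show "\<forall>x\<in>B \<inter> X. \<forall>y\<in>B \<inter> X. x \<noteq> y \<longrightarrow> twins x \<inter> twins y = {}"
      using X by (auto simp: twins_def twin_transversal_def inj_on_def)
  qed simp
  also have "\<dots> = (\<Sum>x\<in>B \<inter> X. s)"
    using X s by (intro sum.cong) (auto simp: twin_transversal_def)
  finally show ?thesis
    by simp
qed

lemma adj_in_transversal:
  assumes X: "twin_transversal X" and u: "u \<in> V" "x \<in> X" "cl_nbrs x = cl_nbrs u"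
    and v: "v \<in> V" "y \<in> X" "cl_nbrs y = cl_nbrs v" and ne: "cl_nbrs u \<noteq> cl_nbrs v"
  shows "E x y \<longleftrightarrow> E u v"
proof -
  have xy: "x \<in> V" "y \<in> V" "x \<noteq> y" "u \<noteq> v" "x \<noteq> v"
    using X u v ne by (auto simp: twin_transversal_def)
  have "E x y \<longleftrightarrow> x \<in> cl_nbrs y"
    using xy by (auto simp: adj_commute)
  also have "\<dots> \<longleftrightarrow> v \<in> cl_nbrs x"
    unfolding v(3) using xy v by (auto simp: adj_commute)
  also have "\<dots> \<longleftrightarrow> E u v"
    unfolding u(3) using xy v by auto
  finally show ?thesis .
qed

lemma nonadj_in_transversal:
  assumes X: "twin_transversal X"
  obtains x y where "x \<in> X" "y \<in> X" "nonadj x y"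
proof -
  obtain u v where uv: "nonadj u v"
    using not_complete by blast
  then have V: "u \<in> V" "v \<in> V" and ne: "cl_nbrs u \<noteq> cl_nbrs v"
    by (auto simp: nonadj_def cl_nbrs_def set_eq_iff)
  obtain x where x: "x \<in> X" "cl_nbrs x = cl_nbrs u"
    using twin_in_transversal[OF X V(1)] .
  obtain y where y: "y \<in> X" "cl_nbrs y = cl_nbrs v"
    using twin_in_transversal[OF X V(2)] .
  have "\<not> E x y"
    using adj_in_transversal[OF X V(1) x V(2) y ne] uv by (simp add: nonadj_def)
  then have "nonadj x y"
    using x y X ne by (auto simp: nonadj_def twin_transversal_def)
  then show thesis
    using that x y by blast
qed

lemma twin_quotient_cards:
  assumes s: "\<forall>u\<in>V. card (twins u) = s" and X: "twin_transversal X"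
  shows "card V = s * card X"
    and "u \<in> X \<Longrightarrow> Suc r = s * Suc (card (nbrs u \<inter> X))"
    and "nonadj u v \<Longrightarrow> \<mu> = s * card (nbrs u \<inter> nbrs v \<inter> X)"
    and "u \<in> X \<Longrightarrow> v \<in> nbrs u \<Longrightarrow> card (private_nbrs u v) = s * card (private_nbrs u v \<inter> X)"
proof -
  have X_verts: "X \<subseteq> V"
    using X by (simp add: twin_transversal_def)
  show "card V = s * card X"
    using card_twin_closed[OF s X twin_closed_verts] X_verts by (simp add: Int_absorb1)
  show "\<mu> = s * card (nbrs u \<inter> nbrs v \<inter> X)" if "nonadj u v"
    using card_twin_closed[OF s X twin_closed_common_nbrs[OF that]] card_common_nbrs_nonadj[OF that] by simp
  assume u: "u \<in> X"
  have "cl_nbrs u \<inter> X = insert u (nbrs u \<inter> X)"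
    using u by (auto simp: cl_nbrs_def)
  then have "card (cl_nbrs u \<inter> X) = Suc (card (nbrs u \<inter> X))"
    by (simp add: adj_irrefl)
  then show "Suc r = s * Suc (card (nbrs u \<inter> X))"
    using card_twin_closed[OF s X twin_closed_cl_nbrs] regular u X_verts by (auto simp: card_cl_nbrs)
  show "card (private_nbrs u v) = s * card (private_nbrs u v \<inter> X)" if "v \<in> nbrs u"
    using card_twin_closed[OF s X twin_closed_private_nbrs] u that X_verts by blast
qed

lemma twin_quotient:
  assumes s: "s > 0" "\<forall>u\<in>V. card (twins u) = s" and X: "twin_transversal X"
  obtains r' \<mu>' b where "twin_free_diam_two_clique_mu_graphs X E \<mu>' r' b" "Suc r = s * Suc r'" "\<mu> = s * \<mu>'"
proof -
  obtain a where a: "a > 0" "\<And>u v. nontwin_adj u v \<Longrightarrow> card (private_nbrs u v) = a"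
    using card_private_nbrs_constant by blast
  obtain x y where xy: "x \<in> X" "y \<in> X" "nonadj x y"
    using nonadj_in_transversal[OF X] .
  have X_verts: "X \<subseteq> V" and inj: "inj_on cl_nbrs X"
    using X by (auto simp: twin_transversal_def)
  note cards = twin_quotient_cards[OF s(2) X]
  interpret X: finite_graph X E
    by (rule induced_subgraph(1)[OF X_verts])
  note X_nbrs = induced_subgraph(2)[OF X_verts] and X_private = induced_subgraph(3)[OF X_verts]
  have X_nonadj: "nonadj u v" if "X.nonadj u v" for u v
    using that induced_subgraph(4)[OF X_verts] by blast
  have nontwin: "nontwin_adj u v" if "u \<in> X" "v \<in> X.nbrs u" for u v
    using that X_verts inj adj_irrefl by (auto simp: nontwin_adj_def inj_on_def)
  have "twin_free_diam_two_clique_mu_graphs X E (card (nbrs x \<inter> nbrs y \<inter> X)) (card (nbrs x \<inter> X)) (a div s)"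
  proof unfold_locales
    show "card (X.nbrs u) = card (nbrs x \<inter> X)" if "u \<in> X" for u
      using cards(2)[OF that] cards(2)[OF xy(1)] s(1) by (simp add: X_nbrs)
    have card_common: "\<mu> = s * card (X.nbrs u \<inter> X.nbrs v)" if "X.nonadj u v" for u v
      using cards(3)[OF X_nonadj[OF that]] by (simp add: X_nbrs Int_ac)
    then show "card (X.nbrs u \<inter> X.nbrs v) = card (nbrs x \<inter> nbrs y \<inter> X)" if "X.nonadj u v" for u v
      using that cards(3)[OF xy(3)] s(1) by (metis mult_cancel1 not_gr_zero)
    show "X.nbrs u \<inter> X.nbrs v \<noteq> {}" if "X.nonadj u v" for u v
      using card_common[OF that] mu_pos by auto
    show "E v w" if "X.nonadj u u'" "v \<in> X.nbrs u \<inter> X.nbrs u'" "w \<in> X.nbrs u \<inter> X.nbrs u'" "v \<noteq> w" for u u' v w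
      using that common_nbrs_clique[OF X_nonadj[OF that(1)], of v w] by (auto simp: X_nbrs)
    show "\<exists>u v. X.nonadj u v"
      using xy by (auto simp: X.nonadj_def nonadj_def)
    have card_private: "a = s * card (X.private_nbrs u v)" if "u \<in> X" "v \<in> X.nbrs u" for u v
      using cards(4)[OF that(1), of v] that(2) a(2)[OF nontwin[OF that]] by (auto simp: X_private X_nbrs)
    then show "card (X.private_nbrs u v) = a div s" if "u \<in> X" "v \<in> X.nbrs u" for u v
      using that s(1) by simp
    have "nbrs x \<inter> nbrs y \<inter> X \<noteq> {}"
      using cards(3)[OF xy(3)] mu_pos by (metis card.empty less_irrefl mult_0_right)
    then obtain z where z: "z \<in> nbrs x \<inter> nbrs y \<inter> X"
      by blast
    show "a div s > 0"
      using card_private[OF xy(1), of z] z a(1) s(1) by (auto simp: X_nbrs)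
  qed
  then show thesis
    using that cards(2)[OF xy(1)] cards(3)[OF xy(3)] by blast
qed

end

context twin_free_diam_two_clique_mu_graphs
begin

lemma degree_times_private: "r * b = (card V - Suc r) * \<mu>"
proof -
  obtain u where u: "u \<in> V"
    using not_complete by (auto simp: nonadj_def)
  have "(\<Sum>v\<in>nbrs u. card (private_nbrs v u)) = (\<Sum>v\<in>nbrs u. b)"
    by (intro sum.cong refl card_private_nbrs) (use u adj_sym in auto)
  then show ?thesis
    using sum_card_private_nbrs[OF u] regular[OF u] by simp
qed

lemma private_nbrs_nonempty: "u \<in> V \<Longrightarrow> v \<in> nbrs u \<Longrightarrow> private_nbrs u v \<noteq> {}"
  using card_private_nbrs b_pos by (metis card.empty less_irrefl)

lemma degree_ge: "r \<ge> Suc \<mu>"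
proof -
  obtain u v where uv: "nonadj u v"
    using not_complete by blast
  then obtain x where x: "x \<in> nbrs u \<inter> nbrs v"
    using common_nbrs_nonempty by blast
  have "private_nbrs u x \<noteq> {}"
    by (rule private_nbrs_nonempty) (use uv x in \<open>auto simp: nonadj_def\<close>)
  then have "nbrs u \<inter> nbrs v \<subset> nbrs u"
    using private_nbrs_disjoint[OF uv x] by (auto simp del: in_nbrs simp: private_nbrs_def)
  then show ?thesis
    using psubset_card_mono[OF finite_nbrs] card_common_nbrs_nonadj[OF uv] regular uv
    by (metis Suc_leI nonadj_def)
qed

lemma nbrs_nonempty: "u \<in> V \<Longrightarrow> nbrs u \<noteq> {}"
  using regular degree_ge by (metis card.empty not_less_eq_eq zero_le)

lemma private_less_degree: "b < r"
proof -
  obtain u where u: "u \<in> V"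
    using not_complete by (auto simp: nonadj_def)
  then obtain v where "v \<in> nbrs u"
    using nbrs_nonempty by blast
  then show ?thesis
    using card_nbrs_split[of v u] card_private_nbrs[OF u] regular[OF u] by simp
qed

lemma nonadj_in_nbrs:
  assumes u: "u \<in> V"
  obtains v w where "nonadj v w" "u \<in> nbrs v \<inter> nbrs w"
proof -
  obtain v where v: "v \<in> nbrs u"
    using nbrs_nonempty[OF u] by blast
  then obtain w where "w \<in> private_nbrs u v"
    using private_nbrs_nonempty[OF u] by blast
  then show thesis
    using that[of v w] u v by (auto simp: nonadj_def adj_commute)
qed

lemma card_local_common_nbrs:
  assumes "nonadj v w" "u \<in> nbrs v \<inter> nbrs w"
  shows "card (nbrs u \<inter> nbrs v \<inter> nbrs w) = \<mu> - 1"
proof -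
  have "nbrs u \<inter> nbrs v \<inter> nbrs w = nbrs v \<inter> nbrs w - {u}"
    using common_nbrs_clique[OF assms] adj_irrefl by auto
  then show ?thesis
    using card_common_nbrs_nonadj[OF assms(1)] assms(2) by simp
qed

lemma degree_le: "Suc r \<le> \<mu> + 2 * b"
proof -
  obtain u where u: "u \<in> V"
    using not_complete by (auto simp: nonadj_def)
  obtain v w where vw: "nonadj v w" "u \<in> nbrs v \<inter> nbrs w"
    using nonadj_in_nbrs[OF u] .
  then have uvw: "v \<in> nbrs u" "w \<in> nbrs u"
    by (auto simp: nonadj_def adj_commute)
  have "nbrs u \<subseteq> private_nbrs u v \<union> private_nbrs u w \<union> (nbrs u \<inter> nbrs v \<inter> nbrs w)"
    using vw by (auto simp: nonadj_def adj_commute)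
  then have "card (nbrs u) \<le> card (private_nbrs u v \<union> private_nbrs u w \<union> (nbrs u \<inter> nbrs v \<inter> nbrs w))"
    by (intro card_mono) auto
  also have "\<dots> \<le> card (private_nbrs u v) + card (private_nbrs u w) + card (nbrs u \<inter> nbrs v \<inter> nbrs w)"
    by (meson card_Un_le add_right_mono order_trans)
  also have "\<dots> = 2 * b + (\<mu> - 1)"
    using card_private_nbrs[OF u] uvw card_local_common_nbrs[OF vw] by simp
  finally show ?thesis
    using regular[OF u] mu_pos by simp
qed

text \<open>Inside the neighbourhood of \<open>u\<close>, count the pairs of nonadjacent vertices with one vertex among the
  common neighbours of \<open>v\<close> and \<open>w\<close> and the other outside of them.\<close>

lemma local_nonadj_count: "(\<mu> - 1) * b \<le> (r - Suc \<mu>) * (b - 1)"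
proof -
  obtain u where u: "u \<in> V"
    using not_complete by (auto simp: nonadj_def)
  obtain v w where vw: "nonadj v w" "u \<in> nbrs v \<inter> nbrs w"
    using nonadj_in_nbrs[OF u] .
  define C where "C = nbrs u \<inter> nbrs v \<inter> nbrs w"
  define D where "D = nbrs u - C - {v, w}"
  have u_vw: "v \<in> nbrs u" "w \<in> nbrs u" and vw_C: "v \<notin> C" "w \<notin> C" "v \<noteq> w"
    using vw adj_irrefl by (auto simp: C_def nonadj_def adj_commute)
  have C: "C \<subseteq> nbrs u" "card C = \<mu> - 1" "finite C"
    using card_local_common_nbrs[OF vw] by (auto simp: C_def)
  have "card D = card (nbrs u - C) - card {v, w}"
    unfolding D_def by (rule card_Diff_subset) (use u_vw vw_C in auto)
  then have card_D: "card D = r - Suc \<mu>"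
    using C regular[OF u] vw_C mu_pos by (simp add: card_Diff_subset)
  have private_C: "{z \<in> D. \<not> E c z} = private_nbrs u c" if c: "c \<in> C" for c
    using common_nbrs_clique[OF vw(1), of c] c vw adj_irrefl by (auto simp: C_def D_def adj_commute)
  have private_D: "card {c \<in> C. \<not> E c z} \<le> b - 1" if z: "z \<in> D" for z
  proof -
    obtain t where t: "t \<in> {v, w}" "\<not> E z t"
      using z by (auto simp: D_def C_def adj_commute)
    have t_private: "t \<in> private_nbrs u z"
      using t u_vw z by (auto simp: D_def)
    have "{c \<in> C. \<not> E c z} \<subseteq> private_nbrs u z - {t}"
      using z C(1) t vw_C by (auto simp: D_def adj_commute)
    then have "card {c \<in> C. \<not> E c z} \<le> card (private_nbrs u z - {t})"
      by (intro card_mono) auto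
    also have "\<dots> = b - 1"
      using t_private card_private_nbrs[OF u, of z] z by (simp add: D_def del: in_private_nbrs)
    finally show ?thesis .
  qed
  have "(\<mu> - 1) * b = (\<Sum>c\<in>C. card {z \<in> D. \<not> E c z})"
    using C private_C card_private_nbrs[OF u] by (auto simp: subset_iff)
  also have "\<dots> = (\<Sum>z\<in>D. card {c \<in> C. \<not> E c z})"
    by (rule sum_multicount_gen) (auto simp: C D_def)
  also have "\<dots> \<le> (\<Sum>z\<in>D. b - 1)"
    by (intro sum_mono private_D)
  finally show ?thesis
    using card_D by simp
qed

lemma degree_ge_twice_mu:
  assumes "\<mu> \<ge> 2"
  shows "r \<ge> 2 * \<mu> + 1"
proof (rule ccontr)
  assume "\<not> ?thesis"
  then have "r - Suc \<mu> \<le> \<mu> - 1"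
    by simp
  then have "(\<mu> - 1) * b \<le> (\<mu> - 1) * (b - 1)"
    using local_nonadj_count by (meson le_trans mult_le_mono1)
  then show False
    using assms b_pos by auto
qed

lemma local_graph:
  assumes \<mu>: "\<mu> \<ge> 2" and u: "u \<in> V"
  shows "diam_two_clique_mu_graphs (nbrs u) E (\<mu> - 1) (r - 1 - b)"
proof (rule local_diam_two[OF u \<mu>])
  show "card (nbrs u \<inter> nbrs v) = r - 1 - b" if "v \<in> nbrs u" for v
    using card_nbrs_split[OF that] regular[OF u] card_private_nbrs[OF u that] by simp
  show "\<exists>v\<in>nbrs u. private_nbrs u v \<noteq> {}"
    using nonadj_in_nbrs[OF u] private_nbrs_nonempty[OF u] by (metis IntD1 adj_sym in_nbrs nonadj_def)
qed

lemma private_le_mu: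
  assumes "card V \<le> 2 * Suc r"
  shows "b \<le> \<mu>"
proof (rule ccontr)
  assume "\<not> ?thesis"
  then have "r * Suc \<mu> \<le> r * b"
    by (intro mult_le_mono2) simp
  also have "\<dots> = (card V - Suc r) * \<mu>"
    by (rule degree_times_private)
  also have "\<dots> \<le> Suc r * \<mu>"
    using assms by (intro mult_le_mono1) simp
  finally have "r \<le> \<mu>"
    by simp
  then show False
    using degree_ge by simp
qed

lemma mu_eq_1_if_small:
  assumes "card V \<le> 2 * Suc r"
  shows "\<mu> = 1"
proof (rule ccontr)
  assume "\<mu> \<noteq> 1"
  then have \<mu>: "\<mu> \<ge> 2"
    using mu_pos by simp
  note bound = private_le_mu[OF assms]
  obtain u where u: "u \<in> V"
    using not_complete by (auto simp: nonadj_def)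
  interpret L: diam_two_clique_mu_graphs "nbrs u" E "\<mu> - 1" "r - 1 - b"
    by (rule local_graph[OF \<mu> u])
  obtain s where s: "s > 0" "\<forall>v\<in>nbrs u. card (L.twins v) = s"
    using L.card_twins_constant by metis
  obtain X where X: "L.twin_transversal X"
    using L.ex_twin_transversal .
  obtain r' \<mu>' b' where Q: "twin_free_diam_two_clique_mu_graphs X E \<mu>' r' b'"
      "Suc (r - 1 - b) = s * Suc r'" "\<mu> - 1 = s * \<mu>'"
    using L.twin_quotient[OF s X] .
  interpret Q: twin_free_diam_two_clique_mu_graphs X E \<mu>' r' b'
    by (rule Q(1))
  have degree: "r - b = s * Suc r'"
    using Q(2) private_less_degree by simp
  have "\<mu>' = 1"
  proof (rule ccontr)
    assume "\<mu>' \<noteq> 1"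
    then have "s * (2 * \<mu>' + 2) \<le> s * Suc r'"
      using Q.degree_ge_twice_mu Q.mu_pos by (intro mult_le_mono2) simp
    then have "2 * (s * \<mu>') + 2 * s \<le> r - b"
      using degree by (simp add: algebra_simps)
    then show False
      using Q(3) s(1) degree_le bound \<mu> by linarith
  qed
  then have "s * 3 \<le> r - b" "s = \<mu> - 1"
    using Q.degree_ge degree Q(3) by simp_all
  then have "\<mu> = 2" "b = 2" "r = 5"
    using degree_le bound \<mu> by linarith+
  then have "card V = 11"
    using degree_times_private by simp
  moreover have "(\<Sum>v\<in>V. card (nbrs v)) = card V * 5"
    using regular \<open>r = 5\<close> by simp
  ultimately show False
    using even_sum_degrees by simp
qed

lemma pentagon_if_small:
  assumes "card V \<le> 2 * Suc r"
  shows "\<mu> = 1" "r = 2" "b = 1" "card V = 5"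
proof -
  show \<mu>: "\<mu> = 1"
    by (rule mu_eq_1_if_small[OF assms])
  show b: "b = 1"
    using private_le_mu[OF assms] b_pos \<mu> by simp
  show r: "r = 2"
    using degree_le degree_ge \<mu> b by simp
  show "card V = 5"
    using degree_times_private \<mu> b r by simp
qed

lemma triangle_free_if_small:
  assumes "card V \<le> 2 * Suc r" and u: "u \<in> V" "v \<in> nbrs u"
  shows "nbrs u \<inter> nbrs v = {}"
proof -
  have "card (nbrs u \<inter> nbrs v) = 0"
    using card_nbrs_split[OF u(2)] regular[OF u(1)] card_private_nbrs[OF u] pentagon_if_small[OF assms(1)] by simp
  then show ?thesis
    by (metis card_0_eq finite_Int finite_nbrs)
qed

end

context diam_two_clique_mu_graphs
begin

lemma blown_up_pentagon_if_small:
  assumes "card V \<le> 2 * Suc r"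
  shows "card V = 5 * \<mu>" "Suc r = 3 * \<mu>" "\<forall>u\<in>V. card (twins u) = \<mu>"
    and "\<And>u v w. nontwin_adj u v \<Longrightarrow> nontwin_adj v w \<Longrightarrow> \<not> nontwin_adj u w"
proof -
  obtain s where s: "s > 0" "\<forall>u\<in>V. card (twins u) = s"
    using card_twins_constant by metis
  obtain X where X: "twin_transversal X"
    using ex_twin_transversal .
  obtain r' \<mu>' b where Q: "twin_free_diam_two_clique_mu_graphs X E \<mu>' r' b" "Suc r = s * Suc r'" "\<mu> = s * \<mu>'"
    using twin_quotient[OF s X] .
  interpret Q: twin_free_diam_two_clique_mu_graphs X E \<mu>' r' b
    by (rule Q(1))
  have "s * card X \<le> s * (2 * Suc r')"
    using assms twin_quotient_cards(1)[OF s(2) X] Q(2) by simp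
  then have small: "card X \<le> 2 * Suc r'"
    using s(1) by (simp only: mult_le_cancel1)
  show "card V = 5 * \<mu>" "Suc r = 3 * \<mu>" "\<forall>u\<in>V. card (twins u) = \<mu>"
    using twin_quotient_cards(1)[OF s(2) X] Q(2,3) s(2) Q.pentagon_if_small[OF small] by simp_all
  fix u v w assume uv: "nontwin_adj u v" and vw: "nontwin_adj v w"
  show "\<not> nontwin_adj u w"
  proof
    assume uw: "nontwin_adj u w"
    have V: "u \<in> V" "v \<in> V" "w \<in> V"
      using uv vw by (auto simp: nontwin_adj_def)
    obtain x where x: "x \<in> X" "cl_nbrs x = cl_nbrs u"
      using twin_in_transversal[OF X V(1)] .
    obtain y where y: "y \<in> X" "cl_nbrs y = cl_nbrs v"
      using twin_in_transversal[OF X V(2)] .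
    obtain z where z: "z \<in> X" "cl_nbrs z = cl_nbrs w"
      using twin_in_transversal[OF X V(3)] .
    have "E x y" "E y z" "E x z"
      using adj_in_transversal[OF X V(1) x V(2) y] adj_in_transversal[OF X V(2) y V(3) z]
        adj_in_transversal[OF X V(1) x V(3) z] uv vw uw by (simp_all add: nontwin_adj_def)
    then have "y \<in> Q.nbrs x" "z \<in> Q.nbrs x \<inter> Q.nbrs y"
      using y z by auto
    then show False
      using Q.triangle_free_if_small[OF small x(1)] by blast
  qed
qed

end

section \<open>Amply regular Terwilliger graphs\<close>

text \<open>Connectedness is expressed by the absence of proper nonempty subsets closed under adjacency.\<close>

locale amply_regular_clique_mu_graphs = clique_mu_graphs V E \<beta>
  for V :: "'a set" and E :: "'a \<Rightarrow> 'a \<Rightarrow> bool" and \<beta> :: nat +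
  fixes d \<alpha> :: nat
  assumes degree: "u \<in> V \<Longrightarrow> card (nbrs u) = d"
    and card_common_nbrs_adj: "u \<in> V \<Longrightarrow> v \<in> nbrs u \<Longrightarrow> card (nbrs u \<inter> nbrs v) = \<alpha>"
    and closed_subset_eq: "S \<subseteq> V \<Longrightarrow> S \<noteq> {} \<Longrightarrow> (\<And>u. u \<in> S \<Longrightarrow> nbrs u \<subseteq> S) \<Longrightarrow> S = V"
    and not_complete: "\<exists>u v. nonadj u v"
begin

lemma verts_nonempty: "V \<noteq> {}"
  using not_complete by (auto simp: nonadj_def)

lemma nbrs_nonempty:
  assumes "u \<in> V"
  shows "nbrs u \<noteq> {}"
proof
  assume "nbrs u = {}"
  then have "{u} = V"
    using assms by (intro closed_subset_eq) auto
  then show False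
    using not_complete by (auto simp: nonadj_def)
qed

lemma card_private_nbrs_adj:
  assumes "u \<in> V" "v \<in> nbrs u"
  shows "d = Suc (\<alpha> + card (private_nbrs u v))"
  using card_nbrs_split[OF assms(2)] degree card_common_nbrs_adj assms by simp

lemma alpha_less: "Suc \<alpha> < d"
proof (rule ccontr)
  assume "\<not> Suc \<alpha> < d"
  then have "card (private_nbrs u v) = 0" if "u \<in> V" "v \<in> nbrs u" for u v
    using card_private_nbrs_adj[OF that] by simp
  then have no_private: "private_nbrs u v = {}" if "u \<in> V" "v \<in> nbrs u" for u v
    using that by (metis card_0_eq finite_private_nbrs)
  obtain u v where uv: "nonadj u v"
    using not_complete by blast
  have "cl_nbrs u = V"
  proof (rule closed_subset_eq)
    fix x assume "x \<in> cl_nbrs u"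
    then have "x = u \<or> x \<in> V \<and> u \<in> nbrs x"
      using uv by (auto simp: nonadj_def adj_commute)
    then show "nbrs x \<subseteq> cl_nbrs u"
      using no_private[of x u] by (auto simp del: in_private_nbrs simp: private_nbrs_def cl_nbrs_def)
  qed (use uv in \<open>auto simp: nonadj_def\<close>)
  then show False
    using uv by (auto simp: nonadj_def)
qed

lemma private_nbrs_nonempty:
  assumes "u \<in> V" "v \<in> nbrs u"
  shows "private_nbrs u v \<noteq> {}"
  using card_private_nbrs_adj[OF assms] alpha_less by auto

lemma beta_pos: "\<beta> > 0"
proof -
  obtain u where u: "u \<in> V"
    using verts_nonempty by blast
  obtain v where v: "v \<in> nbrs u"
    using nbrs_nonempty[OF u] by blast
  obtain w where "w \<in> private_nbrs u v"
    using private_nbrs_nonempty[OF u v] by blast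
  then have "nonadj v w" "u \<in> nbrs v \<inter> nbrs w"
    using u v by (auto simp: nonadj_def adj_commute)
  then show ?thesis
    using card_common_nbrs by (metis card_gt_0_iff empty_iff finite_Int finite_nbrs)
qed

lemma local_graph:
  assumes x: "x \<in> V" and \<beta>: "\<beta> \<ge> 2"
  shows "diam_two_clique_mu_graphs (nbrs x) E (\<beta> - 1) \<alpha>"
proof (rule local_diam_two[OF x \<beta>])
  show "card (nbrs x \<inter> nbrs v) = \<alpha>" if "v \<in> nbrs x" for v
    by (rule card_common_nbrs_adj[OF x that])
  show "\<exists>v\<in>nbrs x. private_nbrs x v \<noteq> {}"
    using nbrs_nonempty[OF x] private_nbrs_nonempty[OF x] by blast
qed

text \<open>A triple is special iff two of its vertices are twins in the local graph at the third one; the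
  definition is symmetric in the three vertices.\<close>

definition special :: "'a \<Rightarrow> 'a \<Rightarrow> 'a \<Rightarrow> bool" where
  "special x y z \<longleftrightarrow> E x y \<and> E y z \<and> E x z \<and> Suc (card (nbrs x \<inter> nbrs y \<inter> nbrs z)) = \<alpha>"

lemma special_permute: "special x y z \<Longrightarrow> special y x z" "special x y z \<Longrightarrow> special x z y"
  using adj_sym by (auto simp: special_def Int_ac)

lemma special_iff:
  assumes x: "x \<in> V" and yz: "y \<in> nbrs x" "z \<in> nbrs x" "y \<noteq> z"
  shows "special x y z \<longleftrightarrow> cl_nbrs y \<inter> nbrs x = cl_nbrs z \<inter> nbrs x"
proof (cases "E y z")
  case True
  let ?A = "nbrs x \<inter> nbrs y" and ?B = "nbrs x \<inter> nbrs z"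
  have z_A: "z \<in> ?A" "z \<notin> ?B" and y_B: "y \<in> ?B" "y \<notin> ?A"
    using yz True adj_irrefl by (auto simp: adj_commute)
  have cards: "card (?A - {z}) = \<alpha> - 1" "card (?B - {y}) = \<alpha> - 1"
    using card_common_nbrs_adj[OF x yz(1)] card_common_nbrs_adj[OF x yz(2)] z_A(1) y_B(1)
    by (simp_all only: card_Diff_singleton)
  have "\<alpha> > 0"
    using card_common_nbrs_adj[OF x yz(1)] z_A(1) by (metis card_gt_0_iff empty_iff finite_Int finite_nbrs)
  have sub: "?A \<inter> ?B \<subseteq> ?A - {z}" "?A \<inter> ?B \<subseteq> ?B - {y}"
    using z_A y_B by blast+
  have "special x y z \<longleftrightarrow> card (?A \<inter> ?B) = \<alpha> - 1"
    using True yz \<open>\<alpha> > 0\<close> by (auto simp: special_def Int_ac)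
  also have "\<dots> \<longleftrightarrow> ?A \<inter> ?B = ?A - {z} \<and> ?A \<inter> ?B = ?B - {y}"
  proof -
    have "card (?A \<inter> ?B) = \<alpha> - 1 \<longleftrightarrow> ?A \<inter> ?B = ?A - {z}"
      unfolding cards(1)[symmetric] by (metis card_subset_eq finite_Diff finite_Int finite_nbrs sub(1))
    moreover have "card (?A \<inter> ?B) = \<alpha> - 1 \<longleftrightarrow> ?A \<inter> ?B = ?B - {y}"
      unfolding cards(2)[symmetric] by (metis card_subset_eq finite_Diff finite_Int finite_nbrs sub(2))
    ultimately show ?thesis
      by blast
  qed
  also have "\<dots> \<longleftrightarrow> insert y ?A = insert z ?B"
    using z_A y_B by blast
  also have "insert y ?A = cl_nbrs y \<inter> nbrs x"
    using yz by (auto simp: cl_nbrs_def)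
  also have "insert z ?B = cl_nbrs z \<inter> nbrs x"
    using yz by (auto simp: cl_nbrs_def)
  finally show ?thesis .
next
  case False
  then have "z \<notin> cl_nbrs y \<inter> nbrs x" "z \<in> cl_nbrs z \<inter> nbrs x"
    using yz by auto
  then show ?thesis
    using False by (auto simp: special_def simp del: in_cl_nbrs in_nbrs)
qed

lemma special_trans:
  assumes "x \<in> V" "u \<in> nbrs x" "v \<in> nbrs x" "w \<in> nbrs x" "u \<noteq> w" "special x u v" "special x v w"
  shows "special x u w"
proof -
  have "u \<noteq> v" "v \<noteq> w"
    using assms(6,7) adj_irrefl by (auto simp: special_def)
  then show ?thesis
    using assms special_iff by metis
qed

lemma local_twins_eq:
  assumes x: "x \<in> V" and \<beta>: "\<beta> \<ge> 2" and y: "y \<in> nbrs x"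
  shows "diam_two_clique_mu_graphs.twins (nbrs x) E y = insert y {z \<in> nbrs x. special x y z}"
proof -
  interpret L: diam_two_clique_mu_graphs "nbrs x" E "\<beta> - 1" \<alpha>
    by (rule local_graph[OF x \<beta>])
  have cl: "L.cl_nbrs z = cl_nbrs z \<inter> nbrs x" if "z \<in> nbrs x" for z
    using that by auto
  have "z \<in> L.twins y \<longleftrightarrow> z = y \<or> special x y z" if "z \<in> nbrs x" for z
    using special_iff[OF x y that] cl[OF y] cl[OF that] that by (cases "z = y") (auto simp: L.twins_def)
  then show ?thesis
    using y by (auto simp: L.twins_def simp del: in_nbrs)
qed

context
  assumes beta_ge_2: "\<beta> \<ge> 2" and degree_le: "d \<le> 2 * Suc \<alpha>"
begin

lemma card_nbrs_le: "x \<in> V \<Longrightarrow> card (nbrs x) \<le> 2 * Suc \<alpha>"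
  using degree degree_le by simp

lemma degree_eq_5_beta: "d = 5 * (\<beta> - 1)" and alpha_eq_3_beta: "Suc \<alpha> = 3 * (\<beta> - 1)"
proof -
  obtain x where x: "x \<in> V"
    using verts_nonempty by blast
  interpret L: diam_two_clique_mu_graphs "nbrs x" E "\<beta> - 1" \<alpha>
    by (rule local_graph[OF x beta_ge_2])
  show "d = 5 * (\<beta> - 1)" "Suc \<alpha> = 3 * (\<beta> - 1)"
    using L.blown_up_pentagon_if_small(1,2)[OF card_nbrs_le[OF x]] degree[OF x] by simp_all
qed

lemma card_special:
  assumes x: "x \<in> V" and y: "y \<in> nbrs x"
  shows "Suc (card {z \<in> nbrs x. special x y z}) = \<beta> - 1"
proof -
  interpret L: diam_two_clique_mu_graphs "nbrs x" E "\<beta> - 1" \<alpha>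
    by (rule local_graph[OF x beta_ge_2])
  have "Suc (card {z \<in> nbrs x. special x y z}) = card (L.twins y)"
    unfolding local_twins_eq[OF x beta_ge_2 y]
    by (subst card_insert_disjoint) (auto simp: special_def adj_irrefl finite_verts)
  also have "\<dots> = \<beta> - 1"
    using L.blown_up_pentagon_if_small(3)[OF card_nbrs_le[OF x]] y by blast
  finally show ?thesis .
qed

lemma special_in_local_triangle:
  assumes x: "x \<in> V" and uvw: "u \<in> nbrs x" "v \<in> nbrs x" "w \<in> nbrs x" "E u v" "E v w" "E u w"
  shows "special x u v \<or> special x v w \<or> special x u w"
proof -
  interpret L: diam_two_clique_mu_graphs "nbrs x" E "\<beta> - 1" \<alpha>
    by (rule local_graph[OF x beta_ge_2])
  have "special x p q" if pq: "p \<in> nbrs x" "q \<in> nbrs x" "E p q" "\<not> L.nontwin_adj p q" for p q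
  proof -
    have "L.cl_nbrs p = L.cl_nbrs q"
      using pq by (simp add: L.nontwin_adj_def)
    then have "q \<in> L.twins p"
      using pq(2) by (simp add: L.twins_def)
    moreover have "p \<noteq> q"
      using pq(3) adj_irrefl by blast
    ultimately show ?thesis
      unfolding local_twins_eq[OF x beta_ge_2 pq(1)] by blast
  qed
  then show ?thesis
    using L.blown_up_pentagon_if_small(4)[OF card_nbrs_le[OF x], of u v w] uvw by blast
qed

lemma ex_special:
  assumes "\<beta> \<ge> 3" "x \<in> V" "y \<in> nbrs x"
  obtains z where "z \<in> nbrs x" "special x y z"
proof -
  have "card {z \<in> nbrs x. special x y z} > 0"
    using card_special[OF assms(2,3)] assms(1) by linarith
  then show thesis
    using that by (auto simp: card_gt_0_iff)
qed

lemma ex_not_special: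
  assumes x: "x \<in> V" and y: "y \<in> nbrs x"
  obtains z where "z \<in> nbrs x \<inter> nbrs y" "\<not> special x y z"
proof -
  have "card {z \<in> nbrs x. special x y z} < card (nbrs x \<inter> nbrs y)"
    using card_special[OF x y] alpha_eq_3_beta card_common_nbrs_adj[OF x y] beta_ge_2 by linarith
  then have "\<not> nbrs x \<inter> nbrs y \<subseteq> {z \<in> nbrs x. special x y z}"
    using card_mono[of "{z \<in> nbrs x. special x y z}" "nbrs x \<inter> nbrs y"] by (auto simp: finite_verts)
  then show thesis
    using that by blast
qed

text \<open>If \<open>z'\<close> is a twin of \<open>z\<close> at \<open>x\<close>, but \<open>y\<close> is not, then \<open>z\<close> and \<open>z'\<close> are twins at \<open>y\<close> too; so
  \<open>x\<close> and \<open>y\<close> are both twins of \<open>z'\<close> at \<open>z\<close>, which makes \<open>x\<close>, \<open>y\<close>, \<open>z\<close> special.\<close>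

lemma beta_eq_2: "\<beta> = 2"
proof (rule ccontr)
  assume "\<beta> \<noteq> 2"
  then have \<beta>: "\<beta> \<ge> 3"
    using beta_ge_2 by simp
  obtain x where x: "x \<in> V"
    using verts_nonempty by blast
  obtain y where y: "y \<in> nbrs x"
    using nbrs_nonempty[OF x] by blast
  obtain z where z: "z \<in> nbrs x \<inter> nbrs y" and xyz: "\<not> special x y z"
    using ex_not_special[OF x y] .
  obtain z' where z': "z' \<in> nbrs x" and xzz': "special x z z'"
    using ex_special[OF \<beta> x IntD1[OF z]] .
  have ne: "z \<noteq> z'" "y \<noteq> z'" "x \<noteq> y" "y \<noteq> z"
    using xzz' xyz special_permute(2)[of x z y] y z adj_irrefl by (auto simp: special_def)
  have "y \<in> cl_nbrs z \<inter> nbrs x"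
    using y z by (auto simp: adj_commute)
  also have "\<dots> = cl_nbrs z' \<inter> nbrs x"
    using special_iff[OF x IntD1[OF z] z' ne(1)] xzz' by simp
  finally have adj: "E y z'" "E z z'" "E x z'"
    using xzz' ne by (auto simp: special_def adj_commute)
  have xyz': "\<not> special x y z'"
    using special_trans[OF x y z' IntD1[OF z] ne(4)] xyz special_permute(2)[OF xzz'] by blast
  have "special y x z \<or> special y z z' \<or> special y x z'"
    by (rule special_in_local_triangle) (use x y z z' adj in \<open>simp_all add: adj_commute\<close>)
  then have "special y z z'"
    using xyz xyz' special_permute(1) by blast
  then have "special z x z'" "special z z' y"
    using special_permute[of y z z'] special_permute[of x z z'] special_permute(2)[of z y z'] xzz' by blast+
  moreover have "z \<in> V" "x \<in> nbrs z" "z' \<in> nbrs z" "y \<in> nbrs z"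
    using x y z z' adj by (simp_all add: adj_commute)
  ultimately have "special z x y"
    using special_trans[of z x z' y] ne by blast
  then show False
    using xyz special_permute(1)[of z x y] special_permute(2)[of x z y] by blast
qed

lemma alpha_eq_2: "\<alpha> = 2" and degree_eq_5: "d = 5"
  using alpha_eq_3_beta degree_eq_5_beta beta_eq_2 by simp_all

lemma local_triangle_free:
  assumes x: "x \<in> V" and uvw: "u \<in> nbrs x" "v \<in> nbrs x" "w \<in> nbrs x" "E u v" "E v w"
  shows "\<not> E u w"
proof
  assume "E u w"
  have "\<not> special x y z" if "y \<in> nbrs x" "z \<in> nbrs x" for y z
    using card_special[OF x that(1)] beta_eq_2 that(2) by (auto simp: card_eq_0_iff finite_verts)
  then show False
    using special_in_local_triangle[OF x uvw \<open>E u w\<close>] uvw by blast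
qed

end

end

section \<open>Moore graphs of diameter two\<close>

subsection \<open>Residues modulo five\<close>

lemma exhaust_5:
  fixes i :: 5
  shows "i = 0 \<or> i = 1 \<or> i = 2 \<or> i = 3 \<or> i = 4"
proof (induct i)
  case (of_int z)
  then have "z = 0 \<or> z = 1 \<or> z = 2 \<or> z = 3 \<or> z = 4"
    by fastforce
  then show ?case
    by auto
qed

lemma forall_5: "(\<forall>i::5. P i) \<longleftrightarrow> P 0 \<and> P 1 \<and> P 2 \<and> P 3 \<and> P 4"
  by (metis exhaust_5)

lemma numerals_mod_5 [simp]: "(5::5) = 0" "(6::5) = 1" "(7::5) = 2" "(8::5) = 3"
  by simp_all

lemma difference_cases_5:
  fixes i j :: 5
  obtains "j = i" | "j = i + 1" | "i = j + 1" | "j = i + 2" | "i = j + 2"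
proof -
  have "j - i = 0 \<or> j - i = 1 \<or> j - i = 2 \<or> j - i = 3 \<or> j - i = 4"
    by (rule exhaust_5)
  then have "j = i \<or> j = i + 1 \<or> j = i + 2 \<or> j = i + 3 \<or> j = i + 4"
    by (simp add: diff_eq_eq add.commute)
  then show thesis
    using that by auto
qed

lemma add_one_induct_5:
  fixes i :: 5
  assumes "P 0" "\<And>i. P i \<Longrightarrow> P (i + 1)"
  shows "P i"
proof -
  have "P 1" "P 2" "P 3" "P 4"
    using assms(1) assms(2)[of 0] assms(2)[of 1] assms(2)[of 2] assms(2)[of 3] by simp_all
  then show ?thesis
    using exhaust_5[of i] assms(1) by auto
qed

definition quintuple :: "'a \<Rightarrow> 'a \<Rightarrow> 'a \<Rightarrow> 'a \<Rightarrow> 'a \<Rightarrow> 5 \<Rightarrow> 'a" where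
  "quintuple a b c d e i = (if i = 0 then a else if i = 1 then b else if i = 2 then c else if i = 3 then d else e)"

lemma quintuple_simps [simp]:
  "quintuple a b c d e 0 = a" "quintuple a b c d e 1 = b" "quintuple a b c d e 2 = c"
  "quintuple a b c d e 3 = d" "quintuple a b c d e 4 = e"
  by (simp_all add: quintuple_def)

definition cycle_adj :: "'n::ring_1 \<Rightarrow> 'n \<Rightarrow> bool" where
  "cycle_adj i j \<longleftrightarrow> j = i + 1 \<or> i = j + 1"

definition (in finite_graph) induced_cycle :: "('n::ring_1 \<Rightarrow> 'a) \<Rightarrow> bool" where
  "induced_cycle p \<longleftrightarrow> inj p \<and> range p \<subseteq> V \<and> (\<forall>i j. E (p i) (p j) \<longleftrightarrow> cycle_adj i j)"

lemma (in finite_graph) induced_cycleD: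
  assumes "induced_cycle p"
  shows "p i \<in> V" "p i = p j \<longleftrightarrow> i = j" "E (p i) (p j) \<longleftrightarrow> cycle_adj i j"
  using assms by (auto simp: induced_cycle_def inj_eq)

subsection \<open>Triangles, common neighbours and pentagons\<close>

locale moore_graph = diam_two_clique_mu_graphs V E 1 k
  for V :: "'a set" and E :: "'a \<Rightarrow> 'a \<Rightarrow> bool" and k :: nat +
  assumes triangle_free: "u \<in> V \<Longrightarrow> v \<in> nbrs u \<Longrightarrow> nbrs u \<inter> nbrs v = {}"
begin

lemma no_triangle: "u \<in> V \<Longrightarrow> v \<in> V \<Longrightarrow> w \<in> V \<Longrightarrow> E u v \<Longrightarrow> E v w \<Longrightarrow> \<not> E u w"
  using triangle_free[of u v] by auto

lemma common_nbr_unique: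
  assumes "u \<in> V" "v \<in> V" "u \<noteq> v" and "x \<in> V" "E u x" "E v x" and "y \<in> V" "E u y" "E v y"
  shows "x = y"
proof -
  have "nonadj u v"
    using no_triangle[of u x v] assms by (auto simp: nonadj_def adj_commute)
  then have "card (nbrs u \<inter> nbrs v) = 1"
    by (rule card_common_nbrs_nonadj)
  moreover have "x \<in> nbrs u \<inter> nbrs v" "y \<in> nbrs u \<inter> nbrs v"
    using assms by auto
  ultimately show ?thesis
    by (metis card_1_singletonE singletonD)
qed

lemma ex_common_nbr:
  assumes "u \<in> V" "v \<in> V" "u \<noteq> v" "\<not> E u v"
  obtains x where "x \<in> V" "E u x" "E v x"
  using common_nbrs_nonempty[OF nonadjI[OF assms]] by auto

lemma degree_ge_2: "k \<ge> 2"
proof -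
  obtain u v where uv: "nonadj u v"
    using not_complete by blast
  then obtain x where x: "x \<in> V" "E u x" "E v x"
    using ex_common_nbr by (auto simp: nonadj_def)
  then have "card {u, v} \<le> card (nbrs x)"
    using uv by (intro card_mono) (auto simp: nonadj_def adj_commute)
  then show ?thesis
    using uv regular[OF x(1)] by (simp add: nonadj_def)
qed

lemma verts_nonempty: "V \<noteq> {}"
  using not_complete by (auto simp: nonadj_def)

lemma other_nbr:
  assumes "u \<in> V"
  obtains v where "v \<in> V" "E u v" "v \<noteq> w"
proof -
  have "\<not> nbrs u \<subseteq> {w}"
    using card_mono[of "{w}" "nbrs u"] regular[OF assms] degree_ge_2 by auto
  then show thesis
    using that by (auto simp: subset_iff)
qed

lemma card_verts: "card V = k * k + 1"
proof -
  obtain u where u: "u \<in> V"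
    using verts_nonempty by blast
  have "card (private_nbrs v u) = k - 1" if v: "v \<in> nbrs u" for v
    using card_nbrs_split[of u v] triangle_free[OF u v] regular u v by (auto simp: adj_commute Int_commute)
  then have "k * (k - 1) = card V - Suc k"
    using sum_card_private_nbrs[OF u] regular[OF u] by simp
  moreover have "cl_nbrs u \<subseteq> V"
    using u by auto
  then have "Suc k \<le> card V"
    using card_mono[OF finite_verts] regular[OF u] by (metis card_cl_nbrs)
  moreover have "k * (k - 1) + k = k * k"
    using degree_ge_2 by (cases k) auto
  ultimately show ?thesis
    by linarith
qed

lemma induced_cycle_if_closed_walk_5:
  fixes p :: "5 \<Rightarrow> 'a"
  assumes p: "\<And>i. p i \<in> V" and walk: "\<And>i. E (p i) (p (i + 1))"
  shows "induced_cycle p"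
proof -
  have no_chord: "\<not> E (p i) (p (i + 2))" for i
    using no_triangle[OF p p p walk[of i] walk[of "i + 1"]] by (simp add: add.assoc)
  have ne: "p i \<noteq> p (i + 2)" for i
    using no_chord[of "i + 3"] walk[of "i + 2"] walk[of i] adj_sym by (auto simp: add.assoc)
  have "inj p"
  proof (rule injI)
    fix i j assume "p i = p j"
    then show "i = j"
      using ne[of i] ne[of j] walk[of i] walk[of j] adj_irrefl by (cases i j rule: difference_cases_5) auto
  qed
  moreover have "E (p i) (p j) \<longleftrightarrow> cycle_adj i j" for i j
    using no_chord[of i] no_chord[of j] walk[of i] walk[of j] adj_irrefl
    by (cases i j rule: difference_cases_5) (auto simp: cycle_adj_def adj_commute)
  ultimately show ?thesis
    using p by (auto simp: induced_cycle_def)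
qed

lemma ex_pentagon:
  obtains p :: "5 \<Rightarrow> 'a" where "induced_cycle p"
proof -
  obtain a where a: "a \<in> V"
    using verts_nonempty by blast
  obtain b where b: "b \<in> V" "E a b"
    using other_nbr[OF a] by blast
  obtain e where e: "e \<in> V" "E a e" "e \<noteq> b"
    using other_nbr[OF a] by blast
  obtain c where c: "c \<in> V" "E b c" "c \<noteq> a"
    using other_nbr[OF b(1)] by blast
  have "c \<noteq> e" "\<not> E c e"
    using no_triangle[of b c a] common_nbr_unique[of b e a c] a b c e by (auto simp: adj_commute)
  then obtain d where d: "d \<in> V" "E c d" "E e d"
    using ex_common_nbr[OF c(1) e(1)] by blast
  have "\<forall>i. quintuple a b c d e i \<in> V \<and> E (quintuple a b c d e i) (quintuple a b c d e (i + 1))"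
    unfolding forall_5 using a b c d e by (simp add: adj_commute)
  then show thesis
    using that induced_cycle_if_closed_walk_5 by blast
qed

lemma pentagon_iso:
  assumes "k = 2"
  obtains p :: "5 \<Rightarrow> 'a" where "graph_iso p UNIV cycle_adj V E"
proof -
  obtain p :: "5 \<Rightarrow> 'a" where p: "induced_cycle p"
    using ex_pentagon .
  then have "card (range p) = card V"
    using assms by (simp add: induced_cycle_def card_image card_verts)
  then have "range p = V"
    using p by (intro card_subset_eq finite_verts) (auto simp: induced_cycle_def)
  then show thesis
    using that p by (auto simp: graph_iso_def induced_cycle_def bij_betw_def)
qed

end

section \<open>The icosahedron\<close>

text \<open>The two rings are \<open>(False, Some i)\<close> and \<open>(True, Some i)\<close>, capped by the apexes \<open>(False, None)\<close> and
  \<open>(True, None)\<close>.\<close>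

fun icosahedron_adj :: "bool \<times> 5 option \<Rightarrow> bool \<times> 5 option \<Rightarrow> bool" where
  "icosahedron_adj (x, None) (y, None) \<longleftrightarrow> False"
| "icosahedron_adj (x, None) (y, Some j) \<longleftrightarrow> x = y"
| "icosahedron_adj (x, Some i) (y, None) \<longleftrightarrow> x = y"
| "icosahedron_adj (False, Some i) (False, Some j) \<longleftrightarrow> cycle_adj i j"
| "icosahedron_adj (True, Some i) (True, Some j) \<longleftrightarrow> cycle_adj i j"
| "icosahedron_adj (False, Some i) (True, Some j) \<longleftrightarrow> j = i \<or> j = i + 1"
| "icosahedron_adj (True, Some i) (False, Some j) \<longleftrightarrow> i = j \<or> i = j + 1"

lemma icosahedron_nbrs:
  "{w. icosahedron_adj (x, None) w} = range (\<lambda>j. (x, Some j))"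
  "{w. icosahedron_adj (False, Some i) w}
    = {(False, None), (False, Some (i - 1)), (False, Some (i + 1)), (True, Some i), (True, Some (i + 1))}"
  "{w. icosahedron_adj (True, Some i) w}
    = {(False, Some (i - 1)), (False, Some i), (True, Some (i - 1)), (True, Some (i + 1)), (True, None)}"
proof -
  have "icosahedron_adj (x, None) w \<longleftrightarrow> w \<in> range (\<lambda>j. (x, Some j))" for w
    by (cases "((x, None :: 5 option), w)" rule: icosahedron_adj.cases) auto
  then show "{w. icosahedron_adj (x, None) w} = range (\<lambda>j. (x, Some j))"
    by blast
  have "icosahedron_adj (False, Some i) w \<longleftrightarrow>
      w \<in> {(False, None), (False, Some (i - 1)), (False, Some (i + 1)), (True, Some i), (True, Some (i + 1))}" for w
    by (cases "((False, Some i), w)" rule: icosahedron_adj.cases) (auto simp: cycle_adj_def algebra_simps)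
  then show "{w. icosahedron_adj (False, Some i) w}
      = {(False, None), (False, Some (i - 1)), (False, Some (i + 1)), (True, Some i), (True, Some (i + 1))}"
    by blast
  have "icosahedron_adj (True, Some i) w \<longleftrightarrow>
      w \<in> {(False, Some (i - 1)), (False, Some i), (True, Some (i - 1)), (True, Some (i + 1)), (True, None)}" for w
    by (cases "((True, Some i), w)" rule: icosahedron_adj.cases) (auto simp: cycle_adj_def algebra_simps)
  then show "{w. icosahedron_adj (True, Some i) w}
      = {(False, Some (i - 1)), (False, Some i), (True, Some (i - 1)), (True, Some (i + 1)), (True, None)}"
    by blast
qed

locale locally_pentagon_graph = amply_regular_clique_mu_graphs V E 2 5 2
  for V :: "'a set" and E :: "'a \<Rightarrow> 'a \<Rightarrow> bool"
begin

lemma local_moore_graph: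
  assumes x: "x \<in> V"
  shows "moore_graph (nbrs x) E 2"
proof -
  interpret L: diam_two_clique_mu_graphs "nbrs x" E 1 2
    using local_graph[OF x] by simp
  show ?thesis
  proof unfold_locales
    fix u v assume uv: "u \<in> nbrs x" "v \<in> L.nbrs u"
    have "\<not> (w \<in> L.nbrs u \<and> w \<in> L.nbrs v)" for w
      using local_triangle_free[OF _ _ x, of u v w] uv by auto
    then show "L.nbrs u \<inter> L.nbrs v = {}"
      by blast
  qed
qed

lemma common_nbrs_eq:
  assumes "u \<in> V" "v \<in> V" "u \<noteq> v" "x \<in> nbrs u \<inter> nbrs v" "y \<in> nbrs u \<inter> nbrs v" "x \<noteq> y"
  shows "nbrs u \<inter> nbrs v = {x, y}"
proof -
  have "card (nbrs u \<inter> nbrs v) = 2"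
  proof (cases "E u v")
    case True
    then show ?thesis
      using card_common_nbrs_adj[of u v] assms by simp
  next
    case False
    then show ?thesis
      using card_common_nbrs[of u v] assms by (auto simp: nonadj_def simp del: in_nbrs)
  qed
  then show ?thesis
    using card_subset_eq[of "nbrs u \<inter> nbrs v" "{x, y}"] assms by simp
qed

lemma ex_other_common_nbr:
  assumes "u \<in> V" "v \<in> nbrs u"
  obtains y where "y \<in> nbrs u \<inter> nbrs v" "y \<noteq> x"
proof -
  have "\<not> nbrs u \<inter> nbrs v \<subseteq> {x}"
    using card_mono[of "{x}" "nbrs u \<inter> nbrs v"] card_common_nbrs_adj[OF assms] by auto
  then show thesis
    using that by blast
qed

lemma ex_wheel:
  obtains z and p :: "5 \<Rightarrow> 'a" where "z \<in> V" "induced_cycle p" "range p = nbrs z"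
proof -
  obtain z where z: "z \<in> V"
    using verts_nonempty by blast
  interpret L: moore_graph "nbrs z" E 2
    by (rule local_moore_graph[OF z])
  obtain p :: "5 \<Rightarrow> 'a" where "graph_iso p UNIV cycle_adj (nbrs z) E"
    using L.pentagon_iso by blast
  then have "induced_cycle p" "range p = nbrs z"
    using nbrs_subset by (auto simp: graph_iso_def bij_betw_def induced_cycle_def)
  then show thesis
    using that z by blast
qed

context
  fixes z and p :: "5 \<Rightarrow> 'a"
  assumes z: "z \<in> V" and p: "induced_cycle p" and range_p: "range p = nbrs z"
begin

lemma p_verts: "p i \<in> V" and p_eq_iff: "p i = p j \<longleftrightarrow> i = j" and adj_p_iff: "E (p i) (p j) \<longleftrightarrow> cycle_adj i j"
  using induced_cycleD[OF p] by blast+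

lemma adj_z_p: "E z (p i)" "E (p i) z"
proof -
  have "p i \<in> nbrs z"
    using range_p by blast
  then show "E z (p i)" "E (p i) z"
    by (simp_all add: adj_commute)
qed

definition outer :: "5 \<Rightarrow> 'a" where
  "outer j = (SOME x. x \<in> nbrs (p (j - 1)) \<inter> nbrs (p j) \<and> x \<noteq> z)"

lemma outer_verts: "outer j \<in> V" and adj_p_outer: "E (p (j - 1)) (outer j)" "E (p j) (outer j)"
  and outer_ne_z: "outer j \<noteq> z"
proof -
  have "p j \<in> nbrs (p (j - 1))"
    by (simp add: p_verts adj_p_iff cycle_adj_def)
  then have "\<exists>x. x \<in> nbrs (p (j - 1)) \<inter> nbrs (p j) \<and> x \<noteq> z"
    using ex_other_common_nbr[OF p_verts] by metis
  from someI_ex[OF this]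
  have "outer j \<in> nbrs (p (j - 1)) \<inter> nbrs (p j)" "outer j \<noteq> z"
    unfolding outer_def by blast+
  then show "outer j \<in> V" "E (p (j - 1)) (outer j)" "E (p j) (outer j)" "outer j \<noteq> z"
    by auto
qed

lemma p_ne_outer: "p i \<noteq> outer j"
proof
  assume "p i = outer j"
  then have "cycle_adj (j - 1) i" "cycle_adj j i"
    using adj_p_outer by (metis adj_p_iff)+
  then show False
    by (auto simp: cycle_adj_def algebra_simps)
qed

lemma not_adj_z_outer: "\<not> E z (outer j)"
proof
  assume "E z (outer j)"
  then have "outer j \<in> range p"
    using range_p outer_verts by simp
  then show False
    using p_ne_outer by (metis rangeE)
qed

lemma adj_p_outer_iff: "E (p i) (outer j) \<longleftrightarrow> j = i \<or> j = i + 1"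
proof -
  have "nbrs z \<inter> nbrs (outer j) = {p (j - 1), p j}"
    using z outer_verts outer_ne_z[symmetric] adj_z_p adj_p_outer
    by (intro common_nbrs_eq) (auto simp: p_verts p_eq_iff adj_commute)
  then have "E (p i) (outer j) \<longleftrightarrow> p i \<in> {p (j - 1), p j}"
    using p_verts adj_z_p adj_commute by auto
  also have "\<dots> \<longleftrightarrow> j = i \<or> j = i + 1"
    by (auto simp: p_eq_iff algebra_simps)
  finally show ?thesis .
qed

lemma outer_eq_iff: "outer i = outer j \<longleftrightarrow> i = j"
proof
  assume "outer i = outer j"
  then have "j = i \<or> j = i + 1" "i = j \<or> i = j + 1"
    using adj_p_outer(2) adj_p_outer_iff by metis+
  then show "i = j"
    by auto
qed simp

lemma nbrs_p: "nbrs (p i) = {z, p (i - 1), p (i + 1), outer i, outer (i + 1)}"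
proof (rule sym, rule card_subset_eq)
  show "{z, p (i - 1), p (i + 1), outer i, outer (i + 1)} \<subseteq> nbrs (p i)"
    using z adj_z_p outer_verts p_verts by (auto simp: adj_p_iff adj_p_outer_iff cycle_adj_def)
  have "card {z, p (i - 1), p (i + 1), outer i, outer (i + 1)} = 5"
    using adj_z_p adj_irrefl p_ne_outer outer_ne_z
    by (auto simp: card_insert_if p_eq_iff outer_eq_iff algebra_simps dest: sym)
  then show "card {z, p (i - 1), p (i + 1), outer i, outer (i + 1)} = card (nbrs (p i))"
    using degree p_verts by simp
qed simp

lemma adj_outer_Suc: "E (outer i) (outer (i + 1))"
proof -
  obtain x where x: "x \<in> nbrs (p i) \<inter> nbrs (outer i)" "x \<noteq> p (i - 1)"
    using ex_other_common_nbr[OF p_verts, of "outer i" i] outer_verts adj_p_outer by auto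
  then have "x \<in> {z, p (i - 1), p (i + 1), outer i, outer (i + 1)}" "E (outer i) x"
    by (auto simp flip: nbrs_p)
  moreover have "\<not> E (outer i) z" "\<not> E (outer i) (p (i + 1))"
    using not_adj_z_outer by (auto simp: adj_commute adj_p_outer_iff)
  ultimately show ?thesis
    using x(2) adj_irrefl by auto
qed

lemma not_adj_outer_add_2: "\<not> E (outer i) (outer (i + 2))"
proof
  assume "E (outer i) (outer (i + 2))"
  moreover have "E (outer (i + 1)) (outer (i + 2))"
    using adj_outer_Suc[of "i + 1"] by (simp add: add.assoc)
  ultimately have "outer i \<in> nbrs (p i) \<inter> nbrs (outer (i + 2))" "outer (i + 1) \<in> nbrs (p i) \<inter> nbrs (outer (i + 2))"
    "p (i + 1) \<in> nbrs (p i) \<inter> nbrs (outer (i + 2))"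
    using outer_verts p_verts adj_p_outer_iff adj_commute by (auto simp: adj_p_iff cycle_adj_def)
  then have "p (i + 1) \<in> {outer i, outer (i + 1)}"
    using common_nbrs_eq[OF p_verts outer_verts p_ne_outer, of "outer i" i "i + 2" "outer (i + 1)"]
    by (simp only: outer_eq_iff) simp
  then show False
    using p_ne_outer by auto
qed

definition antiprism_nbrs :: "5 \<Rightarrow> 'a set" where
  "antiprism_nbrs i = {p (i - 1), p i, outer (i - 1), outer (i + 1)}"

lemma ex_fifth_nbr: "\<exists>t. t \<notin> antiprism_nbrs i \<and> nbrs (outer i) = insert t (antiprism_nbrs i)"
proof -
  have sub: "antiprism_nbrs i \<subseteq> nbrs (outer i)"
    using adj_outer_Suc[of "i - 1"] adj_outer_Suc[of i] p_verts outer_verts adj_p_outer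
    by (auto simp: antiprism_nbrs_def adj_commute)
  have "card (antiprism_nbrs i) = 4" "finite (antiprism_nbrs i)"
    using p_ne_outer
    by (auto simp: antiprism_nbrs_def card_insert_if p_eq_iff outer_eq_iff algebra_simps)
  then have "card (nbrs (outer i) - antiprism_nbrs i) = 1"
    using sub degree[OF outer_verts[of i]] by (simp add: card_Diff_subset)
  then obtain t where "nbrs (outer i) - antiprism_nbrs i = {t}"
    by (rule card_1_singletonE)
  then show ?thesis
    using sub by blast
qed

lemma ex_antipode:
  obtains t where "t \<in> V" "\<And>i. nbrs (outer i) = {p (i - 1), p i, outer (i - 1), outer (i + 1), t}"
    "t \<notin> range p" "t \<notin> range outer"
proof -
  obtain t where t: "\<And>i. t i \<notin> antiprism_nbrs i" "\<And>i. nbrs (outer i) = insert (t i) (antiprism_nbrs i)"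
    using ex_fifth_nbr by metis
  have t_Suc: "t (i + 1) = t i" for i
  proof -
    obtain x where x: "x \<in> nbrs (outer i) \<inter> nbrs (outer (i + 1))" "x \<noteq> p i"
      using ex_other_common_nbr[OF outer_verts, of "outer (i + 1)" i] outer_verts adj_outer_Suc by auto
    have "\<not> E (outer (i + 1)) (outer (i - 1))"
      using not_adj_outer_add_2[of "i - 1"] by (simp add: adj_commute algebra_simps)
    then have "x \<notin> antiprism_nbrs i"
      using x adj_irrefl by (auto simp: antiprism_nbrs_def adj_commute adj_p_outer_iff algebra_simps)
    moreover have "x \<notin> antiprism_nbrs (i + 1)"
      using x not_adj_outer_add_2[of i] adj_irrefl
      by (auto simp: antiprism_nbrs_def adj_commute adj_p_outer_iff algebra_simps)
    ultimately have "x = t i" "x = t (i + 1)"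
      using x(1) unfolding t(2) by blast+
    then show ?thesis
      by simp
  qed
  have t_eq: "t i = t 0" for i
    by (rule add_one_induct_5[of "\<lambda>i. t i = t 0"]) (simp_all add: t_Suc)
  have "nbrs (outer i) = {p (i - 1), p i, outer (i - 1), outer (i + 1), t 0}" for i
    using t(2)[of i] t_eq[of i] by (auto simp: antiprism_nbrs_def simp del: in_nbrs)
  moreover have "t 0 \<noteq> p i" for i
    using t(1)[of i] t_eq[of i] by (auto simp: antiprism_nbrs_def)
  moreover have "t 0 \<noteq> outer i" for i
    using t(1)[of "i - 1"] t_eq[of "i - 1"] by (auto simp: antiprism_nbrs_def)
  moreover have "t 0 \<in> V"
    using t(2)[of 0] in_nbrs by blast
  ultimately show thesis
    using that[of "t 0"] by blast
qed

lemma icosahedron_iso_of_wheel: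
  obtains g where "graph_iso g UNIV icosahedron_adj V E"
proof -
  obtain t where t: "t \<in> V" "t \<notin> range p" "t \<notin> range outer"
    and nbrs_outer: "\<And>i. nbrs (outer i) = {p (i - 1), p i, outer (i - 1), outer (i + 1), t}"
    using ex_antipode by metis
  define g where "g = (\<lambda>(x, i). case i of None \<Rightarrow> if x then t else z | Some i \<Rightarrow> if x then outer i else p i)"
  have g: "g (False, None) = z" "g (True, None) = t" "g (False, Some i) = p i" "g (True, Some i) = outer i" for i
    by (simp_all add: g_def)
  have adj_outer_t: "E (outer i) t" for i
    using nbrs_outer[of i] in_nbrs by blast
  have ne: "z \<noteq> p i" "z \<noteq> outer i" "z \<noteq> t" "p i \<noteq> outer j" for i j
    using adj_z_p[of i] adj_irrefl outer_ne_z[of i] adj_outer_t[of i] not_adj_z_outer[of i] p_ne_outer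
    by (auto simp: adj_commute)
  have "inj g"
  proof (rule injI)
    fix v w assume "g v = g w"
    then show "v = w"
      using ne ne[symmetric] t(2,3)
      by (cases "(v, w)" rule: icosahedron_adj.cases) (auto simp: g_def p_eq_iff outer_eq_iff split: if_splits)
  qed
  have "range outer \<subseteq> nbrs t" "card (range outer) = 5"
    using adj_outer_t outer_verts by (auto simp: adj_commute card_image inj_def outer_eq_iff)
  then have nbrs_t: "nbrs t = range outer"
    using degree[OF t(1)] by (intro card_seteq[symmetric]) auto
  have nbrs_g: "nbrs (g v) = g ` {w. icosahedron_adj v w}" for v
  proof -
    consider "v = (False, None)" | "v = (True, None)" | i where "v = (False, Some i)" | i where "v = (True, Some i)"
      by (metis (full_types) option.exhaust surj_pair)
    then show ?thesis
      by cases (simp_all add: icosahedron_nbrs g nbrs_p nbrs_outer nbrs_t image_image flip: range_p)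
  qed
  have "range g = V"
  proof (rule closed_subset_eq)
    show "range g \<subseteq> V"
      using z t(1) p_verts outer_verts by (auto simp: g_def split: option.split)
    show "nbrs u \<subseteq> range g" if "u \<in> range g" for u
      using that nbrs_g by auto
  qed simp
  then show thesis
    using that graph_iso_if_nbrs_image[of g UNIV icosahedron_adj] \<open>inj g\<close> nbrs_g by simp
qed

end

theorem icosahedron_iso:
  obtains g where "graph_iso g UNIV icosahedron_adj V E"
  using ex_wheel icosahedron_iso_of_wheel by metis

end

section \<open>Hexagons in the Moore graph of degree seven\<close>

subsection \<open>The adjacency operator\<close>

lemma sum_zero_off_Un:
  fixes h :: "'a \<Rightarrow> 'b::comm_monoid_add"
  assumes "finite V" "U \<subseteq> V" "Y \<subseteq> V" "U \<inter> Y = {}" and "\<And>v. v \<notin> U \<Longrightarrow> v \<notin> Y \<Longrightarrow> h v = 0"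
  shows "(\<Sum>v\<in>V. h v) = (\<Sum>u\<in>U. h u) + (\<Sum>y\<in>Y. h y)"
proof -
  have "(\<Sum>v\<in>V. h v) = (\<Sum>v\<in>U \<union> Y. h v)"
    by (rule sum.mono_neutral_right) (use assms in auto)
  also have "\<dots> = (\<Sum>u\<in>U. h u) + (\<Sum>y\<in>Y. h y)"
    using assms by (intro sum.union_disjoint) (auto intro: finite_subset)
  finally show ?thesis .
qed

definition (in finite_graph) nbr_sum :: "('a \<Rightarrow> real) \<Rightarrow> 'a \<Rightarrow> real" where
  "nbr_sum f v = (\<Sum>w\<in>nbrs v. f w)"

lemma (in finite_graph) nbr_sum_eq_sum_Int:
  assumes "\<And>v. v \<in> nbrs u \<Longrightarrow> v \<notin> S \<Longrightarrow> f v = 0"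
  shows "nbr_sum f u = (\<Sum>v\<in>nbrs u \<inter> S. f v)"
  unfolding nbr_sum_def using assms by (intro sum.mono_neutral_right) auto

lemma (in finite_graph) sum_mult_nbr_sum_commute:
  "(\<Sum>v\<in>V. f v * nbr_sum g v) = (\<Sum>v\<in>V. nbr_sum f v * g v)"
proof -
  have "(\<Sum>v\<in>V. f v * nbr_sum g v) = (\<Sum>v\<in>V. \<Sum>w\<in>{w \<in> V. E v w}. f v * g w)"
    by (simp add: nbr_sum_def nbrs_def sum_distrib_left)
  also have "\<dots> = (\<Sum>w\<in>V. \<Sum>v\<in>{v \<in> V. E v w}. f v * g w)"
    by (rule sum.swap_restrict) (rule finite_verts)+
  also have "\<dots> = (\<Sum>v\<in>V. nbr_sum f v * g v)"
    by (simp add: nbr_sum_def nbrs_def sum_distrib_right adj_commute)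
  finally show ?thesis .
qed

context moore_graph
begin

lemma card_common_nbrs_eq:
  assumes "u \<in> V" "v \<in> V"
  shows "real (card (nbrs u \<inter> nbrs v)) = 1 + (real k - 1) * of_bool (u = v) - of_bool (E u v)"
proof -
  consider "u = v" | "E u v" "u \<noteq> v" | "nonadj u v"
    using assms by (auto simp: nonadj_def)
  then show ?thesis
    by cases (use assms regular triangle_free card_common_nbrs_nonadj in \<open>auto simp: adj_irrefl nonadj_def\<close>)
qed

lemma nbr_sum_nbr_sum:
  assumes v: "v \<in> V"
  shows "nbr_sum (nbr_sum f) v = (real k - 1) * f v - nbr_sum f v + (\<Sum>w\<in>V. f w)"
proof -
  have "nbr_sum (nbr_sum f) v = (\<Sum>w\<in>nbrs v. \<Sum>x\<in>{x \<in> V. E w x}. f x)"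
    by (simp add: nbr_sum_def nbrs_def)
  also have "\<dots> = (\<Sum>x\<in>V. \<Sum>w\<in>{w \<in> nbrs v. E w x}. f x)"
    by (rule sum.swap_restrict) (simp_all add: finite_verts)
  also have "\<dots> = (\<Sum>x\<in>V. real (card (nbrs v \<inter> nbrs x)) * f x)"
    by (intro sum.cong refl) (auto simp: adj_commute intro!: arg_cong[of _ _ card])
  also have "\<dots> = (\<Sum>x\<in>V. f x + (real k - 1) * (of_bool (v = x) * f x) - of_bool (E v x) * f x)"
    by (intro sum.cong refl) (simp add: card_common_nbrs_eq[OF v] algebra_simps)
  also have "\<dots> = (\<Sum>x\<in>V. f x) + (real k - 1) * f v - nbr_sum f v"
    using v finite_verts
    by (simp add: sum.distrib sum_subtractf nbr_sum_def nbrs_def of_bool_def if_distrib[of "\<lambda>x. x * _"]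
        sum.inter_filter flip: sum_distrib_left cong: if_cong)
  finally show ?thesis
    by simp
qed

text \<open>If \<open>\<theta>\<close> is the largest eigenvalue of the adjacency operator \<open>A\<close> apart from \<open>k\<close>, then
  \<open>(\<theta> - A)\<^sup>2\<close> is \<open>2 \<theta> + 1\<close> times \<open>\<theta> - A\<close> on the vectors orthogonal to the constants.\<close>

lemma quadratic_form_nonneg:
  fixes f :: "'a \<Rightarrow> real"
  assumes \<theta>: "\<theta> * (\<theta> + 1) = real k - 1" "\<theta> \<ge> 0" and sum_f: "(\<Sum>v\<in>V. f v) = 0"
  shows "0 \<le> (\<Sum>v\<in>V. f v * (\<theta> * f v - nbr_sum f v))"
proof -
  have "(\<Sum>v\<in>V. (nbr_sum f v)\<^sup>2) = (\<Sum>v\<in>V. f v * nbr_sum (nbr_sum f) v)"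
    by (simp add: power2_eq_square sum_mult_nbr_sum_commute)
  also have "\<dots> = (\<Sum>v\<in>V. (real k - 1) * (f v)\<^sup>2 - f v * nbr_sum f v)"
    by (intro sum.cong refl) (simp add: nbr_sum_nbr_sum sum_f power2_eq_square algebra_simps)
  finally have square: "(\<Sum>v\<in>V. (nbr_sum f v)\<^sup>2) = (\<Sum>v\<in>V. (real k - 1) * (f v)\<^sup>2 - f v * nbr_sum f v)" .
  have "0 \<le> (\<Sum>v\<in>V. (\<theta> * f v - nbr_sum f v)\<^sup>2)"
    by (intro sum_nonneg) auto
  also have "\<dots> = (\<Sum>v\<in>V. \<theta>\<^sup>2 * (f v)\<^sup>2 - 2 * \<theta> * (f v * nbr_sum f v)) + (\<Sum>v\<in>V. (nbr_sum f v)\<^sup>2)"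
    by (simp add: power2_diff power_mult_distrib sum.distrib sum_subtractf algebra_simps)
  also have "\<dots> = (\<Sum>v\<in>V. (2 * \<theta> + 1) * (f v * (\<theta> * f v - nbr_sum f v)))"
    unfolding square sum.distrib[symmetric] \<theta>(1)[symmetric]
    by (intro sum.cong refl) (simp add: power2_eq_square algebra_simps)
  finally have "0 \<le> (2 * \<theta> + 1) * (\<Sum>v\<in>V. f v * (\<theta> * f v - nbr_sum f v))"
    by (simp add: sum_distrib_left)
  then show ?thesis
    using \<theta>(2) by (simp add: zero_le_mult_iff)
qed

text \<open>A constant on \<open>U\<close> makes \<open>f\<close> orthogonal to the constants and contributes nothing to the form.\<close>

lemma quadratic_form_nonneg_off_regular:
  fixes f :: "'a \<Rightarrow> real"
  assumes \<theta>: "k = \<theta> * (\<theta> + 1) + 1"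
    and U: "U \<subseteq> V" "U \<noteq> {}" "\<And>u. u \<in> U \<Longrightarrow> card (nbrs u \<inter> U) = \<theta>"
    and Y: "Y \<subseteq> V" "U \<inter> Y = {}" "\<And>y. y \<in> Y \<Longrightarrow> nbrs y \<inter> U = {}"
  shows "0 \<le> (\<Sum>y\<in>Y. f y * (real \<theta> * f y - (\<Sum>z\<in>nbrs y \<inter> Y. f z)))"
proof -
  have fin: "finite U" "finite Y"
    using U(1) Y(1) finite_verts by (auto intro: finite_subset)
  define c where "c = - (\<Sum>y\<in>Y. f y) / real (card U)"
  define g where "g v = (if v \<in> U then c else if v \<in> Y then f v else 0)" for v
  have g_Y: "g y = f y" if "y \<in> Y" for y
    using that Y(2) by (auto simp: g_def)
  note sum_V = sum_zero_off_Un[OF finite_verts U(1) Y(1,2)]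
  have nbr_sum_U: "nbr_sum g u = real \<theta> * c" if u: "u \<in> U" for u
  proof -
    have "v \<notin> Y" if "v \<in> nbrs u" for v
    proof -
      have "u \<in> nbrs v \<inter> U"
        using that u U(1) by (auto simp: adj_commute)
      then show ?thesis
        using Y(3) by blast
    qed
    then have "nbr_sum g u = (\<Sum>v\<in>nbrs u \<inter> U. g v)"
      by (intro nbr_sum_eq_sum_Int) (simp add: g_def)
    then show ?thesis
      using U(3)[OF u] by (simp add: g_def)
  qed
  have nbr_sum_Y: "nbr_sum g y = (\<Sum>z\<in>nbrs y \<inter> Y. f z)" if "y \<in> Y" for y
  proof -
    have "nbr_sum g y = (\<Sum>z\<in>nbrs y \<inter> Y. g z)"
      by (rule nbr_sum_eq_sum_Int) (use Y(3)[OF that] in \<open>auto simp: g_def\<close>)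
    then show ?thesis
      by (simp add: g_Y)
  qed
  have "(\<Sum>v\<in>V. g v) = (\<Sum>u\<in>U. c) + (\<Sum>y\<in>Y. f y)"
    using sum_V[of g] g_Y by (simp add: g_def)
  then have "(\<Sum>v\<in>V. g v) = 0"
    using U(2) fin by (simp add: c_def)
  then have "0 \<le> (\<Sum>v\<in>V. g v * (real \<theta> * g v - nbr_sum g v))"
    by (intro quadratic_form_nonneg) (simp_all add: \<theta> algebra_simps)
  also have "\<dots> = (\<Sum>y\<in>Y. f y * (real \<theta> * f y - (\<Sum>z\<in>nbrs y \<inter> Y. f z)))"
    using sum_V[of "\<lambda>v. g v * (real \<theta> * g v - nbr_sum g v)"]
    by (simp add: nbr_sum_U nbr_sum_Y g_Y) (simp add: g_def)
  finally show ?thesis .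
qed

end

subsection \<open>Hexagons\<close>

lemma exhaust_6:
  fixes i :: 6
  shows "i = 0 \<or> i = 1 \<or> i = 2 \<or> i = 3 \<or> i = 4 \<or> i = 5"
proof (induct i)
  case (of_int z)
  then have "z = 0 \<or> z = 1 \<or> z = 2 \<or> z = 3 \<or> z = 4 \<or> z = 5"
    by fastforce
  then show ?case
    by auto
qed

lemma forall_6: "(\<forall>i::6. P i) \<longleftrightarrow> P 0 \<and> P 1 \<and> P 2 \<and> P 3 \<and> P 4 \<and> P 5"
  by (metis exhaust_6)

lemma six_eq_0 [simp]: "(6::6) = 0"
  by simp

lemma difference_cases_6:
  fixes i j :: 6
  obtains "j = i" | "j = i + 1" | "i = j + 1" | "j = i + 2" | "i = j + 2" | "j = i + 3"
proof -
  have "j = i \<or> j = i + 1 \<or> j = i + 2 \<or> j = i + 3 \<or> j = i + 4 \<or> j = i + 5"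
    using exhaust_6[of "j - i"] by (simp add: diff_eq_eq add.commute)
  then show thesis
    using that by auto
qed

locale moore_hexagon = moore_graph V E 7
  for V :: "'a set" and E :: "'a \<Rightarrow> 'a \<Rightarrow> bool" +
  fixes h w :: "6 \<Rightarrow> 'a"
  assumes h_verts: "h i \<in> V" and inj_h: "inj h" and adj_h: "E (h i) (h (i + 1))"
    and w_verts: "w i \<in> V" and adj_w: "E (w i) (h i)" "E (w i) (h (i + 3))"
begin

lemma h_eq_iff: "h i = h j \<longleftrightarrow> i = j"
  using inj_h by (simp add: inj_eq)

lemma adj_h_iff: "E (h i) (h j) \<longleftrightarrow> cycle_adj i j"
proof -
  have dist_2: "\<not> E (h i) (h (i + 2))" for i
    using no_triangle[OF h_verts h_verts h_verts adj_h[of i] adj_h[of "i + 1"]] by (simp add: add.assoc)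
  have dist_3: "\<not> E (h i) (h (i + 3))" for i
  proof
    assume "E (h i) (h (i + 3))"
    moreover have "E (h (i + 2)) (h (i + 1))" "E (h (i + 2)) (h (i + 3))"
      using adj_h[of "i + 1"] adj_h[of "i + 2"] by (simp_all add: adj_commute add.assoc)
    ultimately have "h (i + 1) = h (i + 3)"
      using common_nbr_unique[of "h i" "h (i + 2)" "h (i + 1)" "h (i + 3)"] h_verts adj_h[of i]
      by (simp add: h_eq_iff)
    then show False
      by (simp add: h_eq_iff)
  qed
  show ?thesis
    using dist_2[of i] dist_2[of j] dist_3[of i] adj_h[of i] adj_h[of j] adj_irrefl
    by (cases i j rule: difference_cases_6) (auto simp: cycle_adj_def adj_commute)
qed

lemma w_ne_h: "w i \<noteq> h j"
proof
  assume "w i = h j"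
  then have "cycle_adj j i" "cycle_adj j (i + 3)"
    using adj_w[of i] by (simp_all add: adj_h_iff)
  then show False
    by (auto simp: cycle_adj_def)
qed

lemma w_notin_hexagon: "w i \<notin> range h"
  using w_ne_h by blast

lemma two_hexagon_nbrs:
  assumes v: "v \<in> V" "v \<notin> range h" and ij: "E v (h i)" "E v (h j)" "i \<noteq> j"
  shows "j = i + 3 \<and> v = w i"
proof -
  have not_consecutive: False if "E v (h l)" "E v (h (l + 1))" for l
    using no_triangle[OF v(1) h_verts h_verts that(1) adj_h] that(2) by blast
  have not_dist_2: False if "E v (h l)" "E v (h (l + 2))" for l
  proof -
    have "v = h (l + 1)"
      using common_nbr_unique[of "h l" "h (l + 2)" v "h (l + 1)"] h_verts v that adj_h[of l] adj_h[of "l + 1"]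
      by (simp add: h_eq_iff adj_commute add.assoc)
    then show False
      using v(2) by blast
  qed
  have "j = i + 3"
    using not_consecutive[of i] not_consecutive[of j] not_dist_2[of i] not_dist_2[of j] ij
    by (cases i j rule: difference_cases_6) auto
  moreover have "v = w i"
    using common_nbr_unique[of "h i" "h j" v "w i"] h_verts v w_verts ij adj_w[of i] \<open>j = i + 3\<close>
    by (simp add: h_eq_iff adj_commute)
  ultimately show ?thesis
    by blast
qed

lemma w_eq_iff: "w i = w j \<longleftrightarrow> j = i \<or> j = i + 3"
proof
  assume "w i = w j"
  then show "j = i \<or> j = i + 3"
    using two_hexagon_nbrs[of "w i" i j] w_verts w_notin_hexagon adj_w(1)[of i] adj_w(1)[of j] by auto
next
  assume "j = i \<or> j = i + 3"
  moreover have "w i = w (i + 3)"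
    using two_hexagon_nbrs[of "w (i + 3)" i "i + 3"] w_verts w_notin_hexagon adj_w[of "i + 3"]
    by (auto simp: add.assoc)
  ultimately show "w i = w j"
    by auto
qed

lemma range_w: "range w = {w 0, w 1, w 2}" and card_range_w: "card (range w) = 3"
proof -
  have "w i \<in> {w 0, w 1, w 2}" for i
    using exhaust_6[of i] by (auto simp: w_eq_iff)
  then show "range w = {w 0, w 1, w 2}"
    by auto
  then show "card (range w) = 3"
    by (simp add: w_eq_iff)
qed

lemma card_range_h: "card (range h) = 6"
  using inj_h by (simp add: card_image)

lemma card_nbrs_h_Int_hexagon: "card (nbrs (h i) \<inter> range h) = 2"
proof -
  have "nbrs (h i) \<inter> range h = {h (i + 1), h (i - 1)}"
    using h_verts by (auto simp: adj_h_iff cycle_adj_def h_eq_iff algebra_simps)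
  then show ?thesis
    by (simp add: h_eq_iff algebra_simps)
qed

lemma nbrs_w_Int_hexagon: "nbrs (w i) \<inter> range h = {h i, h (i + 3)}"
proof -
  have "E (w i) (h j) \<longleftrightarrow> j = i \<or> j = i + 3" for j
  proof
    show "j = i \<or> j = i + 3" if "E (w i) (h j)"
      using two_hexagon_nbrs[OF w_verts w_notin_hexagon adj_w(1) that] by blast
  qed (use adj_w in auto)
  moreover have "nbrs (w i) \<inter> range h = h ` {j. E (w i) (h j)}"
    using h_verts by auto
  ultimately show ?thesis
    by auto
qed

definition far :: "'a set" where
  "far = {y \<in> V - range h. nbrs y \<inter> range h = {}}"

lemma hexagon_nbr_count:
  assumes v: "v \<in> V - range h"
  shows "card (nbrs v \<inter> range h) + of_bool (v \<in> far) = 1 + of_bool (v \<in> range w)"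
proof (cases "v \<in> range w")
  case True
  then obtain i where "v = w i"
    by blast
  moreover have "v \<notin> far"
    using nbrs_w_Int_hexagon[of i] \<open>v = w i\<close> by (auto simp: far_def simp del: in_nbrs)
  ultimately show ?thesis
    by (simp add: nbrs_w_Int_hexagon h_eq_iff)
next
  case False
  have "x = y" if "x \<in> nbrs v \<inter> range h" "y \<in> nbrs v \<inter> range h" for x y
    using two_hexagon_nbrs[of v] v False that by auto
  then have "card (nbrs v \<inter> range h) \<le> 1"
    by (simp add: card_le_Suc0_iff_eq)
  moreover have "card (nbrs v \<inter> range h) = 0 \<longleftrightarrow> v \<in> far"
    using v by (simp add: far_def)
  ultimately show ?thesis
    using False by (auto simp: le_Suc_eq)
qed

lemma far_subset: "far \<subseteq> V" "finite far" "range h \<inter> far = {}" "range w \<inter> far = {}"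
proof -
  show "far \<subseteq> V" "range h \<inter> far = {}"
    by (auto simp: far_def)
  then show "finite far"
    using finite_verts finite_subset by blast
  show "range w \<inter> far = {}"
    using nbrs_w_Int_hexagon by (auto simp: far_def simp del: in_nbrs)
qed

lemma card_far: "card far = 17"
proof -
  let ?R = "V - range h"
  have R: "finite ?R" "card ?R = 44"
    using h_verts finite_verts card_range_h card_verts by (auto simp: card_Diff_subset image_subset_iff)
  have "(\<Sum>v\<in>?R. card (nbrs v \<inter> range h)) = (\<Sum>u\<in>range h. card (nbrs u \<inter> ?R))"
    using h_verts by (intro sum_card_nbrs_commute) auto
  also have "\<dots> = (\<Sum>u\<in>range h. 5)"
  proof (rule sum.cong)
    fix u assume "u \<in> range h"
    then obtain i where "u = h i"
      by blast
    moreover have "nbrs u \<inter> ?R = nbrs u - nbrs u \<inter> range h"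
      by auto
    ultimately show "card (nbrs u \<inter> ?R) = 5"
      using card_nbrs_h_Int_hexagon[of i] regular[OF h_verts, of i] by (simp add: card_Diff_subset)
  qed simp
  also have "\<dots> = 30"
    using card_range_h by simp
  finally have "(\<Sum>v\<in>?R. card (nbrs v \<inter> range h) + of_bool (v \<in> far)) = 30 + card far"
    using R(1) far_subset by (simp add: sum.distrib Int_absorb1 far_def Int_def conj_commute)
  moreover have "(\<Sum>v\<in>?R. card (nbrs v \<inter> range h) + of_bool (v \<in> far))
      = (\<Sum>v\<in>?R. 1 + of_bool (v \<in> range w))"
    using hexagon_nbr_count by (intro sum.cong) auto
  moreover have "\<dots> = card ?R + card (range w)"
  proof -
    have "?R \<inter> range w = range w"
      using w_verts w_ne_h by auto
    then show ?thesis
      using R(1) by (simp only: sum.distrib) simp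
  qed
  ultimately show ?thesis
    using R(2) card_range_w by simp
qed

lemma card_nbrs_far:
  assumes y: "y \<in> far"
  shows "card (nbrs y \<inter> far) = 1 + card (nbrs y \<inter> range w)"
proof -
  have y_V: "y \<in> V" "y \<notin> range h" "nbrs y \<inter> range h = {}"
    using y by (auto simp: far_def simp del: in_nbrs)
  have not_adj: "\<not> E y (h i)" for i
    using y_V(3) h_verts[of i] by (metis IntI emptyE in_nbrs rangeI)
  have nbr_R: "z \<in> V - range h" if "z \<in> nbrs y" for z
    using y_V(3) that by auto
  have "(\<Sum>z\<in>nbrs y. card (nbrs z \<inter> range h)) = (\<Sum>u\<in>range h. card (nbrs u \<inter> nbrs y))"
    using h_verts by (intro sum_card_nbrs_commute) auto
  also have "\<dots> = (\<Sum>u\<in>range h. 1)"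
    using y_V h_verts not_adj by (intro sum.cong refl card_common_nbrs_nonadj) (auto simp: nonadj_def adj_commute)
  finally have "(\<Sum>z\<in>nbrs y. card (nbrs z \<inter> range h) + of_bool (z \<in> far)) = 6 + card (nbrs y \<inter> far)"
    using card_range_h by (simp add: sum.distrib)
  moreover have "(\<Sum>z\<in>nbrs y. card (nbrs z \<inter> range h) + of_bool (z \<in> far))
      = (\<Sum>z\<in>nbrs y. 1 + of_bool (z \<in> range w))"
    using hexagon_nbr_count nbr_R by (intro sum.cong) auto
  moreover have "\<dots> = 7 + card (nbrs y \<inter> range w)"
    using regular[OF y_V(1)] by (simp only: sum.distrib) simp
  ultimately show ?thesis
    by simp
qed

lemma nbrs_w_Diff_hexagon: "nbrs (w i) - range h \<subseteq> far"
proof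
  fix x assume x: "x \<in> nbrs (w i) - range h"
  have not_opposite: "\<not> E x (h j)" if "E (w i) (h j)" for j
    using no_triangle[of "w i" x "h j"] w_verts h_verts x that by auto
  have not_next: "\<not> E x (h l)" if "E (w i) (h j)" "E (h j) (h l)" for j l
    using common_nbr_unique[of "w i" "h l" x "h j"] w_verts h_verts w_ne_h x that by (auto simp: adj_commute)
  have "\<not> E x (h j)" for j
    using not_opposite[OF adj_w(1)] not_opposite[OF adj_w(2)] not_next[OF adj_w(1), of j]
      not_next[OF adj_w(2), of j]
    by (cases i j rule: difference_cases_6) (auto simp: adj_h_iff cycle_adj_def)
  then show "x \<in> far"
    using x by (auto simp: far_def)
qed

lemma card_nbrs_w_far: "card (nbrs (w i) \<inter> far) = 5"
proof -
  have "nbrs (w i) \<inter> far = nbrs (w i) - nbrs (w i) \<inter> range h"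
    using nbrs_w_Diff_hexagon[of i] far_subset(3) by blast
  then show ?thesis
    using regular[OF w_verts, of i] by (simp add: nbrs_w_Int_hexagon card_Diff_subset h_eq_iff h_verts adj_w)
qed

lemma card_common_nbrs_w_far:
  assumes "w i \<noteq> w j"
  shows "card (nbrs (w i) \<inter> far \<inter> (nbrs (w j) \<inter> far)) = 1"
proof -
  have "w j \<notin> nbrs (w i)"
    using nbrs_w_Diff_hexagon[of i] far_subset(4) w_ne_h by blast
  then have "nonadj (w i) (w j)"
    using assms w_verts by (simp add: nonadj_def)
  moreover have "(nbrs (w i) \<inter> range h) \<inter> (nbrs (w j) \<inter> range h) = {}"
    unfolding nbrs_w_Int_hexagon using assms by (auto simp: h_eq_iff w_eq_iff)
  then have "nbrs (w i) \<inter> far \<inter> (nbrs (w j) \<inter> far) = nbrs (w i) \<inter> nbrs (w j)"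
    using nbrs_w_Diff_hexagon[of i] by (auto simp del: in_nbrs)
  ultimately show ?thesis
    using card_common_nbrs_nonadj by simp
qed

lemma sum_card_nbrs_Int_range_w: "(\<Sum>y\<in>far. card (nbrs y \<inter> range w)) = 15"
proof -
  have "(\<Sum>y\<in>far. card (nbrs y \<inter> range w)) = (\<Sum>x\<in>range w. card (nbrs x \<inter> far))"
    using far_subset(1) w_verts by (intro sum_card_nbrs_commute) auto
  also have "\<dots> = (\<Sum>x\<in>range w. 5)"
    by (intro sum.cong) (auto simp: card_nbrs_w_far)
  finally show ?thesis
    using card_range_w by simp
qed

text \<open>Test vector: 2 on the neighbours of the vertices \<open>w i\<close> and 1 on the rest of \<open>far\<close>.\<close>

lemma card_far_nbrs_w: "13 \<le> card (\<Union>x\<in>range w. nbrs x \<inter> far)"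
proof -
  define N where "N = (\<Union>x\<in>range w. nbrs x \<inter> far)"
  define L where "L = far - N"
  have N: "N \<subseteq> far" "finite N"
    using far_subset(2) by (auto simp: N_def intro: finite_subset)
  have L: "L \<subseteq> far" "L \<subseteq> V" "finite L" and card_L: "card L = 17 - card N"
    using far_subset card_far N by (auto simp: L_def card_Diff_subset)
  have no_nbr_w: "card (nbrs y \<inter> range w) = 0" if "y \<in> L" for y
  proof -
    have "nbrs y \<inter> range w = {}"
      using that L(2) by (auto simp: L_def N_def adj_commute)
    then show ?thesis
      by simp
  qed
  have "(\<Sum>y\<in>far. card (nbrs y \<inter> L)) = (\<Sum>y\<in>L. card (nbrs y \<inter> far))"
    using far_subset(1) L(2) by (intro sum_card_nbrs_commute)
  also have "\<dots> = (\<Sum>y\<in>L. 1)"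
    using L(1) no_nbr_w card_nbrs_far by (intro sum.cong) auto
  finally have sum_L: "(\<Sum>y\<in>far. card (nbrs y \<inter> L)) = card L"
    by simp
  define f :: "'a \<Rightarrow> real" where "f y = 2 - of_bool (y \<in> L)" for y
  have "f y * (2 * f y - (\<Sum>z\<in>nbrs y \<inter> far. f z))
      \<le> 4 * of_bool (y \<in> N) - 4 * real (card (nbrs y \<inter> range w)) + 2 * real (card (nbrs y \<inter> L))"
    if y: "y \<in> far" for y
  proof -
    have "(\<Sum>z\<in>nbrs y \<inter> far. f z) = 2 + 2 * real (card (nbrs y \<inter> range w)) - real (card (nbrs y \<inter> L))"
      using card_nbrs_far[OF y] L(1) by (simp add: f_def sum_subtractf Int_assoc Int_absorb1)
    then show ?thesis
      using no_nbr_w[of y] y by (cases "y \<in> N") (auto simp: f_def L_def algebra_simps)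
  qed
  then have "(\<Sum>y\<in>far. f y * (2 * f y - (\<Sum>z\<in>nbrs y \<inter> far. f z)))
      \<le> (\<Sum>y\<in>far. 4 * of_bool (y \<in> N) - 4 * real (card (nbrs y \<inter> range w)) + 2 * real (card (nbrs y \<inter> L)))"
    by (rule sum_mono)
  also have "\<dots> = 4 * real (card N) - 60 + 2 * real (card L)"
    using far_subset(2) N(1) sum_card_nbrs_Int_range_w sum_L
    by (simp add: sum.distrib sum_subtractf Int_absorb1 flip: sum_distrib_left of_nat_sum)
  moreover have "0 \<le> (\<Sum>y\<in>far. f y * (real 2 * f y - (\<Sum>z\<in>nbrs y \<inter> far. f z)))"
    by (rule quadratic_form_nonneg_off_regular[of 2 "range h"])
      (use h_verts far_subset card_nbrs_h_Int_hexagon in \<open>auto simp: far_def\<close>)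
  ultimately have "13 \<le> card N"
    using card_L card_mono[OF far_subset(2) N(1)] card_far by simp
  then show ?thesis
    by (simp only: N_def)
qed

lemma ex_common_nbr_w: "\<exists>a\<in>V. E a (w 0) \<and> E a (w 1) \<and> E a (w 2)"
proof (rule ccontr)
  assume none: "\<not> ?thesis"
  define A where "A i = nbrs (w i) \<inter> far" for i
  have card_A: "card (A i) = 5" "finite (A i)" for i
    using card_nbrs_w_far by (simp_all add: A_def)
  have card_Int: "card (A 0 \<inter> A 1) = 1" "card (A 0 \<inter> A 2) = 1" "card (A 1 \<inter> A 2) = 1"
    using card_common_nbrs_w_far by (simp_all add: A_def w_eq_iff)
  have "(A 0 \<inter> A 2) \<inter> (A 1 \<inter> A 2) = {}"
    using none by (auto simp: A_def adj_commute)
  then have "card ((A 0 \<union> A 1) \<inter> A 2) = 2"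
    using card_Un_disjoint[of "A 0 \<inter> A 2" "A 1 \<inter> A 2"] card_A card_Int by (simp add: Int_Un_distrib2)
  moreover have "card (A 0 \<union> A 1) = 9"
    using card_Un_Int[of "A 0" "A 1"] card_A card_Int by simp
  ultimately have "card (A 0 \<union> A 1 \<union> A 2) = 12"
    using card_Un_Int[of "A 0 \<union> A 1" "A 2"] card_A by simp
  moreover have "A 0 \<union> A 1 \<union> A 2 = (\<Union>x\<in>range w. nbrs x \<inter> far)"
    unfolding range_w by (auto simp: A_def)
  ultimately show False
    using card_far_nbrs_w by simp
qed

end

section \<open>Partners of a pentagon\<close>

lemma add_two_induct_5:
  fixes i :: 5
  assumes "P 0" "\<And>i. P i \<Longrightarrow> P (i + 2)"
  shows "P i"
proof -
  have "P 2" "P 4" "P 1" "P 3"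
    using assms(1) assms(2)[of 0] assms(2)[of 2] assms(2)[of 4] assms(2)[of 1] by simp_all
  then show ?thesis
    using exhaust_5[of i] assms(1) by auto
qed

context moore_graph
begin

text \<open>A partner completes a pentagon to a Petersen subgraph.\<close>

definition partner :: "(5 \<Rightarrow> 'a) \<Rightarrow> (5 \<Rightarrow> 'a) \<Rightarrow> bool" where
  "partner p q \<longleftrightarrow> induced_cycle p \<and> range q \<subseteq> V \<and> range q \<inter> range p = {} \<and>
     (\<forall>i. E (p i) (q i)) \<and> (\<forall>i. E (q i) (q (i + 2)))"

lemma partnerD:
  assumes "partner p q"
  shows "induced_cycle p" "q i \<in> V" "q i \<noteq> p j" "q i \<notin> range p" "E (p i) (q i)" "E (q i) (q (i + 2))"
  using assms by (auto simp: partner_def)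

lemma pentagon_nbr_unique:
  fixes p :: "5 \<Rightarrow> 'a"
  assumes p: "induced_cycle p" and v: "v \<in> V" "v \<notin> range p" "E v (p i)" "E v (p j)"
  shows "i = j"
proof -
  note pD = induced_cycleD[OF p]
  have not_consecutive: False if "E v (p l)" "E v (p (l + 1))" for l
    using no_triangle[of v "p l" "p (l + 1)"] v(1) that pD by (simp add: cycle_adj_def)
  have not_dist_2: False if "E v (p l)" "E v (p (l + 2))" for l
  proof -
    have "v = p (l + 1)"
      using common_nbr_unique[of "p l" "p (l + 2)" v "p (l + 1)"] v(1) that pD
      by (simp add: cycle_adj_def adj_commute)
    then show False
      using v(2) by blast
  qed
  show ?thesis
    using not_consecutive[of i] not_consecutive[of j] not_dist_2[of i] not_dist_2[of j] v(3,4)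
    by (cases i j rule: difference_cases_5) auto
qed

lemma partnerI:
  assumes p: "induced_cycle p" and q: "\<And>i. q i \<in> V" "q 0 \<notin> range p"
    and adj: "\<And>i. E (p i) (q i)" "\<And>i. E (q i) (q (i + 2))"
  shows "partner p q"
proof -
  note pD = induced_cycleD[OF p]
  have "q i \<notin> range p" for i
  proof (induction i rule: add_two_induct_5)
    case (2 i)
    show ?case
    proof
      assume "q (i + 2) \<in> range p"
      then obtain l where l: "q (i + 2) = p l"
        by blast
      have "l = i"
        using pentagon_nbr_unique[OF p q(1) 2, of l i] adj(1)[of i] adj(2)[of i] l by (simp add: adj_commute)
      then have "E (p (i + 2)) (p i)"
        using adj(1)[of "i + 2"] l by simp
      then show False
        by (simp add: pD cycle_adj_def add.assoc)
    qed
  qed (rule q(2))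
  then show ?thesis
    using p q(1) adj by (auto simp: partner_def)
qed

lemma partner_eq_imp_index_eq:
  assumes "partner p q" "partner p q'" "q i = q' j"
  shows "i = j"
  using pentagon_nbr_unique[OF partnerD(1,2,4)[OF assms(1)], of i i j] partnerD(5)[OF assms(1), of i]
    partnerD(5)[OF assms(2), of j] assms(3) by (simp add: adj_commute)

lemma partner_unique:
  assumes q: "partner p q" and q': "partner p q'" and eq: "q i = q' i"
  shows "q = q'"
proof -
  note pD = induced_cycleD[OF partnerD(1)[OF q]]
  have step: "q (l + 2) = q' (l + 2)" if "q l = q' l" for l
    using common_nbr_unique[of "q l" "p (l + 2)" "q (l + 2)" "q' (l + 2)"] pD partnerD[OF q] partnerD[OF q'] that
    by metis
  have "q (i + j) = q' (i + j)" for j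
  proof (induction j rule: add_two_induct_5)
    case (2 j)
    then show ?case
      using step[of "i + j"] by (simp add: add.assoc)
  qed (simp add: eq)
  from this[of "_ - i"] show ?thesis
    by auto
qed

lemma nbr_of_partner:
  assumes pq: "partner p q" and z: "z \<in> V" "z \<notin> range p" "E (p j) z" "E (q i) z"
  shows "z = q j" "j = i + 2 \<or> i = j + 2"
proof -
  note pD = induced_cycleD[OF partnerD(1)[OF pq]] and qD = partnerD(2,3,5,6)[OF pq]
  have not_adj: False if "E (p i) (p j)"
    using common_nbr_unique[of "q i" "p j" z "p i"] pD qD z that by (metis adj_commute rangeI)
  have not_eq: False if "i = j"
    using no_triangle[of "p j" "q i" z] pD qD z that by blast
  show "j = i + 2 \<or> i = j + 2"
    using not_adj not_eq by (cases i j rule: difference_cases_5) (auto simp: pD cycle_adj_def)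
  then have "E (q i) (q j)"
    using qD(4) adj_sym by blast
  then show "z = q j"
    using common_nbr_unique[of "q i" "p j" z "q j"] pD qD z by metis
qed

lemma partner_swap:
  assumes pq: "partner p q"
  shows "partner (\<lambda>i. q (2 * i)) (\<lambda>i. p (2 * i))"
proof (rule partnerI)
  note pD = induced_cycleD[OF partnerD(1)[OF pq]] and qD = partnerD(2,3,5,6)[OF pq]
  show "induced_cycle (\<lambda>i. q (2 * i))"
    using qD by (intro induced_cycle_if_closed_walk_5) (simp_all add: distrib_left)
  show "E (p (2 * i)) (p (2 * (i + 2)))" for i
    by (simp add: pD cycle_adj_def algebra_simps)
  show "p (2 * 0) \<notin> range (\<lambda>i. q (2 * i))"
    using qD(2) by (metis rangeE)
qed (use induced_cycleD[OF partnerD(1)[OF pq]] partnerD[OF pq] adj_sym in auto)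

lemma card_nbrs_off_pentagon:
  fixes p :: "5 \<Rightarrow> 'a"
  assumes p: "induced_cycle p"
  shows "card (nbrs (p i) - range p) = k - 2"
proof -
  note pD = induced_cycleD[OF p]
  have nbrs: "nbrs (p i) \<inter> range p = {p (i + 1), p (i - 1)}"
    using pD by (auto simp: cycle_adj_def algebra_simps)
  then have "card (nbrs (p i) \<inter> range p) = 2"
    by (simp add: pD algebra_simps)
  then show ?thesis
    using regular[OF pD(1)] by (simp add: card_Diff_subset_Int)
qed

lemma ex_partner_degree_3:
  assumes k: "k = 3" and p: "induced_cycle p"
  obtains q where "partner p q"
proof -
  note pD = induced_cycleD[OF p]
  have "\<exists>x. nbrs (p i) - range p = {x}" for i
    using card_nbrs_off_pentagon[OF p, of i] k by (simp add: card_1_singleton_iff)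
  then obtain q where q: "nbrs (p i) - range p = {q i}" for i
    by metis
  have qD: "q i \<in> V" "q i \<notin> range p" "E (p i) (q i)" for i
    using q[of i] by auto
  have "E (q i) (q (i + 2))" for i
  proof -
    have "\<not> E (q i) (p (i + 2))"
      using pentagon_nbr_unique[OF p qD(1,2), of i "i + 2" i] qD(3)[of i] by (auto simp: adj_commute)
    then obtain x where x: "x \<in> V" "E (q i) x" "E (p (i + 2)) x"
      using ex_common_nbr[OF qD(1) pD(1), of i "i + 2"] qD(2) by blast
    have "x \<noteq> p l" for l
    proof
      assume "x = p l"
      then have "l = i"
        using pentagon_nbr_unique[OF p qD(1,2), of i l i] qD(3)[of i] x(2) by (simp add: adj_commute)
      then show False
        using x(3) \<open>x = p l\<close> by (simp add: pD cycle_adj_def add.assoc)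
    qed
    then have "x \<in> nbrs (p (i + 2)) - range p"
      using x by auto
    then show ?thesis
      using x(2) q[of "i + 2"] by simp
  qed
  then show thesis
    using that partnerI[OF p] qD by blast
qed

lemma ex_hexagon_off_pentagon:
  fixes p :: "5 \<Rightarrow> 'a"
  assumes p: "induced_cycle p" and v: "v \<in> nbrs (p 4) - range p"
  obtains u y\<^sub>2 y\<^sub>3 where "u \<in> V" "\<And>i. u \<noteq> p i" "E v u" "E (p 1) u" "y\<^sub>2 \<in> V" "E v y\<^sub>2" "E (p 2) y\<^sub>2"
    "y\<^sub>3 \<in> V" "E u y\<^sub>3" "E (p 3) y\<^sub>3"
proof -
  note pD = induced_cycleD[OF p] and p_nbr = pentagon_nbr_unique[OF p]
  have v_V: "v \<in> V" "v \<notin> range p" "E v (p 4)" "\<And>i. v \<noteq> p i"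
    using v by (auto simp: adj_commute)
  have "\<not> E v (p 1)" "\<not> E v (p 2)"
    using p_nbr[OF v_V(1,2,3)] by fastforce+
  then obtain u y\<^sub>2 where u: "u \<in> V" "E v u" "E (p 1) u" and y2: "y\<^sub>2 \<in> V" "E v y\<^sub>2" "E (p 2) y\<^sub>2"
    using ex_common_nbr[OF v_V(1) pD(1) v_V(4)] by metis
  have u_ne: "u \<noteq> p i" for i
  proof
    assume "u = p i"
    then have "4 = i"
      using p_nbr[OF v_V(1,2,3), of i] u(2) by simp
    then show False
      using u(3) \<open>u = p i\<close> by (simp add: pD cycle_adj_def)
  qed
  have "\<not> E u (p 3)"
    using p_nbr[OF u(1), of 1 3] u_ne u(3) by (auto simp: adj_commute)
  then obtain y\<^sub>3 where "y\<^sub>3 \<in> V" "E u y\<^sub>3" "E (p 3) y\<^sub>3"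
    using ex_common_nbr[OF u(1) pD(1) u_ne] by blast
  with u y2 u_ne show thesis
    by (intro that)
qed

text \<open>The vertices \<open>p 1, p 2, p 3, p 4, v\<close> and \<open>u\<close> below form a hexagon, whose opposite pairs are joined by
  \<open>p 0\<close>, \<open>y\<^sub>2\<close> and \<open>y\<^sub>3\<close>.\<close>

lemma ex_partner_at_4:
  fixes p :: "5 \<Rightarrow> 'a"
  assumes k: "k = 7" and p: "induced_cycle p" and v: "v \<in> nbrs (p 4) - range p"
  obtains q where "partner p q" "q 4 = v"
proof -
  note pD = induced_cycleD[OF p]
  have v_V: "v \<in> V" "E v (p 4)" "\<And>i. v \<noteq> p i"
    using v by (auto simp: adj_commute)
  obtain u y\<^sub>2 y\<^sub>3 where u: "u \<in> V" "\<And>i. u \<noteq> p i" "E v u" "E (p 1) u"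
    and y2: "y\<^sub>2 \<in> V" "E v y\<^sub>2" "E (p 2) y\<^sub>2" and y3: "y\<^sub>3 \<in> V" "E u y\<^sub>3" "E (p 3) y\<^sub>3"
    using ex_hexagon_off_pentagon[OF p v] by metis
  define h :: "6 \<Rightarrow> 'a" where
    "h i = (if i = 0 then p 1 else if i = 1 then p 2 else if i = 2 then p 3 else if i = 3 then p 4
      else if i = 4 then v else u)" for i
  define w :: "6 \<Rightarrow> 'a" where
    "w i = (if i = 0 \<or> i = 3 then p 0 else if i = 1 \<or> i = 4 then y\<^sub>2 else y\<^sub>3)" for i
  have "u \<noteq> v"
    using u(3) adj_irrefl by blast
  then have "inj h"
    unfolding inj_def forall_6 using u(2) u(2)[symmetric] v_V(3) v_V(3)[symmetric] by (simp add: h_def pD)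
  moreover have "\<forall>i. h i \<in> V \<and> E (h i) (h (i + 1)) \<and> w i \<in> V \<and> E (w i) (h i) \<and> E (w i) (h (i + 3))"
    unfolding forall_6 using u v_V y2 y3 by (simp add: h_def w_def pD cycle_adj_def adj_commute)
  ultimately have "moore_hexagon V E h w"
    using moore_graph_axioms k by (simp add: moore_hexagon_def moore_hexagon_axioms_def)
  then obtain a where a: "a \<in> V" "E a (p 0)" "E a y\<^sub>2" "E a y\<^sub>3"
    using moore_hexagon.ex_common_nbr_w[of V E h w] by (auto simp: w_def)
  have "partner p (quintuple a u y\<^sub>2 y\<^sub>3 v)"
  proof (rule partnerI[OF p])
    have "\<not> E a (p 2)" "\<not> E a (p 3)"
      using no_triangle[of a y\<^sub>2 "p 2"] no_triangle[of a y\<^sub>3 "p 3"] a y2 y3 pD(1) adj_sym by blast+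
    then have "a \<noteq> p i" for i
      using a(2) exhaust_5[of i] by (auto simp: pD cycle_adj_def)
    then show "quintuple a u y\<^sub>2 y\<^sub>3 v 0 \<notin> range p"
      by auto
    have "\<forall>i. quintuple a u y\<^sub>2 y\<^sub>3 v i \<in> V \<and> E (p i) (quintuple a u y\<^sub>2 y\<^sub>3 v i) \<and>
        E (quintuple a u y\<^sub>2 y\<^sub>3 v i) (quintuple a u y\<^sub>2 y\<^sub>3 v (i + 2))"
      unfolding forall_5 using a u v_V y2 y3 by (simp add: adj_commute)
    then show "quintuple a u y\<^sub>2 y\<^sub>3 v i \<in> V" "E (p i) (quintuple a u y\<^sub>2 y\<^sub>3 v i)"
      "E (quintuple a u y\<^sub>2 y\<^sub>3 v i) (quintuple a u y\<^sub>2 y\<^sub>3 v (i + 2))" for i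
      by blast+
  qed
  then show thesis
    by (rule that) simp
qed

lemma ex_partner_degree_7:
  fixes p :: "5 \<Rightarrow> 'a"
  assumes k: "k = 7" and p: "induced_cycle p" and a: "a \<in> nbrs (p 0) - range p"
  obtains q where "partner p q" "q 0 = a"
proof -
  define A where "A i = nbrs (p i) - range p" for i
  have card_A: "card (A i) = 5" "finite (A i)" for i
    using card_nbrs_off_pentagon[OF p, of i] k by (simp_all add: A_def)
  have "\<exists>q. partner p q \<and> q 4 = v" if "v \<in> A 4" for v
    using ex_partner_at_4[OF k p, of v] that unfolding A_def by blast
  then obtain Q where Q: "partner p (Q v)" "Q v 4 = v" if "v \<in> A 4" for v
    by metis
  have "inj_on (\<lambda>v. Q v 0) (A 4)"
  proof (rule inj_onI)
    fix v v' assume v: "v \<in> A 4" "v' \<in> A 4" "Q v 0 = Q v' 0"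
    then have "Q v = Q v'"
      using partner_unique Q(1) by blast
    then show "v = v'"
      using Q(2) v by metis
  qed
  then have "card ((\<lambda>v. Q v 0) ` A 4) = card (A 0)"
    using card_A by (simp add: card_image)
  moreover have "(\<lambda>v. Q v 0) ` A 4 \<subseteq> A 0"
    using partnerD(2,3,5)[OF Q(1)] by (auto simp: A_def)
  ultimately have "(\<lambda>v. Q v 0) ` A 4 = A 0"
    using card_A(2) by (intro card_subset_eq)
  moreover have "a \<in> A 0"
    using a by (simp add: A_def)
  ultimately have "a \<in> (\<lambda>v. Q v 0) ` A 4"
    by (simp only:)
  then obtain v where v: "v \<in> A 4" "a = Q v 0"
    by (rule imageE)
  show thesis
    by (rule that[of "Q v"]) (use Q v in auto)
qed

lemma partner_family:
  fixes p :: "5 \<Rightarrow> 'a"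
  assumes k: "k = 7" and p: "induced_cycle p"
  obtains Q :: "5 \<Rightarrow> 5 \<Rightarrow> 'a" where "\<forall>i. partner p (Q i)"
    "\<forall>i i' j j'. Q i j = Q i' j' \<longleftrightarrow> i = i' \<and> j = j'" "\<forall>j. nbrs (p j) - range p = range (\<lambda>i. Q i j)"
proof -
  have card_off: "card (nbrs (p j) - range p) = CARD(5)" for j
    using card_nbrs_off_pentagon[OF p] k by simp
  then obtain a :: "5 \<Rightarrow> 'a" where a: "bij_betw a UNIV (nbrs (p 0) - range p)"
    using finite_same_card_bij[of "UNIV :: 5 set" "nbrs (p 0) - range p"] by auto
  have "\<exists>q. partner p q \<and> q 0 = a i" for i
    using ex_partner_degree_7[OF k p, of "a i"] bij_betw_apply[OF a, of i] by blast
  then obtain Q where Q: "\<And>i. partner p (Q i)" "\<And>i. Q i 0 = a i"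
    by metis
  have inj: "Q i j = Q i' j' \<longleftrightarrow> i = i' \<and> j = j'" for i i' j j'
  proof
    assume eq: "Q i j = Q i' j'"
    have "j = j'"
      by (rule partner_eq_imp_index_eq[OF Q(1) Q(1) eq])
    then have "Q i = Q i'"
      using partner_unique[OF Q(1) Q(1)] eq by blast
    then have "a i = a i'"
      using Q(2) by metis
    then show "i = i' \<and> j = j'"
      using a \<open>j = j'\<close> by (simp add: bij_betw_def inj_eq)
  qed simp
  have "range (\<lambda>i. Q i j) = nbrs (p j) - range p" for j
  proof (rule card_subset_eq)
    show "range (\<lambda>i. Q i j) \<subseteq> nbrs (p j) - range p"
      using partnerD(2,3,5)[OF Q(1)] by auto
    show "card (range (\<lambda>i. Q i j)) = card (nbrs (p j) - range p)"
      using card_off by (simp add: card_image inj_def inj)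
  qed simp
  then show thesis
    using that Q(1) inj by metis
qed

end

subsection \<open>Uniqueness of the Petersen graph\<close>

fun petersen_adj :: "bool \<times> 5 \<Rightarrow> bool \<times> 5 \<Rightarrow> bool" where
  "petersen_adj (False, i) (False, j) \<longleftrightarrow> cycle_adj i j"
| "petersen_adj (True, i) (True, j) \<longleftrightarrow> j = i + 2 \<or> i = j + 2"
| "petersen_adj (False, i) (True, j) \<longleftrightarrow> i = j"
| "petersen_adj (True, i) (False, j) \<longleftrightarrow> i = j"

lemma card_petersen_nbrs: "card {w. petersen_adj v w} = 3"
proof (cases v)
  case (Pair x i)
  show ?thesis
  proof (cases x)
    case True
    then have "{w. petersen_adj v w} = {(True, i + 2), (True, i - 2), (False, i)}"
      using Pair by (auto simp: algebra_simps elim: petersen_adj.elims)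
    then show ?thesis
      by (simp add: algebra_simps)
  next
    case False
    then have "{w. petersen_adj v w} = {(False, i + 1), (False, i - 1), (True, i)}"
      using Pair by (auto simp: cycle_adj_def algebra_simps elim: petersen_adj.elims)
    then show ?thesis
      by (simp add: algebra_simps)
  qed
qed

theorem (in moore_graph) petersen_iso:
  assumes k: "k = 3"
  obtains g where "graph_iso g UNIV petersen_adj V E"
proof -
  obtain p :: "5 \<Rightarrow> 'a" where p: "induced_cycle p"
    using ex_pentagon .
  obtain q where pq: "partner p q"
    using ex_partner_degree_3[OF k p] .
  note pD = induced_cycleD[OF p] and qD = partnerD[OF pq]
  define g where "g = (\<lambda>(x, i). if x then q i else p i)"
  have inj: "inj g"
    using pD(2) qD(3) partner_eq_imp_index_eq[OF pq pq] by (auto simp: inj_def g_def dest: sym split: if_splits)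
  have verts: "g v \<in> V" for v
    using pD(1) qD(2) by (cases v) (simp add: g_def)
  have hom: "E (g v) (g w)" if "petersen_adj v w" for v w
    using that pD(3) qD(5,6) by (cases "(v, w)" rule: petersen_adj.cases) (auto simp: g_def adj_commute)
  have "graph_iso g UNIV petersen_adj V E"
    by (rule graph_iso_if_regular_hom) (use inj verts hom regular card_verts card_petersen_nbrs k in auto)
  then show thesis
    by (rule that)
qed

section \<open>Uniqueness of the Hoffman--Singleton graph\<close>

subsection \<open>Difference matrices over the residues modulo five\<close>

lemma orthomorphism_linear_5:
  fixes x :: "5 \<Rightarrow> 5"
  assumes x0: "x 0 = 0" and inj: "inj x" "inj (\<lambda>i. x i - i)"
  shows "x i = x 1 * i"
proof -
  have ne: "x i \<noteq> x j \<and> x i - i \<noteq> x j - j" if "i \<noteq> j" for i j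
    using inj[THEN injD, of i j] that by blast
  have x_ne: "x i \<noteq> 0 \<and> x i \<noteq> i" if "i \<noteq> 0" for i
    using ne[OF that] x0 by auto
  have "x 1 = 2 \<or> x 1 = 3 \<or> x 1 = 4" "x 2 = 1 \<or> x 2 = 3 \<or> x 2 = 4"
    "x 3 = 1 \<or> x 3 = 2 \<or> x 3 = 4" "x 4 = 1 \<or> x 4 = 2 \<or> x 4 = 3"
    using exhaust_5[of "x 1"] exhaust_5[of "x 2"] exhaust_5[of "x 3"] exhaust_5[of "x 4"]
      x_ne[of 1] x_ne[of 2] x_ne[of 3] x_ne[of 4] by auto
  then have "x 2 = x 1 * 2 \<and> x 3 = x 1 * 3 \<and> x 4 = x 1 * 4"
    using ne[of 1 2] ne[of 1 3] ne[of 1 4] ne[of 2 3] ne[of 2 4] ne[of 3 4] by (elim disjE) simp_all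
  then show ?thesis
    using exhaust_5[of i] x0 by auto
qed

definition difference_matrix :: "(5 \<Rightarrow> 5 \<Rightarrow> 5) \<Rightarrow> bool" where
  "difference_matrix C \<longleftrightarrow> (\<forall>i. C 0 i = 0 \<and> C i 0 = 0) \<and>
     (\<forall>h h' i i'. h \<noteq> h' \<longrightarrow> i \<noteq> i' \<longrightarrow> C h i + C h' i' \<noteq> C h i' + C h' i)"

lemma difference_matrixD:
  assumes "difference_matrix C"
  shows "C 0 i = 0" "C i 0 = 0" "h \<noteq> h' \<Longrightarrow> i \<noteq> i' \<Longrightarrow> C h i + C h' i' \<noteq> C h i' + C h' i"
  using assms by (simp_all add: difference_matrix_def)

lemma difference_matrix_transpose: "difference_matrix C \<Longrightarrow> difference_matrix (\<lambda>i h. C h i)"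
  by (simp add: difference_matrix_def add.commute)

lemma difference_matrix_row:
  assumes C: "difference_matrix C" and "h \<noteq> 0"
  shows "bij (C h)"
proof -
  have "inj (C h)"
  proof (rule injI, rule ccontr)
    fix i i' assume "C h i = C h i'" "i \<noteq> i'"
    then show False
      using difference_matrixD(3)[OF C \<open>h \<noteq> 0\<close>, of i i'] by (simp add: difference_matrixD(1)[OF C])
  qed
  then show ?thesis
    by (simp add: bij_def finite_UNIV_inj_surj)
qed

lemma difference_matrix_linear:
  assumes C: "difference_matrix C" and C_1: "\<And>i. C 1 i = i"
  shows "C h i = C h 1 * i"
proof -
  note C_0 = difference_matrixD(1,2)[OF C]
  consider "h = 0" | "h = 1" | "h \<noteq> 0" "h \<noteq> 1"
    by blast
  then show ?thesis
  proof cases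
    case 3
    show ?thesis
    proof (rule orthomorphism_linear_5)
      show "C h 0 = 0"
        by (rule C_0)
      show "inj (C h)"
        using difference_matrix_row[OF C 3(1)] by (rule bij_is_inj)
      show "inj (\<lambda>i. C h i - i)"
      proof (rule injI, rule ccontr)
        fix i j assume eq: "C h i - i = C h j - j" and "i \<noteq> j"
        then have "C h i + C 1 j \<noteq> C h j + C 1 i"
          by (intro difference_matrixD(3)[OF C 3(2)])
        then show False
          using eq unfolding C_1 by (simp add: diff_eq_eq algebra_simps)
      qed
    qed
  qed (simp_all add: C_0 C_1)
qed

lemma difference_matrix_normal_form:
  assumes C: "difference_matrix C"
  obtains \<sigma> \<tau> where "bij \<sigma>" "bij \<tau>" "\<And>h i. C (\<tau> h) (\<sigma> i) = h * i"
proof -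
  note C_0 = difference_matrixD(1,2)[OF C]
  have bij_row: "bij (C 1)"
    using difference_matrix_row[OF C] by simp
  define \<sigma> where "\<sigma> = inv_into UNIV (C 1)"
  have \<sigma>: "bij \<sigma>" and C_1: "C 1 (\<sigma> i) = i" for i
    using bij_row by (simp_all add: \<sigma>_def bij_imp_bij_inv surj_f_inv_f bij_is_surj)
  have \<sigma>_0: "\<sigma> 0 = 0"
    by (rule injD[OF bij_is_inj[OF bij_row]]) (simp_all add: C_1 C_0)
  have \<sigma>_1: "\<sigma> 1 \<noteq> 0"
    using C_1[of 1] C_0(2)[of 1] by (metis zero_neq_one)
  have bij_col: "bij (\<lambda>h. C h (\<sigma> 1))"
    by (rule difference_matrix_row[OF difference_matrix_transpose[OF C] \<sigma>_1])
  define \<tau> where "\<tau> = inv_into UNIV (\<lambda>h. C h (\<sigma> 1))"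
  have \<tau>: "bij \<tau>" and C_\<tau>: "C (\<tau> h) (\<sigma> 1) = h" for h
    using bij_col surj_f_inv_f[of "\<lambda>h. C h (\<sigma> 1)"] by (simp_all add: \<tau>_def bij_imp_bij_inv bij_is_surj)
  have "difference_matrix (\<lambda>h i. C h (\<sigma> i))"
    using C \<sigma>_0 inj_eq[OF bij_is_inj[OF \<sigma>]] by (simp add: difference_matrix_def)
  then have "C (\<tau> h) (\<sigma> i) = h * i" for h i
    using difference_matrix_linear[of "\<lambda>h i. C h (\<sigma> i)" "\<tau> h" i] by (simp add: C_1 C_\<tau>)
  then show thesis
    using that \<sigma> \<tau> by blast
qed

subsection \<open>Robertson's pentagons and pentagrams\<close>

text \<open>In the labels, pentagons are marked by \<open>False\<close> and pentagrams by \<open>True\<close>.\<close>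

fun robertson_adj :: "bool \<times> 5 \<times> 5 \<Rightarrow> bool \<times> 5 \<times> 5 \<Rightarrow> bool" where
  "robertson_adj (False, h, j) (False, h', j') \<longleftrightarrow> h = h' \<and> cycle_adj j j'"
| "robertson_adj (True, i, l) (True, i', l') \<longleftrightarrow> i = i' \<and> (l' = l + 2 \<or> l = l' + 2)"
| "robertson_adj (False, h, j) (True, i, l) \<longleftrightarrow> l = h * i + j"
| "robertson_adj (True, i, l) (False, h, j) \<longleftrightarrow> l = h * i + j"

lemma robertson_adj_iff:
  "robertson_adj (True, i, l) (x, h, j) \<longleftrightarrow>
    (if x then h = i \<and> (j = l + 2 \<or> l = j + 2) else l = h * i + j)"
  "robertson_adj (False, h, j) (x, i, l) \<longleftrightarrow> (if x then l = h * i + j else h = i \<and> cycle_adj j l)"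
  by (cases x; auto)+

lemma card_robertson_nbrs: "card {w. robertson_adj v w} = 7"
proof (cases v)
  case (fields x h j)
  show ?thesis
  proof (cases x)
    case True
    let ?T = "range (\<lambda>h'. (False, h', j - h' * h))"
    have "{w. robertson_adj v w} = {(True, h, j + 2), (True, h, j - 2)} \<union> ?T"
      using fields True by (auto simp: robertson_adj_iff algebra_simps split: if_splits)
    moreover have "card ?T = 5"
      by (simp add: card_image inj_def)
    ultimately show ?thesis
      by (subst \<open>{w. robertson_adj v w} = _\<close>, subst card_Un_disjoint) (auto simp: algebra_simps)
  next
    case False
    let ?T = "range (\<lambda>i. (True, i, h * i + j))"
    have "{w. robertson_adj v w} = {(False, h, j + 1), (False, h, j - 1)} \<union> ?T"
      using fields False by (auto simp: robertson_adj_iff cycle_adj_def algebra_simps split: if_splits)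
    moreover have "card ?T = 5"
      by (simp add: card_image inj_def)
    ultimately show ?thesis
      by (subst \<open>{w. robertson_adj v w} = _\<close>, subst card_Un_disjoint) (auto simp: algebra_simps)
  qed
qed

lemma times_3_eq_iff: "3 * j = 3 * j' \<longleftrightarrow> j = j'" for j j' :: 5
proof
  have "2 * (3 * j) = j" for j :: 5
    by simp
  then show "j = j'" if "3 * j = 3 * j'"
    using that by metis
qed simp

locale robertson_pentagons = moore_graph V E 7
  for V :: "'a set" and E :: "'a \<Rightarrow> 'a \<Rightarrow> bool" +
  fixes P Q :: "5 \<Rightarrow> 5 \<Rightarrow> 'a"
  assumes partner_P_0: "partner (P 0) (Q i)"
    and partner_Q_0: "partner (\<lambda>j. Q 0 (2 * j)) (\<lambda>j. P h (2 * j))"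
    and P_eq_iff: "P h j = P h' j' \<longleftrightarrow> h = h' \<and> j = j'"
    and Q_eq_iff: "Q i l = Q i' l' \<longleftrightarrow> i = i' \<and> l = l'"
    and nbrs_P_0: "nbrs (P 0 j) - range (P 0) = range (\<lambda>i. Q i j)"
begin

lemma Q_verts: "Q i l \<in> V" and Q_ne_P_0: "Q i l \<noteq> P 0 j" and adj_P_0_Q: "E (P 0 j) (Q i j)"
  and adj_Q_Q: "E (Q i l) (Q i (l + 2))"
  using partnerD[OF partner_P_0] by blast+

lemma P_verts: "P h j \<in> V" and P_ne_Q_0: "P h j \<noteq> Q 0 l" and adj_P_Q_0: "E (P h j) (Q 0 j)"
  and adj_P_P: "E (P h j) (P h (j + 1))"
proof -
  note D = partnerD[OF partner_Q_0[of h]]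
  show "P h j \<in> V"
    using D(2)[of "3 * j"] by simp
  show "P h j \<noteq> Q 0 l"
    using D(3)[of "3 * j" "3 * l"] by simp
  show "E (P h j) (Q 0 j)"
    using D(5)[of "3 * j"] by (simp add: adj_commute)
  show "E (P h j) (P h (j + 1))"
    using D(6)[of "3 * (j + 1)"] by (simp add: adj_commute algebra_simps)
qed

lemma P_ne_Q: "P h j \<noteq> Q i l"
proof
  assume eq: "P h j = Q i l"
  then have "E (Q 0 j) (Q i l)"
    using adj_P_Q_0[of h j] by (simp add: adj_commute)
  then have "Q i l = Q 0 l"
    using nbr_of_partner(1)[OF partner_P_0 Q_verts _ adj_P_0_Q] Q_ne_P_0 by blast
  then show False
    using eq P_ne_Q_0 by metis
qed

lemma not_adj_P_0:
  assumes "h \<noteq> 0"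
  shows "\<not> E (P h j) (P 0 l)"
proof
  assume "E (P h j) (P 0 l)"
  then have "P h j = P 0 (2 * (3 * j))"
    using P_verts P_ne_Q_0 adj_P_Q_0[of h j]
    by (intro nbr_of_partner(1)[OF partner_Q_0[of 0], where i = "3 * l"]) (auto simp: adj_commute)
  then show False
    using assms by (simp add: P_eq_iff)
qed

lemma matching_unique:
  assumes "E (P h j) (Q i l)" "E (P h j) (Q i l')"
  shows "l = l'"
proof -
  have "3 * l = 3 * l'"
    using partnerD(1)[OF partner_swap[OF partner_P_0[of i]]] P_verts
    by (rule pentagon_nbr_unique) (use assms in \<open>auto simp: P_ne_Q\<close>)
  then show ?thesis
    by (simp only: times_3_eq_iff)
qed

lemma ex_matching: "\<exists>l. E (P h j) (Q i l)"
proof (cases "h = 0")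
  case True
  then show ?thesis
    using adj_P_0_Q by blast
next
  case False
  have "\<exists>i. E (P h j) (Q i l)" for l
  proof -
    have "P h j \<noteq> P 0 l"
      using False by (simp add: P_eq_iff)
    then obtain x where x: "x \<in> V" "E (P h j) x" "E (P 0 l) x"
      using ex_common_nbr[OF P_verts P_verts] not_adj_P_0[OF False] by blast
    then have "x \<in> nbrs (P 0 l) - range (P 0)"
      using not_adj_P_0[OF False] by auto
    then show ?thesis
      using x(2) unfolding nbrs_P_0 by blast
  qed
  then obtain \<iota> where \<iota>: "E (P h j) (Q (\<iota> l) l)" for l
    by metis
  then have "inj \<iota>"
    using matching_unique by (metis injI)
  then have "surj \<iota>"
    by (simp add: finite_UNIV_inj_surj)
  then show ?thesis
    using \<iota> by (metis surjD)
qed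

definition matching :: "5 \<Rightarrow> 5 \<Rightarrow> 5 \<Rightarrow> 5" where
  "matching h i j = (THE l. E (P h j) (Q i l))"

lemma adj_P_Q_iff: "E (P h j) (Q i l) \<longleftrightarrow> l = matching h i j"
proof -
  have "\<exists>!l. E (P h j) (Q i l)"
    using ex_matching matching_unique by blast
  then show ?thesis
    unfolding matching_def by (metis (mono_tags, lifting) theI')
qed

lemma matching_0: "matching 0 i j = j" "matching h 0 j = j"
  using adj_P_0_Q adj_P_Q_0 adj_P_Q_iff by metis+

lemma matching_ne:
  assumes "h \<noteq> 0" "i \<noteq> 0"
  shows "matching h i j \<noteq> j"
proof
  assume "matching h i j = j"
  then have "E (P h j) (Q i j)"
    by (simp add: adj_P_Q_iff)
  moreover have "P h j \<noteq> P 0 j"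
    using assms by (simp add: P_eq_iff)
  ultimately have "Q i j = Q 0 j"
    using common_nbr_unique[OF P_verts P_verts] Q_verts adj_P_0_Q adj_P_Q_0 by blast
  then show False
    using assms by (simp add: Q_eq_iff)
qed

lemma matching_Suc: "cycle_adj (matching h i j) (matching h i (j + 1))"
proof -
  define x y where "x = matching h i j" and "y = matching h i (j + 1)"
  have xy: "E (P h j) (Q i x)" "E (P h (j + 1)) (Q i y)"
    by (simp_all add: adj_P_Q_iff x_def y_def)
  have "x \<noteq> y"
    using no_triangle[OF P_verts P_verts Q_verts adj_P_P[of h j] xy(2)] xy(1) by auto
  moreover have "\<not> E (Q i x) (Q i y)"
  proof
    assume "E (Q i x) (Q i y)"
    then have "P h (j + 1) = Q i x"
      using common_nbr_unique[of "P h j" "Q i y" "P h (j + 1)" "Q i x"] P_verts Q_verts P_ne_Q adj_P_P xy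
      by (simp add: adj_commute)
    then show False
      using P_ne_Q by blast
  qed
  then have "y \<noteq> x + 2" "x \<noteq> y + 2"
    using adj_Q_Q adj_sym by blast+
  ultimately show ?thesis
    unfolding x_def[symmetric] y_def[symmetric]
    by (cases x y rule: difference_cases_5) (auto simp: cycle_adj_def)
qed

lemma matching_add_2_ne: "matching h i (j + 2) \<noteq> matching h i j"
proof
  define l where "l = matching h i j"
  assume "matching h i (j + 2) = matching h i j"
  then have "E (P h j) (Q i l)" "E (P h (j + 2)) (Q i l)"
    by (simp_all add: adj_P_Q_iff l_def)
  moreover have "E (P h (j + 2)) (P h (j + 1))"
    using adj_P_P[of h "j + 1"] by (simp add: adj_commute add.assoc)
  ultimately have "P h (j + 1) = Q i l"
    using common_nbr_unique[of "P h j" "P h (j + 2)" "P h (j + 1)" "Q i l"] P_verts Q_verts adj_P_P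
    by (simp add: P_eq_iff)
  then show False
    using P_ne_Q by blast
qed

lemma matching_linear: "matching h i j = matching h i 0 + j"
proof -
  define s where "s = matching h i 1 - matching h i 0"
  have step: "z - y = y - x" if "cycle_adj x y" "cycle_adj y z" "z \<noteq> x" for x y z :: 5
    using that by (auto simp: cycle_adj_def)
  have "matching h i (j + 1) - matching h i j = s" for j
  proof (induction j rule: add_one_induct_5)
    case (2 j)
    have "matching h i (j + 1 + 1) \<noteq> matching h i j"
      using matching_add_2_ne[of h i j] by (simp add: add.assoc)
    then have "matching h i (j + 1 + 1) - matching h i (j + 1) = matching h i (j + 1) - matching h i j"
      by (rule step[OF matching_Suc matching_Suc])
    then show ?case
      using 2 by simp
  qed (simp add: s_def)
  then have Suc: "matching h i (j + 1) = matching h i j + s" for j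
    by (simp add: diff_eq_eq add.commute[of s])
  have linear: "matching h i j = matching h i 0 + s * j" for j
    by (induction j rule: add_one_induct_5) (simp_all add: Suc distrib_left flip: add.assoc)
  have "s = 1 \<or> s = - 1"
    using matching_Suc[of h i 0] by (auto simp: cycle_adj_def s_def)
  moreover have "h = 0 \<or> i = 0" if "s = - 1"
    using linear[of "3 * matching h i 0"] matching_ne[of h i "3 * matching h i 0"] that by auto
  ultimately show ?thesis
    using linear[of j] matching_0 by auto
qed

lemma matching_difference:
  assumes h: "h \<noteq> h'" and i: "i \<noteq> i'"
  shows "matching h i 0 + matching h' i' 0 \<noteq> matching h i' 0 + matching h' i 0"
proof
  assume eq: "matching h i 0 + matching h' i' 0 = matching h i' 0 + matching h' i 0"
  define j where "j = matching h i 0 - matching h' i 0"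
  have "matching h' i j = matching h i 0"
    unfolding matching_linear[of h' i j] by (simp add: j_def)
  moreover have "matching h' i' j = matching h i' 0"
    unfolding matching_linear[of h' i' j] using eq by (simp add: j_def algebra_simps)
  ultimately have "E (P h 0) (Q i (matching h i 0))" "E (P h' j) (Q i (matching h i 0))"
    "E (P h 0) (Q i' (matching h i' 0))" "E (P h' j) (Q i' (matching h i' 0))"
    by (simp_all add: adj_P_Q_iff)
  then have "Q i (matching h i 0) = Q i' (matching h i' 0)"
    using common_nbr_unique[of "P h 0" "P h' j"] P_verts Q_verts h by (simp add: P_eq_iff)
  then show False
    using i by (simp add: Q_eq_iff)
qed

lemma difference_matrix_matching: "difference_matrix (\<lambda>h i. matching h i 0)"
  using matching_difference by (simp add: difference_matrix_def matching_0)

lemma robertson_iso: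
  obtains g where "graph_iso g UNIV robertson_adj V E"
proof -
  obtain \<sigma> \<tau> where bij: "bij \<sigma>" "bij \<tau>" and matching: "\<And>h i. matching (\<tau> h) (\<sigma> i) 0 = h * i"
    using difference_matrix_normal_form[OF difference_matrix_matching] by blast
  define g where "g = (\<lambda>(x, h, j). if x then Q (\<sigma> h) j else P (\<tau> h) j)"
  have "\<sigma> i = \<sigma> j \<longleftrightarrow> i = j" "\<tau> i = \<tau> j \<longleftrightarrow> i = j" for i j
    using bij by (simp_all add: bij_is_inj inj_eq)
  then have inj: "inj g"
    using P_ne_Q P_ne_Q[symmetric] by (simp add: inj_def g_def P_eq_iff Q_eq_iff)
  have verts: "g v \<in> V" for v
    using P_verts Q_verts by (cases v) (simp add: g_def)
  have adj_P_Q: "E (P (\<tau> h) j) (Q (\<sigma> i) (h * i + j))" for h i j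
    using matching_linear[of "\<tau> h" "\<sigma> i" j] by (simp add: adj_P_Q_iff matching)
  have hom: "E (g v) (g w)" if "robertson_adj v w" for v w
    using that adj_P_P adj_Q_Q adj_P_Q adj_sym
    by (cases "(v, w)" rule: robertson_adj.cases) (auto simp: g_def cycle_adj_def)
  have "graph_iso g UNIV robertson_adj V E"
    by (rule graph_iso_if_regular_hom) (use inj verts hom regular card_verts card_robertson_nbrs in auto)
  then show thesis
    by (rule that)
qed

end

lemma (in moore_graph) ex_robertson_pentagons:
  assumes k: "k = 7"
  obtains P Q where "robertson_pentagons V E P Q"
proof -
  obtain p :: "5 \<Rightarrow> 'a" where p: "induced_cycle p"
    using ex_pentagon .
  obtain Q :: "5 \<Rightarrow> 5 \<Rightarrow> 'a" where Q: "\<forall>i. partner p (Q i)" "\<forall>i i' j j'. Q i j = Q i' j' \<longleftrightarrow> i = i' \<and> j = j'"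
      "\<forall>j. nbrs (p j) - range p = range (\<lambda>i. Q i j)"
    using partner_family[OF k p] .
  let ?q = "\<lambda>j. Q 0 (2 * j)" and ?r = "\<lambda>j. p (2 * j)"
  have swap: "partner ?q ?r"
    by (rule partner_swap[OF Q(1)[rule_format]])
  obtain R :: "5 \<Rightarrow> 5 \<Rightarrow> 'a" where R: "\<forall>h. partner ?q (R h)" "\<forall>h h' j j'. R h j = R h' j' \<longleftrightarrow> h = h' \<and> j = j'"
      "\<forall>j. nbrs (?q j) - range ?q = range (\<lambda>h. R h j)"
    using partner_family[OF k partnerD(1)[OF swap]] .
  have "?r 0 \<in> range (\<lambda>h. R h 0)"
    unfolding R(3)[rule_format, symmetric] using partnerD(2,4,5)[OF swap, of 0] by simp
  then obtain h0 where "R h0 0 = ?r 0"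
    by auto
  then have R_h0: "R h0 = ?r"
    by (rule partner_unique[OF R(1)[rule_format] swap])
  define P where "P h j = R (h + h0) (3 * j)" for h j
  have "P 0 = p"
    by (rule ext) (simp add: P_def R_h0)
  moreover have "(\<lambda>j. P h (2 * j)) = R (h + h0)" for h
    by (simp add: P_def)
  moreover have "P h j = P h' j' \<longleftrightarrow> h = h' \<and> j = j'" for h h' j j'
    by (simp add: P_def R(2) times_3_eq_iff)
  ultimately have "robertson_pentagons_axioms V E P Q"
    using Q R(1) by (simp add: robertson_pentagons_axioms_def)
  then show thesis
    using that moore_graph_axioms k by (simp add: robertson_pentagons_def)
qed

theorem (in moore_graph) hoffman_singleton_iso:
  assumes "k = 7"
  obtains g where "graph_iso g UNIV robertson_adj V E"
  using ex_robertson_pentagons[OF assms] robertson_pentagons.robertson_iso by metis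

section \<open>Degrees of Moore graphs\<close>

subsection \<open>Traces of idempotent matrices\<close>

definition mat_trace :: "'a::comm_monoid_add mat \<Rightarrow> 'a" where
  "mat_trace A = sum_list (diag_mat A)"

lemma mat_trace_eq_sum: "A \<in> carrier_mat n n \<Longrightarrow> mat_trace A = (\<Sum>i<n. A $$ (i, i))"
  by (simp add: mat_trace_def diag_mat_def interv_sum_list_conv_sum_set_nat atLeast0LessThan)

lemma mat_mult_index:
  assumes "A \<in> carrier_mat n n" "B \<in> carrier_mat n n" "i < n" "j < n"
  shows "(A * B) $$ (i, j) = (\<Sum>l<n. A $$ (i, l) * B $$ (l, j))"
  using assms by (simp add: scalar_prod_def atLeast0LessThan)

lemma mat_trace_mult_commute:
  fixes A B :: "'a::comm_semiring_0 mat"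
  assumes "A \<in> carrier_mat n n" "B \<in> carrier_mat n n"
  shows "mat_trace (A * B) = mat_trace (B * A)"
proof -
  have "mat_trace (A * B) = (\<Sum>i<n. \<Sum>l<n. A $$ (i, l) * B $$ (l, i))"
    using assms by (simp add: mat_trace_eq_sum[of _ n] mat_mult_index del: index_mult_mat(1))
  also have "\<dots> = (\<Sum>l<n. \<Sum>i<n. B $$ (l, i) * A $$ (i, l))"
    by (subst sum.swap) (simp add: mult.commute)
  also have "\<dots> = mat_trace (B * A)"
    using assms by (simp add: mat_trace_eq_sum[of _ n] mat_mult_index del: index_mult_mat(1))
  finally show ?thesis .
qed

lemma mat_trace_similar:
  fixes A B :: "'a::comm_semiring_1 mat"
  assumes A: "A \<in> carrier_mat n n" and similar: "similar_mat_wit A B P Q"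
  shows "mat_trace A = mat_trace B"
proof -
  note D = similar_mat_witD2[OF A similar]
  have "mat_trace A = mat_trace (P * (B * Q))"
    using D(3,5-7) by (simp add: assoc_mult_mat[of _ n n _ n _ n])
  also have "\<dots> = mat_trace (B * Q * P)"
    using D(5-7) by (intro mat_trace_mult_commute[of _ n]) auto
  also have "B * Q * P = B"
    using D(2,5-7) by (simp add: assoc_mult_mat[of _ n n _ n _ n])
  finally show ?thesis .
qed

lemma mat_trace_eq_sum_eigenvalues:
  fixes A :: "'a::conjugatable_ordered_field mat"
  assumes A: "A \<in> carrier_mat n n" and es: "char_poly A = (\<Prod>e\<leftarrow>es. [:- e, 1:])"
  shows "mat_trace A = sum_list es"
proof -
  obtain B P Q where "schur_decomposition A es = (B, P, Q)"
    by (metis prod_cases3)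
  then have "similar_mat_wit A B P Q" "diag_mat B = es"
    using schur_decomposition[OF A es] by blast+
  then show ?thesis
    using mat_trace_similar[OF A] by (simp add: mat_trace_def)
qed

lemma eigenvalue_idempotent_mat:
  fixes A :: "'a::field mat"
  assumes A: "A \<in> carrier_mat n n" "A * A = A" and "eigenvalue A e"
  shows "e = 0 \<or> e = 1"
proof -
  obtain v where v: "v \<in> carrier_vec n" "v \<noteq> 0\<^sub>v n" "A *\<^sub>v v = e \<cdot>\<^sub>v v"
    using assms by (auto simp: eigenvalue_def eigenvector_def)
  obtain i where i: "i < n" "v $ i \<noteq> 0"
    using v(1,2) by (metis carrier_vecD dim_vec eq_vecI index_zero_vec)
  have "e \<cdot>\<^sub>v v = A *\<^sub>v (A *\<^sub>v v)"
    using A v(1,3) by (metis assoc_mult_mat_vec)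
  also have "\<dots> = e \<cdot>\<^sub>v (e \<cdot>\<^sub>v v)"
    using A(1) v(1,3) by (metis mult_mat_vec)
  finally have "e * v $ i = e * (e * v $ i)"
    using i(1) v(1) by (metis carrier_vecD index_smult_vec smult_carrier_vec)
  then show ?thesis
    using i(2) by auto
qed

lemma mat_trace_idempotent:
  fixes A :: "complex mat"
  assumes A: "A \<in> carrier_mat n n" and idem: "A * A = A"
  obtains m :: nat where "mat_trace A = of_nat m"
proof -
  obtain es where es: "char_poly A = (\<Prod>e\<leftarrow>es. [:- e, 1:])"
    using char_poly_factorized[OF A] by blast
  have "e = 0 \<or> e = 1" if "e \<in> set es" for e
  proof -
    have "poly (char_poly A) e = 0"
      using that by (auto simp: es poly_prod_list prod_list_zero_iff)
    then show ?thesis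
      using eigenvalue_idempotent_mat[OF A idem] eigenvalue_root_char_poly[OF A] by blast
  qed
  then have "\<exists>m. sum_list es = of_nat m"
  proof (induction es)
    case (Cons e es)
    then obtain m where "sum_list es = of_nat m"
      by auto
    then have "sum_list (e # es) = of_nat (if e = 0 then m else Suc m)"
      using Cons.prems by auto
    then show ?case
      by blast
  qed (auto intro: exI[of _ 0])
  then show thesis
    using that mat_trace_eq_sum_eigenvalues[OF A es] by auto
qed

lemma idempotent_kernel_trace:
  fixes e :: "'a \<Rightarrow> 'a \<Rightarrow> real"
  assumes "finite V" and idem: "\<And>u v. u \<in> V \<Longrightarrow> v \<in> V \<Longrightarrow> (\<Sum>w\<in>V. e u w * e w v) = e u v"
  obtains m :: nat where "(\<Sum>v\<in>V. e v v) = of_nat m"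
proof -
  define n where "n = card V"
  obtain f where f: "bij_betw f {..<n} V"
    using ex_bij_betw_nat_finite[OF \<open>finite V\<close>] by (auto simp: n_def atLeast0LessThan)
  define M where "M = mat n n (\<lambda>(i, j). complex_of_real (e (f i) (f j)))"
  have M: "M \<in> carrier_mat n n"
    by (simp add: M_def)
  have "M * M = M"
  proof (rule eq_matI)
    fix i j assume "i < dim_row M" "j < dim_col M"
    then have ij: "i < n" "j < n"
      by (simp_all add: M_def)
    have "(M * M) $$ (i, j) = complex_of_real (\<Sum>l<n. e (f i) (f l) * e (f l) (f j))"
      using ij unfolding mat_mult_index[OF M M ij] by (simp add: M_def)
    also have "(\<Sum>l<n. e (f i) (f l) * e (f l) (f j)) = (\<Sum>w\<in>V. e (f i) w * e w (f j))"
      by (rule sum.reindex_bij_betw[OF f])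
    also have "\<dots> = e (f i) (f j)"
      using ij bij_betw_apply[OF f] by (intro idem) auto
    finally show "(M * M) $$ (i, j) = M $$ (i, j)"
      using ij by (simp add: M_def)
  qed (simp_all add: M_def)
  then obtain m where "mat_trace M = of_nat m"
    using mat_trace_idempotent[OF M] by blast
  moreover have "mat_trace M = complex_of_real (\<Sum>i<n. e (f i) (f i))"
    unfolding mat_trace_eq_sum[OF M] by (simp add: M_def)
  ultimately have "complex_of_real (\<Sum>i<n. e (f i) (f i)) = complex_of_real (real m)"
    by simp
  then have "(\<Sum>i<n. e (f i) (f i)) = real m"
    by (simp only: of_real_eq_iff)
  moreover have "(\<Sum>i<n. e (f i) (f i)) = (\<Sum>v\<in>V. e v v)"
    by (rule sum.reindex_bij_betw[OF f])
  ultimately show thesis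
    using that by simp
qed

subsection \<open>The spectrum of a Moore graph\<close>

context moore_graph
begin

definition shifted_adj :: "real \<Rightarrow> 'a \<Rightarrow> 'a \<Rightarrow> real" where
  "shifted_adj \<tau> u v = of_bool (E u v) - \<tau> * of_bool (u = v)"

lemma sum_mult_of_bool_eq:
  fixes f :: "'a \<Rightarrow> real"
  assumes "u \<in> V"
  shows "(\<Sum>w\<in>V. of_bool (u = w) * f w) = f u" "(\<Sum>w\<in>V. f w * of_bool (w = u)) = f u"
  using assms finite_verts
  by (simp_all add: of_bool_def if_distrib[of "\<lambda>x. x * _"] if_distrib[of "\<lambda>x. _ * x"] cong: if_cong)

lemma sum_shifted_adj:
  assumes "u \<in> V"
  shows "(\<Sum>w\<in>V. shifted_adj \<tau> u w) = real k - \<tau>" "(\<Sum>w\<in>V. shifted_adj \<tau> w u) = real k - \<tau>"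
proof -
  have "(\<Sum>w\<in>V. of_bool (E u w)) = real (card (nbrs u))"
    using finite_verts by (simp add: nbrs_def Int_def)
  then show "(\<Sum>w\<in>V. shifted_adj \<tau> u w) = real k - \<tau>"
    using sum_mult_of_bool_eq(1)[OF assms, of "\<lambda>_. \<tau>"] regular[OF assms]
    by (simp add: shifted_adj_def sum_subtractf mult.commute[of \<tau>])
  moreover have "shifted_adj \<tau> w u = shifted_adj \<tau> u w" for w
    by (auto simp: shifted_adj_def adj_commute[of w])
  ultimately show "(\<Sum>w\<in>V. shifted_adj \<tau> w u) = real k - \<tau>"
    by (simp only:)
qed

lemma sum_mult_shifted_adj:
  assumes u: "u \<in> V" and v: "v \<in> V" and root: "\<tau> * \<tau> + \<tau> = real k - 1"
  shows "(\<Sum>w\<in>V. shifted_adj \<tau> u w * shifted_adj \<tau> w v) = 1 + (- 1 - 2 * \<tau>) * shifted_adj \<tau> u v"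
proof -
  have walks: "(\<Sum>w\<in>V. of_bool (E u w) * of_bool (E w v)) = real (card (nbrs u \<inter> nbrs v))"
  proof -
    have "(\<Sum>w\<in>V. of_bool (E u w) * of_bool (E w v)) = real (card {w \<in> V. E u w \<and> E w v})"
      using finite_verts by (simp add: Int_def flip: of_bool_conj)
    moreover have "{w \<in> V. E u w \<and> E w v} = nbrs u \<inter> nbrs v"
      by (auto simp: adj_commute)
    ultimately show ?thesis
      by simp
  qed
  have "(\<Sum>w\<in>V. shifted_adj \<tau> u w * shifted_adj \<tau> w v)
      = (\<Sum>w\<in>V. of_bool (E u w) * of_bool (E w v) - \<tau> * (of_bool (E u w) * of_bool (w = v))
          - \<tau> * (of_bool (u = w) * of_bool (E w v)) + \<tau> * \<tau> * (of_bool (u = w) * of_bool (w = v)))"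
    by (simp add: shifted_adj_def algebra_simps)
  also have "\<dots> = real (card (nbrs u \<inter> nbrs v)) - 2 * \<tau> * of_bool (E u v) + \<tau> * \<tau> * of_bool (u = v)"
    by (simp only: sum.distrib sum_subtractf walks sum_mult_of_bool_eq[OF u] sum_mult_of_bool_eq[OF v]
        flip: sum_distrib_left)
  also have "\<dots> = 1 - (1 + 2 * \<tau>) * of_bool (E u v) + (real k - 1 + \<tau> * \<tau>) * of_bool (u = v)"
    by (simp add: card_common_nbrs_eq[OF u v] algebra_simps)
  also have "real k - 1 + \<tau> * \<tau> = (1 + 2 * \<tau>) * \<tau>"
    using root by (simp add: algebra_simps)
  finally show ?thesis
    by (simp add: shifted_adj_def algebra_simps)
qed

text \<open>On the vectors orthogonal to the constants, the adjacency operator \<open>A\<close> has the eigenvalues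
  \<open>\<tau>\<close> and \<open>- 1 - \<tau>\<close>. The projection onto the eigenspace of the latter is
  \<open>(A - \<tau>) (1 - J / n) / (- 1 - 2 \<tau>)\<close>, where \<open>J\<close> is the all-ones matrix.\<close>

definition eigenprojection :: "real \<Rightarrow> 'a \<Rightarrow> 'a \<Rightarrow> real" where
  "eigenprojection \<tau> u v = (shifted_adj \<tau> u v - (real k - \<tau>) / real (card V)) / (- 1 - 2 * \<tau>)"

lemma eigenprojection_idempotent:
  assumes u: "u \<in> V" and v: "v \<in> V" and root: "\<tau> * \<tau> + \<tau> = real k - 1" and "- 1 - 2 * \<tau> \<noteq> 0"
  shows "(\<Sum>w\<in>V. eigenprojection \<tau> u w * eigenprojection \<tau> w v) = eigenprojection \<tau> u v"
proof -
  define n where "n = real (card V)"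
  define c where "c = (real k - \<tau>) / n"
  define s where "s = - 1 - 2 * \<tau>"
  have "s \<noteq> 0"
    using assms(4) by (simp add: s_def)
  have proj: "eigenprojection \<tau> x y = (shifted_adj \<tau> x y - c) / s" for x y
    by (simp add: eigenprojection_def c_def s_def n_def)
  have "n \<noteq> 0"
    using verts_nonempty finite_verts by (simp add: n_def)
  then have c_n: "c * n = real k - \<tau>"
    by (simp add: c_def)
  have "n = (real k - \<tau>) * (real k - \<tau> - s)"
    using root by (simp add: n_def card_verts s_def algebra_simps)
  then have "n * 1 = n * (c * (real k - \<tau> - s))"
    unfolding c_n[symmetric] by (simp only: mult_ac mult_1)
  then have "c * (real k - \<tau> - s) = 1"
    using \<open>n \<noteq> 0\<close> mult_left_cancel by metis
  then have c_shift: "c * (real k - \<tau>) = 1 + s * c"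
    by (simp add: algebra_simps)
  have "s * s * (\<Sum>w\<in>V. eigenprojection \<tau> u w * eigenprojection \<tau> w v)
      = (\<Sum>w\<in>V. (shifted_adj \<tau> u w - c) * (shifted_adj \<tau> w v - c))"
    using \<open>s \<noteq> 0\<close> by (simp add: proj sum_distrib_left)
  also have "\<dots> = (\<Sum>w\<in>V. shifted_adj \<tau> u w * shifted_adj \<tau> w v - c * shifted_adj \<tau> u w
      - c * shifted_adj \<tau> w v + c * c)"
    by (simp add: algebra_simps)
  also have "\<dots> = 1 + s * shifted_adj \<tau> u v - 2 * (c * (real k - \<tau>)) + c * n * c"
    using sum_mult_shifted_adj[OF u v root] sum_shifted_adj(1)[OF u] sum_shifted_adj(2)[OF v]
    by (simp add: sum.distrib sum_subtractf s_def n_def flip: sum_distrib_left)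
  also have "\<dots> = s * (shifted_adj \<tau> u v - c)"
    unfolding c_n using c_shift by (simp add: algebra_simps)
  also have "\<dots> = s * s * eigenprojection \<tau> u v"
    using \<open>s \<noteq> 0\<close> by (simp add: proj)
  finally show ?thesis
    using \<open>s \<noteq> 0\<close> by simp
qed

text \<open>The dimension of the eigenspace is the trace of the projection.\<close>

lemma eigenspace_dim:
  assumes root: "\<tau> * \<tau> + \<tau> = real k - 1" and ne: "- 1 - 2 * \<tau> \<noteq> 0"
  obtains m :: nat where "real m * (- 1 - 2 * \<tau>) = - (\<tau> * (real k)\<^sup>2) - real k"
proof -
  let ?n = "real (card V)"
  obtain m where m: "(\<Sum>v\<in>V. eigenprojection \<tau> v v) = real m"
    using idempotent_kernel_trace[OF finite_verts eigenprojection_idempotent] root ne by metis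
  have "?n \<noteq> 0"
    using verts_nonempty finite_verts by simp
  have "real m * (- 1 - 2 * \<tau>) = (\<Sum>v\<in>V. - \<tau> - (real k - \<tau>) / ?n)"
    using ne unfolding m[symmetric] sum_distrib_right
    by (simp add: eigenprojection_def shifted_adj_def adj_irrefl)
  also have "\<dots> = - (\<tau> * ?n) - (real k - \<tau>)"
    using \<open>?n \<noteq> 0\<close> by (simp add: field_simps)
  also have "\<dots> = - (\<tau> * (real k)\<^sup>2) - real k"
    by (simp add: card_verts power2_eq_square algebra_simps)
  finally show thesis
    by (rule that)
qed

end

subsection \<open>The theorem of Hoffman and Singleton\<close>

lemma divisors_15: "{n::nat. n dvd 15} = {1, 3, 5, 15}"
proof -
  have "n \<in> {..15}" if "n dvd 15" for n :: nat
    using dvd_imp_le[OF that] by simp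
  then have "{n::nat. n dvd 15} = {n \<in> {..15}. n dvd 15}"
    by blast
  also have "\<dots> = {1, 3, 5, 15}"
    by (auto simp: atMost_nat_numeral atMost_Suc)
  finally show ?thesis .
qed

lemma moore_degree_equation:
  fixes m :: int and k :: nat
  assumes eq: "(4 * int k - 3) * m\<^sup>2 = ((int k)\<^sup>2 - 2 * int k)\<^sup>2" and k: "k > 2"
  shows "k \<in> {3, 7, 57}"
proof -
  define N where "N = (int k)\<^sup>2 - 2 * int k"
  have "N = int k * (int k - 2)"
    by (simp add: N_def power2_eq_square algebra_simps)
  then have "N > 0"
    using k by simp
  have "m\<^sup>2 dvd N\<^sup>2"
    using eq unfolding N_def by (metis dvd_triv_right)
  then obtain q where q: "N = m * q"
    by (auto simp: pow_divides_pow_iff)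
  then have "m \<noteq> 0"
    using \<open>N > 0\<close> by auto
  then have q_k: "4 * int k - 3 = q\<^sup>2"
    using eq q unfolding N_def[symmetric] by (simp add: power_mult_distrib mult.commute)
  have "16 * N = (4 * int k)\<^sup>2 - 8 * (4 * int k)"
    by (simp add: N_def power2_eq_square)
  also have "4 * int k = q\<^sup>2 + 3"
    using q_k by simp
  finally have "15 = q * (q\<^sup>2 * q - 2 * q - 16 * m)"
    by (simp add: q power2_eq_square algebra_simps)
  then have "q dvd 15"
    by (rule dvdI)
  then have "nat \<bar>q\<bar> dvd 15"
    by (simp add: nat_abs_dvd_iff)
  then have "nat \<bar>q\<bar> \<in> {1, 3, 5, 15}"
    using divisors_15 by blast
  then have "q\<^sup>2 = 1 \<or> q\<^sup>2 = 9 \<or> q\<^sup>2 = 25 \<or> q\<^sup>2 = 225"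
    by (auto simp: nat_eq_iff abs_eq_iff')
  then show ?thesis
    using q_k k by auto
qed

theorem (in moore_graph) degree_cases: "k \<in> {2, 3, 7, 57}"
proof (cases "k = 2")
  case False
  then have k: "k > 2"
    using degree_ge_2 by simp
  define D where "D = sqrt (4 * real k - 3)"
  have D: "D\<^sup>2 = 4 * real k - 3" "D > 0"
    using k by (simp_all add: D_def)
  define \<tau> where "\<tau> = (- 1 - D) / 2"
  have "\<tau> * \<tau> + \<tau> = real k - 1" "- 1 - 2 * \<tau> = D"
    using D(1) by (simp_all add: \<tau>_def field_simps power2_eq_square)
  then obtain m where "real m * D = - (\<tau> * (real k)\<^sup>2) - real k"
    using eigenspace_dim[of \<tau>] D(2) by auto
  then have m: "D * (2 * real m - (real k)\<^sup>2) = (real k)\<^sup>2 - 2 * real k"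
    by (simp add: \<tau>_def field_simps)
  define z where "z = 2 * int m - (int k)\<^sup>2"
  have "(D * real_of_int z)\<^sup>2 = ((real k)\<^sup>2 - 2 * real k)\<^sup>2"
    using m by (simp add: z_def)
  then have "real_of_int ((4 * int k - 3) * z\<^sup>2) = real_of_int (((int k)\<^sup>2 - 2 * int k)\<^sup>2)"
    using D(1) by (simp add: power_mult_distrib)
  then have "(4 * int k - 3) * z\<^sup>2 = ((int k)\<^sup>2 - 2 * int k)\<^sup>2"
    by (simp only: of_int_eq_iff)
  then show ?thesis
    using moore_degree_equation[OF _ k] by blast
qed simp

section \<open>Lines of positively curved graphs\<close>

subsection \<open>Two consequences of positive curvature\<close>

context finite_graph
begin

lemma sum_nbrs_split:
  fixes f :: "'a \<Rightarrow> real"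
  assumes "v \<in> nbrs u"
  shows "(\<Sum>w\<in>nbrs u. f w) = f v + (\<Sum>w\<in>nbrs u \<inter> nbrs v. f w) + (\<Sum>w\<in>private_nbrs u v. f w)"
proof -
  have "nbrs u = insert v (nbrs u \<inter> nbrs v) \<union> private_nbrs u v"
    using assms by auto
  moreover have "(\<Sum>w\<in>insert v (nbrs u \<inter> nbrs v) \<union> private_nbrs u v. f w)
      = (\<Sum>w\<in>insert v (nbrs u \<inter> nbrs v). f w) + (\<Sum>w\<in>private_nbrs u v. f w)"
    by (rule sum.union_disjoint) auto
  moreover have "(\<Sum>w\<in>insert v (nbrs u \<inter> nbrs v). f w) = f v + (\<Sum>w\<in>nbrs u \<inter> nbrs v. f w)"
    by (simp add: adj_irrefl)
  ultimately show ?thesis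
    by metis
qed

definition capped_dist :: "'a set \<Rightarrow> 'a \<Rightarrow> real" where
  "capped_dist S v =
     (if v \<in> S then 0 else if nbrs v \<inter> S \<noteq> {} then 1 else if \<exists>w\<in>nbrs v. nbrs w \<inter> S \<noteq> {} then 2 else 3)"

lemma capped_dist_lipschitz:
  assumes v: "v \<in> V" "u \<in> nbrs v"
  shows "capped_dist S v \<le> capped_dist S u + 1"
proof -
  have "capped_dist S v \<le> 1" if "u \<in> S"
  proof -
    have "nbrs v \<inter> S \<noteq> {}"
      using that v by blast
    then show ?thesis
      by (simp add: capped_dist_def)
  qed
  moreover have "capped_dist S v \<le> 2" if "nbrs u \<inter> S \<noteq> {}"
  proof -
    have "\<exists>w\<in>nbrs v. nbrs w \<inter> S \<noteq> {}"
      using that v by blast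
    then show ?thesis
      by (simp add: capped_dist_def)
  qed
  moreover have "capped_dist S v \<le> 3"
    by (simp add: capped_dist_def)
  ultimately show ?thesis
    by (simp add: capped_dist_def[of S u] split: if_splits)
qed

end

lemma (in clique_mu_graphs) not_adj_private_nbrs:
  assumes x: "x \<in> V" and y: "y \<in> nbrs x" and u: "u \<in> private_nbrs x y" and v: "v \<in> private_nbrs y x"
  shows "\<not> E u v"
proof
  assume "E u v"
  then have "x \<in> nbrs u \<inter> nbrs y" "v \<in> nbrs u \<inter> nbrs y" "x \<noteq> v"
    using x y u v by (auto simp: adj_commute)
  moreover have "nonadj u y"
    using y u by (auto simp: nonadj_def adj_commute)
  ultimately have "E x v"
    using common_nbrs_clique by blast
  then show False
    using v by simp
qed

text \<open>By Kantorovich duality, the last assumption follows from positive curvature of the edge \<open>xy\<close>.\<close>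

locale positively_curved_graph = amply_regular_clique_mu_graphs +
  assumes transport_bound:
    "x \<in> V \<Longrightarrow> y \<in> nbrs x \<Longrightarrow> \<forall>u\<in>V. \<forall>v\<in>nbrs u. f u - f v \<le> (1::real) \<Longrightarrow> f x - f y = 1 \<Longrightarrow>
      (\<Sum>u\<in>nbrs x. f u) - (\<Sum>u\<in>nbrs y. f u) < real d"
begin

lemma capped_dist_private_nbrs:
  assumes x: "x \<in> V" and y: "y \<in> nbrs x"
  shows "capped_dist (private_nbrs y x) y = 1" "capped_dist (private_nbrs y x) x = 2"
    "u \<in> private_nbrs x y \<Longrightarrow> capped_dist (private_nbrs y x) u \<ge> 2"
proof -
  let ?S = "private_nbrs y x"
  have yx: "y \<in> V" "x \<in> nbrs y"
    using x y by (auto simp: adj_commute)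
  have "nbrs y \<inter> ?S \<noteq> {}"
    using private_nbrs_nonempty[OF yx] by auto
  then show "capped_dist ?S y = 1" "capped_dist ?S x = 2"
    using y by (auto simp: capped_dist_def adj_irrefl)
  show "capped_dist ?S u \<ge> 2" if u: "u \<in> private_nbrs x y"
  proof -
    have "u \<notin> ?S" "nbrs u \<inter> ?S = {}"
      using u not_adj_private_nbrs[OF x y u] by auto
    then show ?thesis
      by (simp add: capped_dist_def)
  qed
qed

lemma sum_capped_dist_private_nbrs:
  assumes x: "x \<in> V" and y: "y \<in> nbrs x"
  shows "(\<Sum>u\<in>private_nbrs x y. capped_dist (private_nbrs y x) u) < real d + 1"
proof -
  let ?f = "capped_dist (private_nbrs y x)"
  have yx: "y \<in> V" "x \<in> nbrs y"
    using x y by (auto simp: adj_commute)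
  note dist = capped_dist_private_nbrs[OF x y]
  have "\<forall>u\<in>V. \<forall>v\<in>nbrs u. ?f u - ?f v \<le> 1"
    using capped_dist_lipschitz by (simp add: diff_le_eq add.commute)
  then have "(\<Sum>u\<in>nbrs x. ?f u) - (\<Sum>u\<in>nbrs y. ?f u) < real d"
    using transport_bound[OF x y, of ?f] dist(1,2) by simp
  moreover have "(\<Sum>u\<in>private_nbrs y x. ?f u) = 0"
    by (simp add: capped_dist_def)
  ultimately show ?thesis
    using sum_nbrs_split[OF y, of ?f] sum_nbrs_split[OF yx(2), of ?f] dist(1,2) by (simp add: Int_commute)
qed

lemma degree_le: "d \<le> 2 * Suc \<alpha>"
proof -
  obtain x where x: "x \<in> V"
    using verts_nonempty by blast
  obtain y where y: "y \<in> nbrs x"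
    using nbrs_nonempty[OF x] by blast
  have "real (card (private_nbrs x y)) * 2 \<le> (\<Sum>u\<in>private_nbrs x y. capped_dist (private_nbrs y x) u)"
    by (rule sum_bounded_below) (use capped_dist_private_nbrs(3)[OF x y] in blast)
  then have "2 * card (private_nbrs x y) \<le> d"
    using sum_capped_dist_private_nbrs[OF x y] by linarith
  then show ?thesis
    using card_private_nbrs_adj[OF x y] by simp
qed

lemma ex_private_nbr_common:
  assumes d: "d = 2 * Suc \<alpha>" and x: "x \<in> V" and y: "y \<in> nbrs x" and z: "z \<in> private_nbrs x y"
  obtains w where "w \<in> private_nbrs y x" "nbrs z \<inter> nbrs w \<noteq> {}"
proof (rule ccontr)
  let ?f = "capped_dist (private_nbrs y x)" and ?P = "private_nbrs x y"
  assume "\<not> thesis"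
  then have far: "nbrs z \<inter> nbrs w = {}" if "w \<in> private_nbrs y x" for w
    using that \<open>\<And>w. w \<in> private_nbrs y x \<Longrightarrow> nbrs z \<inter> nbrs w \<noteq> {} \<Longrightarrow> thesis\<close> by blast
  have "\<not> (\<exists>u\<in>nbrs z. nbrs u \<inter> private_nbrs y x \<noteq> {})"
  proof
    assume "\<exists>u\<in>nbrs z. nbrs u \<inter> private_nbrs y x \<noteq> {}"
    then obtain u w where u: "u \<in> nbrs z" and w: "w \<in> nbrs u" "w \<in> private_nbrs y x"
      by blast
    then have "u \<in> nbrs z \<inter> nbrs w"
      by (auto simp: adj_commute)
    then show False
      using far[OF w(2)] by blast
  qed
  then have "?f z = 3"
    using capped_dist_private_nbrs(3)[OF x y z] by (simp add: capped_dist_def split: if_splits)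
  moreover have "real (card (?P - {z})) * 2 \<le> (\<Sum>u\<in>?P - {z}. ?f u)"
    by (rule sum_bounded_below) (use capped_dist_private_nbrs(3)[OF x y] in blast)
  moreover have "(\<Sum>u\<in>?P. ?f u) = ?f z + (\<Sum>u\<in>?P - {z}. ?f u)"
    using z by (intro sum.remove) simp_all
  moreover have "card ?P = Suc (card (?P - {z}))"
    using z finite_private_nbrs by (metis card_Suc_Diff1)
  ultimately have "real (2 * card ?P) < real d"
    using sum_capped_dist_private_nbrs[OF x y] by simp
  then have "2 * card ?P < d"
    by (simp only: of_nat_less_iff)
  then show False
    using card_private_nbrs_adj[OF x y] d by simp
qed

end

subsection \<open>Lines\<close>

definition meet :: "'a set \<Rightarrow> 'a set \<Rightarrow> bool" where
  "meet l m \<longleftrightarrow> l \<noteq> m \<and> l \<inter> m \<noteq> {}"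

lemma meet_commute: "meet l m \<longleftrightarrow> meet m l"
  by (auto simp: meet_def)

text \<open>If the \<open>\<mu>\<close>-graphs are single vertices, the maximal cliques are the lines of a partial linear
  space.\<close>

locale mu_one_graph = amply_regular_clique_mu_graphs V E 1 d \<alpha>
  for V :: "'a set" and E :: "'a \<Rightarrow> 'a \<Rightarrow> bool" and d \<alpha> :: nat
begin

definition line :: "'a \<Rightarrow> 'a \<Rightarrow> 'a set" where
  "line x y = insert x (insert y (nbrs x \<inter> nbrs y))"

definition lines :: "'a set set" where
  "lines = {line x y | x y. x \<in> V \<and> y \<in> nbrs x}"

definition lines_through :: "'a \<Rightarrow> 'a set set" where
  "lines_through x = {l \<in> lines. x \<in> l}"

lemma in_line [simp]: "x \<in> line x y" "y \<in> line x y"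
  by (simp_all add: line_def)

lemma line_in_lines: "x \<in> V \<Longrightarrow> y \<in> nbrs x \<Longrightarrow> line x y \<in> lines"
  unfolding lines_def by blast

lemma common_nbr_eq:
  assumes "nonadj u v" "x \<in> nbrs u \<inter> nbrs v" "y \<in> nbrs u \<inter> nbrs v"
  shows "x = y"
proof -
  have "card (nbrs u \<inter> nbrs v) = 1"
    using assms by (intro card_common_nbrs) auto
  then show ?thesis
    using assms(2,3) by (metis card_1_singletonE singletonD)
qed

lemma local_adj_trans:
  assumes "x \<in> V" "u \<in> nbrs x" "v \<in> nbrs x" "w \<in> nbrs x" "E u v" "E v w" "u \<noteq> w"
  shows "E u w"
  using common_nbr_eq[of u w x v] assms adj_irrefl by (auto simp: nonadj_def adj_commute)

lemma line_clique:
  assumes x: "x \<in> V" and y: "y \<in> nbrs x" and ab: "a \<in> line x y" "b \<in> line x y" "a \<noteq> b"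
  shows "E a b"
proof -
  have "E u v" if "u \<in> nbrs x \<inter> nbrs y" "v \<in> nbrs x \<inter> nbrs y" "u \<noteq> v" for u v
    by (rule local_adj_trans[of x u y v]) (use that x y in \<open>auto simp: adj_commute\<close>)
  moreover have "E x u \<and> E u x \<and> E y u \<and> E u y" if "u \<in> nbrs x \<inter> nbrs y" for u
    using that adj_commute by auto
  moreover have "E x y" "E y x"
    using y adj_commute by auto
  ultimately show ?thesis
    using ab unfolding line_def by blast
qed

lemma lines_adj:
  assumes "l \<in> lines" "a \<in> l" "b \<in> l" "a \<noteq> b"
  shows "E a b"
  using assms line_clique by (auto simp: lines_def)

lemma lines_subset: "l \<in> lines \<Longrightarrow> l \<subseteq> V"
  by (auto simp: lines_def line_def)

lemma finite_line: "l \<in> lines \<Longrightarrow> finite l"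
  using lines_subset finite_verts finite_subset by blast

lemma card_lines:
  assumes "l \<in> lines"
  shows "card l = \<alpha> + 2"
proof -
  obtain x y where x: "x \<in> V" and y: "y \<in> nbrs x" and l: "l = line x y"
    using assms by (auto simp: lines_def)
  have "x \<noteq> y"
    using y adj_irrefl by auto
  then show ?thesis
    using card_common_nbrs_adj[OF x y] by (simp add: l line_def adj_irrefl)
qed

lemma line_eq:
  assumes l: "l \<in> lines" and ab: "a \<in> l" "b \<in> l" "a \<noteq> b"
  shows "l = line a b"
proof -
  have V: "l \<subseteq> V"
    by (rule lines_subset[OF l])
  then have "a \<in> V" "b \<in> nbrs a"
    using ab lines_adj[OF l] by auto
  then have m: "line a b \<in> lines"
    by (rule line_in_lines)
  have "l \<subseteq> line a b"
    using ab V lines_adj[OF l] by (auto simp: line_def)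
  then show ?thesis
    using card_lines[OF l] card_lines[OF m] finite_line[OF m] by (intro card_subset_eq) auto
qed

lemma lines_eq_if_common:
  assumes "l \<in> lines" "m \<in> lines" "a \<in> l" "a \<in> m" "b \<in> l" "b \<in> m" "a \<noteq> b"
  shows "l = m"
  using assms line_eq by metis

lemma ex_other_point:
  assumes "l \<in> lines"
  obtains y where "y \<in> l" "y \<noteq> x"
proof -
  have "\<not> l \<subseteq> {x}"
    using card_mono[of "{x}" l] card_lines[OF assms] by auto
  then show thesis
    using that by blast
qed

lemma adj_iff_line:
  assumes "x \<in> V" "y \<in> V"
  shows "E x y \<longleftrightarrow> x \<noteq> y \<and> (\<exists>l\<in>lines. x \<in> l \<and> y \<in> l)"
proof
  assume "E x y"
  then have "line x y \<in> lines" "x \<noteq> y"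
    using assms adj_irrefl by (auto intro: line_in_lines)
  then show "x \<noteq> y \<and> (\<exists>l\<in>lines. x \<in> l \<and> y \<in> l)"
    by (auto intro!: bexI[of _ "line x y"])
next
  assume "x \<noteq> y \<and> (\<exists>l\<in>lines. x \<in> l \<and> y \<in> l)"
  then show "E x y"
    using lines_adj by blast
qed

lemma ex_line:
  assumes "x \<in> V" "y \<in> V" "E x y"
  obtains l where "l \<in> lines" "x \<in> l" "y \<in> l"
  using assms adj_iff_line by blast

lemma ex_two_lines_through:
  assumes x: "x \<in> V"
  obtains l m where "l \<in> lines" "m \<in> lines" "x \<in> l" "x \<in> m" "l \<noteq> m"
proof -
  obtain y where y: "y \<in> nbrs x"
    using nbrs_nonempty[OF x] by blast
  obtain z where z: "z \<in> private_nbrs x y"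
    using private_nbrs_nonempty[OF x y] by blast
  then have "z \<in> nbrs x" "z \<notin> line x y"
    using adj_irrefl by (auto simp: line_def)
  then show thesis
    using that[of "line x y" "line x z"] line_in_lines[OF x] y in_line by metis
qed

lemma card_Un_lines_through:
  assumes "l \<in> lines" "m \<in> lines" "x \<in> l" "x \<in> m" "l \<noteq> m"
  shows "l \<union> m \<subseteq> cl_nbrs x" "card (l \<union> m) = 2 * \<alpha> + 3"
proof -
  have "n \<subseteq> cl_nbrs x" if "n \<in> lines" "x \<in> n" for n
    using lines_adj[OF that] lines_subset[OF that(1)] by auto
  then show "l \<union> m \<subseteq> cl_nbrs x"
    using assms by blast
  have "l \<inter> m = {x}"
    using assms lines_eq_if_common by blast
  then show "card (l \<union> m) = 2 * \<alpha> + 3"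
    using card_Un_Int[of l m] card_lines finite_line assms by simp
qed

end

text \<open>If the curvature is positive as well, then every point lies on exactly two lines.\<close>

locale curved_mu_one_graph = mu_one_graph V E d \<alpha> + positively_curved_graph V E 1 d \<alpha>
  for V :: "'a set" and E :: "'a \<Rightarrow> 'a \<Rightarrow> bool" and d \<alpha> :: nat
begin

lemma degree_eq: "d = 2 * Suc \<alpha>"
proof -
  obtain x where x: "x \<in> V"
    using verts_nonempty by blast
  obtain l m where lm: "l \<in> lines" "m \<in> lines" "x \<in> l" "x \<in> m" "l \<noteq> m"
    using ex_two_lines_through[OF x] .
  have "2 * \<alpha> + 3 \<le> Suc d"
    using card_mono[OF finite_cl_nbrs card_Un_lines_through(1)[OF lm]] card_Un_lines_through(2)[OF lm]
      degree[OF x] by (simp add: card_cl_nbrs)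
  then show ?thesis
    using degree_le by simp
qed

lemma lines_through_eq:
  assumes lm: "l \<in> lines" "m \<in> lines" "x \<in> l" "x \<in> m" "l \<noteq> m"
  shows "lines_through x = {l, m}"
proof -
  have x: "x \<in> V"
    using lm lines_subset by blast
  have cover: "l \<union> m = cl_nbrs x"
    using card_Un_lines_through[OF lm] degree[OF x] degree_eq
    by (intro card_subset_eq finite_cl_nbrs) (simp_all add: card_cl_nbrs)
  have "n = l \<or> n = m" if n: "n \<in> lines" "x \<in> n" for n
  proof -
    obtain t where t: "t \<in> n" "t \<noteq> x"
      using ex_other_point[OF n(1)] .
    then have "t \<in> cl_nbrs x"
      using lines_adj[OF n] lines_subset[OF n(1)] by auto
    then show ?thesis
      using lines_eq_if_common[OF n(1) _ n(2) _ t(1)] lm t(2) unfolding cover[symmetric] by blast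
  qed
  then show ?thesis
    using lm by (auto simp: lines_through_def)
qed

lemma line_cases:
  assumes "l \<in> lines" "m \<in> lines" "x \<in> l" "x \<in> m" "l \<noteq> m" and "n \<in> lines" "x \<in> n"
  shows "n = l \<or> n = m"
  using lines_through_eq[of l m x] assms by (auto simp: lines_through_def)

lemma ex_other_line:
  assumes "l \<in> lines" "x \<in> l"
  obtains m where "m \<in> lines" "x \<in> m" "m \<noteq> l"
proof -
  have "x \<in> V"
    using lines_subset assms by blast
  then show thesis
    using ex_two_lines_through[of x] that by metis
qed

lemma lines_triangle_free:
  assumes "l \<in> lines" "m \<in> lines" "n \<in> lines" "meet l m" "meet m n"
  shows "\<not> meet l n"
proof
  assume "meet l n"
  then have ne: "l \<noteq> m" "m \<noteq> n" "l \<noteq> n"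
    using assms by (auto simp: meet_def)
  obtain x y z where xyz: "x \<in> l" "x \<in> m" "y \<in> m" "y \<in> n" "z \<in> l" "z \<in> n"
    using assms \<open>meet l n\<close> by (auto simp: meet_def)
  have no_common: "\<not> (p \<in> l \<and> p \<in> m \<and> p \<in> n)" for p
    using line_cases[of l m p n] assms ne by blast
  then have "x \<noteq> y" "x \<noteq> z" "y \<noteq> z"
    using xyz by blast+
  moreover have "x \<in> V"
    using lines_subset assms(1) xyz(1) by blast
  ultimately have "x \<in> line y z"
    using lines_adj[OF assms(2) xyz(3,2)] lines_adj[OF assms(1) xyz(5,1)] by (auto simp: line_def)
  then have "x \<in> n"
    using line_eq[OF assms(3) xyz(4,6)] \<open>y \<noteq> z\<close> by blast
  then show False
    using no_common xyz by blast
qed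

lemma lines_quadrangle_free:
  assumes lines: "l \<in> lines" "m \<in> lines" "n \<in> lines" "n' \<in> lines" and lm: "l \<noteq> m"
    and meets: "meet l n" "meet m n" "meet l n'" "meet m n'"
  shows "n = n'"
proof (rule ccontr)
  assume "n \<noteq> n'"
  have disjoint: "l \<inter> m = {}"
    using lines_triangle_free[OF lines(1,2,3) _ meets(2)] meets(1) lm by (auto simp: meet_def)
  obtain a b a' b' where pts: "a \<in> l" "a \<in> n" "b \<in> m" "b \<in> n" "a' \<in> l" "a' \<in> n'" "b' \<in> m" "b' \<in> n'"
    using meets by (auto simp: meet_def)
  have V: "a \<in> V" "b \<in> V" "a' \<in> V" "b' \<in> V"
    using pts lines lines_subset by blast+
  have ne: "l \<noteq> n" "m \<noteq> n" "l \<noteq> n'" "m \<noteq> n'"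
    using meets by (auto simp: meet_def)
  have "a \<noteq> a'"
    using line_cases[OF lines(1,3) pts(1,2) ne(1) lines(4)] pts(6) ne(3) \<open>n \<noteq> n'\<close> by blast
  moreover have "b \<noteq> b'"
    using line_cases[OF lines(2,3) pts(3,4) ne(2) lines(4)] pts(8) ne(4) \<open>n \<noteq> n'\<close> by blast
  moreover have "a \<noteq> b" "a' \<noteq> b'" "a \<noteq> b'" "a' \<noteq> b"
    using disjoint pts by blast+
  ultimately have adj: "E a a'" "E b b'" "E a b" "E a' b'"
    using pts lines lines_adj by blast+
  have "\<not> E a b'"
  proof
    assume "E a b'"
    then obtain g where g: "g \<in> lines" "a \<in> g" "b' \<in> g"
      using ex_line[OF V(1,4)] by blast
    then have "g = l \<or> g = n" "g = m \<or> g = n'"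
      using line_cases[OF lines(1,3) pts(1,2) ne(1)] line_cases[OF lines(2,4) pts(7,8) ne(4)] by blast+
    then show False
      using lm ne \<open>n \<noteq> n'\<close> by blast
  qed
  then have "nonadj a b'"
    using V \<open>a \<noteq> b'\<close> by (simp add: nonadj_def)
  then have "a' = b"
    using common_nbr_eq[of a b' a' b] adj V by (auto simp: adj_commute)
  then show False
    using \<open>a' \<noteq> b\<close> by blast
qed

lemma lines_path_private_nbr:
  assumes lines: "b \<in> lines" "c \<in> lines" "c' \<in> lines" and disjoint: "b \<inter> c' = {}"
    and xy: "x \<in> b" "x \<in> c" "y \<in> c" "y \<in> c'" and ne: "b \<noteq> c" "c \<noteq> c'" and z: "z \<in> b" "z \<noteq> x"
  shows "y \<in> nbrs x" "z \<in> private_nbrs x y"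
proof -
  have V: "y \<in> V" "z \<in> V"
    using xy z lines lines_subset by blast+
  have "x \<noteq> y" "y \<noteq> z"
    using disjoint xy z by blast+
  then show "y \<in> nbrs x"
    using V lines_adj[OF lines(2) xy(2,3)] by simp
  have "\<not> E y z"
  proof
    assume "E y z"
    then obtain g where g: "g \<in> lines" "y \<in> g" "z \<in> g"
      using ex_line[OF V] by blast
    then consider "g = c" | "g = c'"
      using line_cases[OF lines(2,3) xy(3,4) ne(2)] by blast
    then show False
      using lines_eq_if_common[OF lines(1,2) xy(1,2) z(1)] g(3) z ne(1) disjoint by cases blast+
  qed
  then show "z \<in> private_nbrs x y"
    using V \<open>y \<noteq> z\<close> lines_adj[OF lines(1) xy(1) z(1)] z(2) by auto
qed

lemma ex_meeting_lines:
  assumes lines: "b \<in> lines" "c \<in> lines" "c' \<in> lines" and disjoint: "b \<inter> c' = {}"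
    and xy: "x \<in> b" "x \<in> c" "y \<in> c" "y \<in> c'" and ne: "b \<noteq> c" "c \<noteq> c'" and z: "z \<in> b" "z \<noteq> x"
  obtains h i where "h \<in> lines" "i \<in> lines" "z \<in> h" "h \<noteq> b" "h \<inter> i \<noteq> {}" "i \<inter> c' \<noteq> {}"
proof -
  have V: "x \<in> V" "y \<in> V" "z \<in> V"
    using xy z lines lines_subset by blast+
  obtain w t where w: "w \<in> private_nbrs y x" and t: "t \<in> nbrs z \<inter> nbrs w"
    using ex_private_nbr_common[OF degree_eq V(1) lines_path_private_nbr[OF assms]] by blast
  have "w \<notin> c"
    using w lines_adj[OF lines(2) xy(2)] by auto
  then have "w \<in> c'"
    using ex_line[OF V(2), of w] w line_cases[OF lines(2,3) xy(3,4) ne(2)] by auto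
  obtain h where h: "h \<in> lines" "z \<in> h" "t \<in> h"
    using ex_line[OF V(3), of t] t by auto
  obtain i where i: "i \<in> lines" "w \<in> i" "t \<in> i"
    using ex_line[of w t] w t by auto
  have "h \<noteq> b"
  proof
    assume "h = b"
    then have "meet b i" "meet c' i"
      using h i \<open>w \<in> c'\<close> disjoint by (auto simp: meet_def)
    moreover have "meet b c" "meet c' c" "b \<noteq> c'"
      using xy ne disjoint by (auto simp: meet_def)
    ultimately have "i = c"
      using lines_quadrangle_free lines i(1) by blast
    then show False
      using i \<open>w \<notin> c\<close> by blast
  qed
  then show thesis
    using that[of h i] h i \<open>w \<in> c'\<close> by blast
qed

definition within_two :: "'a set \<Rightarrow> 'a set \<Rightarrow> bool" where
  "within_two l m \<longleftrightarrow> l = m \<or> meet l m \<or> (\<exists>g\<in>lines. meet l g \<and> meet g m)"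

lemma within_two_path_3:
  assumes lines: "l \<in> lines" "b \<in> lines" "c \<in> lines" "c' \<in> lines"
    and meets: "meet l b" "meet b c" "meet c c'" and "l \<noteq> c"
  shows "within_two l c'"
proof (cases "b \<inter> c' = {}")
  case True
  obtain x y z where pts: "z \<in> l" "z \<in> b" "x \<in> b" "x \<in> c" "y \<in> c" "y \<in> c'"
    using meets by (auto simp: meet_def)
  have ne: "l \<noteq> b" "b \<noteq> c" "c \<noteq> c'"
    using meets by (auto simp: meet_def)
  have "z \<noteq> x"
    using line_cases[OF lines(1,2) pts(1,2) ne(1) lines(3)] pts(4) ne(2) \<open>l \<noteq> c\<close> by blast
  then obtain h i where hi: "h \<in> lines" "i \<in> lines" "z \<in> h" "h \<noteq> b" "h \<inter> i \<noteq> {}" "i \<inter> c' \<noteq> {}"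
    using ex_meeting_lines[OF lines(2-4) True pts(3-6) ne(2,3) pts(2)] by blast
  then have "h = l"
    using line_cases[OF lines(1,2) pts(1,2) ne(1) hi(1)] by blast
  then show ?thesis
    using hi by (auto simp: within_two_def meet_def)
next
  case False
  then have "b = c' \<or> meet b c'"
    by (simp add: meet_def)
  then show ?thesis
    using meets(1) lines(2) by (auto simp: within_two_def)
qed

lemma within_two_meet:
  assumes lines: "l \<in> lines" "c \<in> lines" "c' \<in> lines" and "within_two l c" and meet: "meet c c'"
  shows "within_two l c'"
proof -
  consider "l = c" | "meet l c" "l \<noteq> c" | g where "g \<in> lines" "meet l g" "meet g c" "l \<noteq> c"
    using \<open>within_two l c\<close> by (auto simp: within_two_def)
  then show ?thesis
  proof cases
    case 3
    show ?thesis
      by (rule within_two_path_3[OF lines(1) 3(1) lines(2,3) 3(2,3) meet 3(4)])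
  qed (use lines meet in \<open>auto simp: within_two_def\<close>)
qed

lemma lines_within_two:
  assumes l: "l \<in> lines" and m: "m \<in> lines"
  shows "within_two l m"
proof -
  define R where "R = {c \<in> lines. within_two l c}"
  have R_step: "c' \<in> R" if "c \<in> R" "c' \<in> lines" "c \<inter> c' \<noteq> {}" for c c'
    using within_two_meet[OF l, of c c'] that by (cases "c = c'") (auto simp: R_def meet_def)
  have "\<Union>R = V"
  proof (rule closed_subset_eq)
    show "\<Union>R \<subseteq> V"
      using lines_subset by (auto simp: R_def)
    obtain v where "v \<in> l"
      using ex_other_point[OF l] .
    then show "\<Union>R \<noteq> {}"
      using l by (auto simp: R_def within_two_def)
  next
    fix u assume "u \<in> \<Union>R"
    then obtain c where c: "c \<in> R" "u \<in> c"
      by blast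
    then have "u \<in> V"
      using lines_subset by (auto simp: R_def)
    show "nbrs u \<subseteq> \<Union>R"
    proof
      fix v assume "v \<in> nbrs u"
      then obtain c' where "c' \<in> lines" "u \<in> c'" "v \<in> c'"
        using ex_line[of u v] \<open>u \<in> V\<close> by auto
      then show "v \<in> \<Union>R"
        using R_step[OF c(1)] c(2) by blast
    qed
  qed
  moreover obtain v where "v \<in> m"
    using ex_other_point[OF m] .
  ultimately obtain c where "c \<in> R" "v \<in> c"
    using lines_subset[OF m] by blast
  then have "m \<in> R"
    using R_step m \<open>v \<in> m\<close> by blast
  then show ?thesis
    by (simp add: R_def)
qed

sublocale meeting: finite_graph lines meet
proof
  have "lines \<subseteq> Pow V"
    using lines_subset by auto
  then show "finite lines"
    using finite_verts finite_subset by blast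
qed (auto simp: meet_def)

lemma card_meeting_lines:
  assumes l: "l \<in> lines"
  shows "card (meeting.nbrs l) = \<alpha> + 2"
proof -
  have "\<forall>x\<in>l. \<exists>m. m \<in> lines \<and> x \<in> m \<and> m \<noteq> l"
    using ex_other_line[OF l] by metis
  then obtain f where f: "\<And>x. x \<in> l \<Longrightarrow> f x \<in> lines \<and> x \<in> f x \<and> f x \<noteq> l"
    by metis
  have "bij_betw f l (meeting.nbrs l)"
  proof (rule bij_betw_imageI)
    show "inj_on f l"
    proof (rule inj_onI)
      fix x y assume "x \<in> l" "y \<in> l" "f x = f y"
      then show "x = y"
        using lines_eq_if_common[of l "f x" x y] f[of x] f[of y] l by auto
    qed
    have "m \<in> f ` l" if m: "m \<in> lines" "meet l m" for m
    proof -
      obtain x where x: "x \<in> l" "x \<in> m"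
        using m(2) by (auto simp: meet_def)
      then have "m = f x"
        using line_cases[of l "f x" x m] f[of x] l m by (auto simp: meet_def)
      then show ?thesis
        using x(1) by blast
    qed
    moreover have "meet l (f x)" if "x \<in> l" for x
      using f[OF that] that by (auto simp: meet_def)
    ultimately show "f ` l = meeting.nbrs l"
      using f by auto
  qed
  then show ?thesis
    using bij_betw_same_card card_lines[OF l] by metis
qed

lemma lines_not_complete: "\<exists>l m. meeting.nonadj l m"
proof -
  obtain x where x: "x \<in> V"
    using verts_nonempty by blast
  obtain l m where lm: "l \<in> lines" "m \<in> lines" "x \<in> l" "x \<in> m" "l \<noteq> m"
    using ex_two_lines_through[OF x] .
  obtain y where y: "y \<in> m" "y \<noteq> x"
    using ex_other_point[OF lm(2)] .
  obtain n where n: "n \<in> lines" "y \<in> n" "n \<noteq> m"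
    using ex_other_line[OF lm(2) y(1)] .
  have "y \<notin> l"
    using lines_eq_if_common[OF lm(1-4) _ y(1)] y(2) lm(5) by blast
  moreover have "\<not> meet l n"
    using lm n y by (intro lines_triangle_free[of l m n]) (auto simp: meet_def)
  ultimately show ?thesis
    using lm n by (auto simp: meeting.nonadj_def)
qed

theorem lines_moore: "moore_graph lines meet (\<alpha> + 2)"
proof -
  have common: "\<exists>g. meeting.nbrs l \<inter> meeting.nbrs m = {g}" if nonadj: "meeting.nonadj l m" for l m
  proof -
    have lm: "l \<in> lines" "m \<in> lines" "l \<noteq> m" "\<not> meet l m"
      using nonadj by (auto simp: meeting.nonadj_def)
    then obtain g where g: "g \<in> lines" "meet l g" "meet g m"
      using lines_within_two unfolding within_two_def by blast
    have "h = g" if "h \<in> meeting.nbrs l \<inter> meeting.nbrs m" for h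
      using lines_quadrangle_free[OF lm(1,2) _ g(1) lm(3), of h] that g by (auto simp: meet_commute)
    moreover have "g \<in> meeting.nbrs l \<inter> meeting.nbrs m"
      using g by (simp add: meet_commute)
    ultimately show ?thesis
      by blast
  qed
  have triangle_free: "meeting.nbrs l \<inter> meeting.nbrs m = {}" if "l \<in> lines" "m \<in> meeting.nbrs l" for l m
  proof -
    have "\<not> (n \<in> meeting.nbrs l \<and> n \<in> meeting.nbrs m)" for n
      using lines_triangle_free[of l m n] that by auto
    then show ?thesis
      by blast
  qed
  show ?thesis
  proof unfold_locales
    show "card (meeting.nbrs l) = \<alpha> + 2" if "l \<in> lines" for l
      by (rule card_meeting_lines[OF that])
    show "meeting.nbrs l \<inter> meeting.nbrs m = {}" if "l \<in> lines" "m \<in> meeting.nbrs l" for l m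
      by (rule triangle_free[OF that])
    show "\<exists>l m. meeting.nonadj l m"
      by (rule lines_not_complete)
    fix l m assume "meeting.nonadj l m"
    then obtain g where g: "meeting.nbrs l \<inter> meeting.nbrs m = {g}"
      using common by blast
    show "meeting.nbrs l \<inter> meeting.nbrs m \<noteq> {}" "card (meeting.nbrs l \<inter> meeting.nbrs m) = 1"
      by (simp_all add: g)
    fix x y assume "x \<in> meeting.nbrs l \<inter> meeting.nbrs m" "y \<in> meeting.nbrs l \<inter> meeting.nbrs m" "x \<noteq> y"
    then show "meet x y"
      unfolding g by simp
  qed
qed

end

subsection \<open>Line graphs\<close>

definition edge_set :: "'a set \<Rightarrow> ('a \<Rightarrow> 'a \<Rightarrow> bool) \<Rightarrow> 'a set set" where
  "edge_set V E = {{u, v} | u v. u \<in> V \<and> v \<in> V \<and> E u v}"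

theorem (in curved_mu_one_graph) lines_through_iso:
  "graph_iso lines_through V E (edge_set lines meet) meet"
proof (rule graph_isoI)
  have inj: "inj_on lines_through V"
  proof (rule inj_onI)
    fix x y assume xy: "x \<in> V" "y \<in> V" "lines_through x = lines_through y"
    obtain l m where lm: "l \<in> lines" "m \<in> lines" "x \<in> l" "x \<in> m" "l \<noteq> m"
      using ex_two_lines_through[OF xy(1)] .
    then have "y \<in> l" "y \<in> m"
      using xy(3) by (auto simp: lines_through_def)
    then show "x = y"
      using lines_eq_if_common lm by blast
  qed
  have "lines_through x \<in> edge_set lines meet" if x: "x \<in> V" for x
  proof -
    obtain l m where lm: "l \<in> lines" "m \<in> lines" "x \<in> l" "x \<in> m" "l \<noteq> m"
      using ex_two_lines_through[OF x] .
    then have "meet l m"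
      by (auto simp: meet_def)
    then show ?thesis
      using lm lines_through_eq[OF lm] unfolding edge_set_def by blast
  qed
  moreover have "e \<in> lines_through ` V" if "e \<in> edge_set lines meet" for e
  proof -
    obtain l m x where lm: "e = {l, m}" "l \<in> lines" "m \<in> lines" "x \<in> l" "x \<in> m" "l \<noteq> m"
      using \<open>e \<in> edge_set lines meet\<close> by (auto simp: edge_set_def meet_def)
    then have "e = lines_through x"
      using lines_through_eq[OF lm(2-6)] by simp
    then show ?thesis
      using lines_subset[OF lm(2)] lm(4) by blast
  qed
  ultimately have "lines_through ` V = edge_set lines meet"
    by blast
  with inj show "bij_betw lines_through V (edge_set lines meet)"
    by (simp add: bij_betw_def)
  fix x y assume xy: "x \<in> V" "y \<in> V"
  then have "lines_through x = lines_through y \<longleftrightarrow> x = y"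
    using inj by (auto simp: inj_on_def)
  then show "E x y \<longleftrightarrow> meet (lines_through x) (lines_through y)"
    using adj_iff_line[OF xy] by (auto simp: meet_def lines_through_def)
qed

lemma edge_set_iso:
  assumes iso: "graph_iso g W F V E"
  shows "graph_iso ((`) g) (edge_set W F) meet (edge_set V E) meet"
proof (rule graph_isoI)
  have g: "inj_on g W" "g ` W = V" and adj: "\<And>u v. u \<in> W \<Longrightarrow> v \<in> W \<Longrightarrow> F u v \<longleftrightarrow> E (g u) (g v)"
    using iso by (auto simp: graph_iso_def bij_betw_def)
  have "inj_on ((`) g) (edge_set W F)"
    by (rule inj_on_subset[OF inj_on_image_Pow[OF g(1)]]) (auto simp: edge_set_def)
  moreover have "(`) g ` edge_set W F = edge_set V E"
  proof
    show "(`) g ` edge_set W F \<subseteq> edge_set V E"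
      using adj g(2) by (auto simp: edge_set_def)
    show "edge_set V E \<subseteq> (`) g ` edge_set W F"
    proof
      fix e assume "e \<in> edge_set V E"
      then obtain u v where "e = {g u, g v}" "u \<in> W" "v \<in> W" "F u v"
        using adj g(2) by (auto simp: edge_set_def)
      then show "e \<in> (`) g ` edge_set W F"
        by (intro image_eqI[of _ _ "{u, v}"]) (auto simp: edge_set_def)
    qed
  qed
  ultimately show "bij_betw ((`) g) (edge_set W F) (edge_set V E)"
    by (simp add: bij_betw_def)
  fix e f assume "e \<in> edge_set W F" "f \<in> edge_set W F"
  then have "e \<subseteq> W" "f \<subseteq> W"
    by (auto simp: edge_set_def)
  then show "meet e f \<longleftrightarrow> meet (g ` e) (g ` f)"
    using inj_on_image_eq_iff[OF g(1)] inj_on_image_Int[OF g(1)] by (metis image_is_empty meet_def)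
qed

lemma pentagon_edge_set_iso:
  "graph_iso (\<lambda>i::5. {i, i + 1}) UNIV cycle_adj (edge_set UNIV cycle_adj) meet"
proof (rule graph_isoI)
  have edge_eq: "{i, i + 1} = {j, j + 1} \<longleftrightarrow> i = j" for i j :: 5
    by (cases i j rule: difference_cases_5) (auto simp: doubleton_eq_iff)
  have "range (\<lambda>i::5. {i, i + 1}) = edge_set UNIV cycle_adj"
    by (auto simp: edge_set_def cycle_adj_def)
  then show "bij_betw (\<lambda>i::5. {i, i + 1}) UNIV (edge_set UNIV cycle_adj)"
    by (simp add: bij_betw_def inj_def edge_eq)
  show "cycle_adj i j \<longleftrightarrow> meet {i, i + 1} {j, j + 1}" for i j :: 5
    unfolding meet_def edge_eq by (cases i j rule: difference_cases_5) (auto simp: cycle_adj_def)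
qed

section \<open>Lin--Lu--Yau curvature\<close>

subsection \<open>Adjacency and distance\<close>

definition arc_adj :: "'a pair_pre_digraph \<Rightarrow> 'a \<Rightarrow> 'a \<Rightarrow> bool" where
  "arc_adj G u v \<longleftrightarrow> (u, v) \<in> parcs G"

context pair_graph
begin

abbreviation adjacent :: "'a \<Rightarrow> 'a \<Rightarrow> bool" where
  "adjacent \<equiv> arc_adj G"

sublocale graph: finite_graph "pverts G" adjacent
proof
  show "finite (pverts G)"
    by (rule pair_finite_verts)
  show "adjacent v u" if "adjacent u v" for u v
    using that arcs_symmetric by (simp add: arc_adj_def)
  show "\<not> adjacent v v" for v
    using pair_no_loops[of "(v, v)"] by (auto simp: arc_adj_def)
qed

lemma adjacent_verts: "adjacent u v \<Longrightarrow> u \<in> pverts G" "adjacent u v \<Longrightarrow> v \<in> pverts G"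
  using in_arcsD1 in_arcsD2 by (auto simp: arc_adj_def)

lemma in_nbrs_iff: "v \<in> graph.nbrs u \<longleftrightarrow> adjacent u v"
  using adjacent_verts by auto

lemma out_degree_eq: "out_degree (with_proj G) u = card (graph.nbrs u)"
proof -
  have "out_arcs (with_proj G) u = Pair u ` graph.nbrs u"
    using adjacent_verts by (auto simp: out_arcs_def arc_adj_def)
  then show ?thesis
    by (simp add: out_degree_def card_image inj_on_def)
qed

lemma common_neighbours_eq: "common_neighbours G u v = graph.nbrs u \<inter> graph.nbrs v"
  by (auto simp: common_neighbours_def arc_adj_def)

lemma complete_graph_iff: "complete_graph G \<longleftrightarrow> \<not> (\<exists>u v. graph.nonadj u v)"
proof
  assume "\<not> (\<exists>u v. graph.nonadj u v)"
  then have "parcs G = {(u, v). (u, v) \<in> pverts G \<times> pverts G \<and> u \<noteq> v}"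
    using adjacent_verts graph.adj_irrefl by (auto simp: graph.nonadj_def arc_adj_def)
  then show "complete_graph G"
    unfolding complete_graph_def complete_digraph_pair_def using graph.finite_verts by blast
qed (auto simp: complete_graph_def complete_digraph_pair_def graph.nonadj_def arc_adj_def)

lemma gdist_eq: "gdist G u v = (INF p\<in>{p. awalk u p v}. ereal (real (length p)))"
proof -
  have "awalk_cost (\<lambda>_. 1) p = real (length p)" for p :: "('a \<times> 'a) list"
    by (induction p) auto
  then show ?thesis
    by (simp add: gdist_def \<mu>_def)
qed

lemma gdist_le: "awalk u p v \<Longrightarrow> gdist G u v \<le> ereal (real (length p))"
  unfolding gdist_eq by (rule INF_lower) simp

lemma gdist_attained:
  assumes "awalk u q v"
  obtains p where "awalk u p v" "gdist G u v = ereal (real (length p))"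
proof -
  define n where "n = (LEAST n. \<exists>p. awalk u p v \<and> length p = n)"
  have "\<exists>p. awalk u p v \<and> length p = n"
    unfolding n_def by (rule LeastI_ex) (use assms in blast)
  then obtain p where p: "awalk u p v" "length p = n"
    by blast
  have "n \<le> length q" if "awalk u q v" for q
    unfolding n_def by (rule Least_le) (use that in blast)
  then have "ereal (real n) \<le> gdist G u v"
    unfolding gdist_eq by (intro INF_greatest) auto
  then have "gdist G u v = ereal (real (length p))"
    using gdist_le[OF p(1)] p(2) by simp
  then show thesis
    by (rule that[OF p(1)])
qed

lemma gdist_eq_iff:
  "gdist G u v = ereal (real n) \<longleftrightarrow>
    (\<exists>p. awalk u p v \<and> length p = n) \<and> (\<forall>p. awalk u p v \<longrightarrow> n \<le> length p)"
proof
  assume dist: "gdist G u v = ereal (real n)"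
  have "{p. awalk u p v} \<noteq> {}"
  proof
    assume "{p. awalk u p v} = {}"
    then have "gdist G u v = \<infinity>"
      by (simp only: gdist_eq image_empty Inf_empty top_ereal_def)
    then show False
      using dist by simp
  qed
  then obtain p where "awalk u p v" "gdist G u v = ereal (real (length p))"
    using gdist_attained by blast
  then show "(\<exists>p. awalk u p v \<and> length p = n) \<and> (\<forall>p. awalk u p v \<longrightarrow> n \<le> length p)"
    using dist gdist_le[of u _ v] by auto
next
  assume "(\<exists>p. awalk u p v \<and> length p = n) \<and> (\<forall>p. awalk u p v \<longrightarrow> n \<le> length p)"
  then obtain p where p: "awalk u p v" "length p = n" and min: "\<And>q. awalk u q v \<Longrightarrow> n \<le> length q"
    by blast
  show "gdist G u v = ereal (real n)"
  proof (rule antisym)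
    show "gdist G u v \<le> ereal (real n)"
      using gdist_le[OF p(1)] p(2) by simp
    show "ereal (real n) \<le> gdist G u v"
      unfolding gdist_eq using min by (intro INF_greatest) auto
  qed
qed

lemma awalk_length_0_iff: "awalk u p v \<and> length p = 0 \<longleftrightarrow> p = [] \<and> u = v \<and> u \<in> pverts G"
  by (auto simp: awalk_Nil_iff)

lemma awalk_length_1_iff: "awalk u p v \<and> length p = 1 \<longleftrightarrow> p = [(u, v)] \<and> adjacent u v"
  using adjacent_verts
  by (cases p) (auto simp: awalk_Cons_iff awalk_Nil_iff arc_adj_def)

lemma awalk_length_2_iff:
  "awalk u p v \<and> length p = 2 \<longleftrightarrow> (\<exists>w. p = [(u, w), (w, v)] \<and> adjacent u w \<and> adjacent w v)"
proof
  assume p: "awalk u p v \<and> length p = 2"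
  then obtain a b c e where "p = [(a, b), (c, e)]"
    by (auto simp: numeral_2_eq_2 length_Suc_conv)
  then show "\<exists>w. p = [(u, w), (w, v)] \<and> adjacent u w \<and> adjacent w v"
    using p by (auto simp: awalk_Cons_iff awalk_Nil_iff arc_adj_def)
qed (use adjacent_verts in \<open>auto simp: awalk_Cons_iff awalk_Nil_iff arc_adj_def\<close>)

lemma gdist_adjacent:
  assumes "adjacent u v"
  shows "gdist G u v = 1"
proof -
  have "1 \<le> length p" if "awalk u p v" for p
  proof -
    have "p \<noteq> []"
      using that assms graph.adj_irrefl by (auto simp: awalk_Nil_iff)
    then show ?thesis
      by (simp add: Suc_le_eq)
  qed
  then have "gdist G u v = ereal (real 1)"
    unfolding gdist_eq_iff using awalk_length_1_iff[of u "[(u, v)]" v] assms by auto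
  then show ?thesis
    by (simp add: one_ereal_def)
qed

lemma gdist_2_iff:
  assumes "u \<in> pverts G" "v \<in> pverts G"
  shows "gdist G u v = 2 \<longleftrightarrow> graph.nonadj u v \<and> graph.nbrs u \<inter> graph.nbrs v \<noteq> {}"
proof -
  have "(\<forall>p. awalk u p v \<longrightarrow> 2 \<le> length p) \<longleftrightarrow>
      \<not> (\<exists>p. awalk u p v \<and> length p = 0) \<and> \<not> (\<exists>p. awalk u p v \<and> length p = 1)"
  proof -
    have "2 \<le> n \<longleftrightarrow> n \<noteq> 0 \<and> n \<noteq> 1" for n :: nat
      by auto
    then show ?thesis
      by metis
  qed
  also have "\<dots> \<longleftrightarrow> graph.nonadj u v"
    using assms unfolding awalk_length_0_iff awalk_length_1_iff by (auto simp: graph.nonadj_def)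
  finally have far: "(\<forall>p. awalk u p v \<longrightarrow> 2 \<le> length p) \<longleftrightarrow> graph.nonadj u v" .
  have "(\<exists>p. awalk u p v \<and> length p = 2) \<longleftrightarrow> graph.nbrs u \<inter> graph.nbrs v \<noteq> {}"
    unfolding awalk_length_2_iff by (auto simp: in_nbrs_iff graph.adj_commute[of v] simp del: graph.in_nbrs)
  moreover have "gdist G u v = 2 \<longleftrightarrow> gdist G u v = ereal (real 2)"
    by (simp add: numeral_eq_ereal)
  ultimately show ?thesis
    unfolding gdist_eq_iff far by blast
qed

lemma lipschitz_awalk:
  fixes f :: "'a \<Rightarrow> real"
  assumes lipschitz: "\<And>u v. adjacent u v \<Longrightarrow> f u - f v \<le> 1" and "awalk u p v"
  shows "f u - f v \<le> real (length p)"
  using assms(2)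
proof (induction p arbitrary: u)
  case Nil
  then show ?case
    by (simp add: awalk_Nil_iff)
next
  case (Cons e p)
  then have "e \<in> parcs G" "u = fst e" "awalk (snd e) p v"
    by (auto simp: awalk_Cons_iff)
  then have "f u - f (snd e) \<le> 1" "f (snd e) - f v \<le> real (length p)"
    using lipschitz[of u "snd e"] Cons.IH by (auto simp: arc_adj_def)
  then show ?case
    by simp
qed

lemma ex_awalk_if_connected:
  assumes "Digraph_Component.connected (with_proj G)" "u \<in> pverts G" "v \<in> pverts G"
  obtains p where "awalk u p v"
proof -
  have "symmetric (with_proj G)"
    by (rule pair_sym_arcs)
  then have "strongly_connected (with_proj G)"
    using symmetric_connected_imp_strongly_connected assms(1) by blast
  then have "u \<rightarrow>\<^sup>*\<^bsub>with_proj G\<^esub> v"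
    using assms(2,3) by (auto simp: strongly_connected_def)
  then show thesis
    using that by (auto simp: reachable_awalk)
qed

lemma closed_subset_eq_if_connected:
  assumes connected: "Digraph_Component.connected (with_proj G)"
    and S: "S \<subseteq> pverts G" "S \<noteq> {}" and closed: "\<And>u. u \<in> S \<Longrightarrow> graph.nbrs u \<subseteq> S"
  shows "S = pverts G"
proof -
  have "v \<in> S" if "awalk u p v" "u \<in> S" for u p v
    using that
  proof (induction p arbitrary: u)
    case Nil
    then show ?case
      by (simp add: awalk_Nil_iff)
  next
    case (Cons e p)
    then have "snd e \<in> graph.nbrs u" "awalk (snd e) p v"
      by (auto simp: in_nbrs_iff awalk_Cons_iff arc_adj_def simp del: graph.in_nbrs)
    then show ?case
      using Cons.IH closed[OF Cons.prems(2)] by blast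
  qed
  moreover obtain u where u: "u \<in> S" "u \<in> pverts G"
    using S by blast
  moreover have "\<exists>p. awalk u p v" if "v \<in> pverts G" for v
    using ex_awalk_if_connected[OF connected u(2) that] by metis
  ultimately show ?thesis
    using S(1) by blast
qed

subsection \<open>Kantorovich duality\<close>

definition plan_cost :: "('a \<Rightarrow> 'a \<Rightarrow> real) \<Rightarrow> real" where
  "plan_cost \<pi> = (\<Sum>u\<in>pverts G. \<Sum>v\<in>pverts G. \<pi> u v * real_of_ereal (gdist G u v))"

lemma wasserstein1_eq: "wasserstein1 G m1 m2 = (INF \<pi>\<in>{\<pi>. transport_plan G m1 m2 \<pi>}. plan_cost \<pi>)"
  by (simp add: wasserstein1_def plan_cost_def)

lemma wasserstein1_le:
  assumes "transport_plan G m1 m2 \<pi>"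
  shows "wasserstein1 G m1 m2 \<le> plan_cost \<pi>"
  unfolding wasserstein1_eq
proof (rule cINF_lower)
  have "0 \<le> plan_cost \<rho>" if "transport_plan G m1 m2 \<rho>" for \<rho>
  proof -
    have "0 \<le> gdist G u v" for u v
      unfolding gdist_eq by (intro INF_greatest) simp
    then show ?thesis
      using that unfolding plan_cost_def
      by (intro sum_nonneg mult_nonneg_nonneg) (auto simp: transport_plan_def real_of_ereal_pos)
  qed
  then show "bdd_below (plan_cost ` {\<pi>. transport_plan G m1 m2 \<pi>})"
    by (intro bdd_belowI[of _ 0]) auto
qed (use assms in simp)

definition prob_mass :: "('a \<Rightarrow> real) \<Rightarrow> bool" where
  "prob_mass m \<longleftrightarrow> (\<forall>v\<in>pverts G. 0 \<le> m v) \<and> (\<Sum>v\<in>pverts G. m v) = 1"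

lemma wasserstein1_ge:
  assumes "prob_mass m1" "prob_mass m2"
    and le: "\<And>\<pi>. transport_plan G m1 m2 \<pi> \<Longrightarrow> a \<le> plan_cost \<pi>"
  shows "a \<le> wasserstein1 G m1 m2"
  unfolding wasserstein1_eq
proof (rule cINF_greatest)
  have "transport_plan G m1 m2 (\<lambda>u v. m1 u * m2 v)"
    using assms(1,2) by (simp add: transport_plan_def prob_mass_def flip: sum_distrib_left sum_distrib_right)
  then show "{\<pi>. transport_plan G m1 m2 \<pi>} \<noteq> {}"
    by blast
qed (use le in simp)

lemma kantorovich_le_plan_cost:
  fixes f :: "'a \<Rightarrow> real"
  assumes connected: "Digraph_Component.connected (with_proj G)"
    and lipschitz: "\<And>u v. adjacent u v \<Longrightarrow> f u - f v \<le> 1" and plan: "transport_plan G m1 m2 \<pi>"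
  shows "(\<Sum>v\<in>pverts G. f v * m1 v) - (\<Sum>v\<in>pverts G. f v * m2 v) \<le> plan_cost \<pi>"
proof -
  let ?V = "pverts G"
  have "(\<Sum>u\<in>?V. f u * m1 u) = (\<Sum>u\<in>?V. \<Sum>v\<in>?V. \<pi> u v * f u)"
    using plan by (simp add: transport_plan_def mult.commute flip: sum_distrib_left)
  moreover have "(\<Sum>v\<in>?V. f v * m2 v) = (\<Sum>v\<in>?V. \<Sum>u\<in>?V. \<pi> u v * f v)"
    using plan by (simp add: transport_plan_def mult.commute flip: sum_distrib_left)
  moreover have "\<dots> = (\<Sum>u\<in>?V. \<Sum>v\<in>?V. \<pi> u v * f v)"
    by (rule sum.swap)
  ultimately have "(\<Sum>v\<in>?V. f v * m1 v) - (\<Sum>v\<in>?V. f v * m2 v) = (\<Sum>u\<in>?V. \<Sum>v\<in>?V. \<pi> u v * (f u - f v))"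
    by (simp add: sum_subtractf right_diff_distrib)
  also have "\<dots> \<le> plan_cost \<pi>"
    unfolding plan_cost_def
  proof (intro sum_mono mult_left_mono)
    fix u v assume uv: "u \<in> ?V" "v \<in> ?V"
    show "0 \<le> \<pi> u v"
      using plan uv by (simp add: transport_plan_def)
    obtain q where "awalk u q v"
      using ex_awalk_if_connected[OF connected uv] .
    then obtain p where "awalk u p v" "gdist G u v = ereal (real (length p))"
      by (rule gdist_attained)
    then show "f u - f v \<le> real_of_ereal (gdist G u v)"
      using lipschitz_awalk[of f, OF lipschitz] by simp
  qed
  finally show ?thesis .
qed

subsection \<open>Mixing with point masses\<close>

definition mix :: "real \<Rightarrow> 'a \<Rightarrow> ('a \<Rightarrow> real) \<Rightarrow> 'a \<Rightarrow> real" where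
  "mix t x m v = t * m v + (1 - t) * of_bool (v = x)"

definition mix_plan :: "real \<Rightarrow> 'a \<Rightarrow> 'a \<Rightarrow> ('a \<Rightarrow> 'a \<Rightarrow> real) \<Rightarrow> 'a \<Rightarrow> 'a \<Rightarrow> real" where
  "mix_plan t x y \<pi> u v = t * \<pi> u v + (1 - t) * (of_bool (u = x) * of_bool (v = y))"

lemma sum_mult_point_mass:
  fixes f :: "'a \<Rightarrow> real"
  assumes "x \<in> pverts G"
  shows "(\<Sum>v\<in>pverts G. of_bool (v = x) * f v) = f x"
  using assms graph.finite_verts by (simp add: of_bool_def if_distrib[of "\<lambda>a. a * _"] cong: if_cong)

lemma transport_plan_mix:
  assumes plan: "transport_plan G m1 m2 \<pi>" and t: "0 \<le> t" "t \<le> 1" and xy: "x \<in> pverts G" "y \<in> pverts G"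
  shows "transport_plan G (mix t x m1) (mix t y m2) (mix_plan t x y \<pi>)"
  unfolding transport_plan_def
proof (intro conjI ballI)
  fix u assume u: "u \<in> pverts G"
  have "(\<Sum>v\<in>pverts G. mix_plan t x y \<pi> u v)
      = t * (\<Sum>v\<in>pverts G. \<pi> u v) + (1 - t) * (\<Sum>v\<in>pverts G. of_bool (v = y) * of_bool (u = x))"
    by (simp add: mix_plan_def sum.distrib sum_distrib_left mult_ac)
  then show "(\<Sum>v\<in>pverts G. mix_plan t x y \<pi> u v) = mix t x m1 u"
    using plan u by (simp add: sum_mult_point_mass[OF xy(2)] mix_def transport_plan_def)
next
  fix v assume v: "v \<in> pverts G"
  have "(\<Sum>u\<in>pverts G. mix_plan t x y \<pi> u v)
      = t * (\<Sum>u\<in>pverts G. \<pi> u v) + (1 - t) * (\<Sum>u\<in>pverts G. of_bool (u = x) * of_bool (v = y))"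
    by (simp add: mix_plan_def sum.distrib sum_distrib_left mult_ac)
  then show "(\<Sum>u\<in>pverts G. mix_plan t x y \<pi> u v) = mix t y m2 v"
    using plan v by (simp add: sum_mult_point_mass[OF xy(1)] mix_def transport_plan_def)
next
  fix u v assume "u \<in> pverts G" "v \<in> pverts G"
  then show "0 \<le> mix_plan t x y \<pi> u v"
    using plan t by (simp add: mix_plan_def transport_plan_def)
qed

lemma plan_cost_mix:
  assumes "x \<in> pverts G" "y \<in> pverts G"
  shows "plan_cost (mix_plan t x y \<pi>) = t * plan_cost \<pi> + (1 - t) * real_of_ereal (gdist G x y)"
proof -
  let ?V = "pverts G" and ?g = "\<lambda>u v. real_of_ereal (gdist G u v)"
  have "plan_cost (mix_plan t x y \<pi>) = (\<Sum>u\<in>?V. \<Sum>v\<in>?V. t * (\<pi> u v * ?g u v)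
      + (1 - t) * (of_bool (u = x) * (of_bool (v = y) * ?g u v)))"
    unfolding plan_cost_def mix_plan_def by (intro sum.cong refl) (simp add: algebra_simps)
  also have "\<dots> = t * plan_cost \<pi> + (1 - t) * ?g x y"
    using assms by (simp add: plan_cost_def sum.distrib sum_mult_point_mass flip: sum_distrib_left)
  finally show ?thesis .
qed

lemma wasserstein1_mix_le:
  assumes "prob_mass m1" "prob_mass m2" and t: "0 < t" "t \<le> 1" and xy: "x \<in> pverts G" "y \<in> pverts G"
  shows "wasserstein1 G (mix t x m1) (mix t y m2)
    \<le> t * wasserstein1 G m1 m2 + (1 - t) * real_of_ereal (gdist G x y)"
proof -
  let ?g = "real_of_ereal (gdist G x y)"
  have "(wasserstein1 G (mix t x m1) (mix t y m2) - (1 - t) * ?g) / t \<le> wasserstein1 G m1 m2"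
  proof (rule wasserstein1_ge[OF assms(1,2)])
    fix \<pi> assume "transport_plan G m1 m2 \<pi>"
    then have "transport_plan G (mix t x m1) (mix t y m2) (mix_plan t x y \<pi>)"
      using t xy by (intro transport_plan_mix) simp_all
    then have "wasserstein1 G (mix t x m1) (mix t y m2) \<le> t * plan_cost \<pi> + (1 - t) * ?g"
      using wasserstein1_le plan_cost_mix[OF xy] by metis
    then show "(wasserstein1 G (mix t x m1) (mix t y m2) - (1 - t) * ?g) / t \<le> plan_cost \<pi>"
      using t(1) by (simp add: field_simps)
  qed
  then show ?thesis
    using t(1) by (simp add: field_simps)
qed

subsection \<open>Lazy random walks\<close>

lemma sum_mult_lazy_walk_measure:
  fixes f :: "'a \<Rightarrow> real"
  assumes x: "x \<in> pverts G"
  shows "(\<Sum>v\<in>pverts G. f v * lazy_walk_measure G p x v)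
    = p * f x + (1 - p) / real (card (graph.nbrs x)) * (\<Sum>v\<in>graph.nbrs x. f v)"
proof -
  let ?V = "pverts G"
  have "(\<Sum>v\<in>?V. f v * lazy_walk_measure G p x v)
      = f x * lazy_walk_measure G p x x + (\<Sum>v\<in>?V - {x}. f v * lazy_walk_measure G p x v)"
    using x graph.finite_verts by (simp add: sum.remove)
  also have "(\<Sum>v\<in>?V - {x}. f v * lazy_walk_measure G p x v)
      = (\<Sum>v\<in>graph.nbrs x. f v * ((1 - p) / real (card (graph.nbrs x))))"
  proof (rule sum.mono_neutral_cong_right)
    show "graph.nbrs x \<subseteq> ?V - {x}"
      using graph.adj_irrefl by auto
  qed (use graph.finite_verts graph.adj_irrefl in \<open>auto simp: lazy_walk_measure_def out_degree_eq arc_adj_def\<close>)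
  also have "\<dots> = (1 - p) / real (card (graph.nbrs x)) * (\<Sum>v\<in>graph.nbrs x. f v)"
    unfolding mult.commute[of "(1 - p) / _"] sum_distrib_right ..
  finally show ?thesis
    by (simp add: lazy_walk_measure_def mult.commute)
qed

lemma prob_mass_lazy_walk_measure:
  assumes "adjacent x y" "0 \<le> p" "p \<le> 1"
  shows "prob_mass (lazy_walk_measure G p x)"
proof -
  have "y \<in> graph.nbrs x"
    using assms(1) by (simp only: in_nbrs_iff)
  then have "card (graph.nbrs x) \<noteq> 0"
    by (metis card_0_eq empty_iff graph.finite_nbrs)
  then have "(\<Sum>v\<in>pverts G. lazy_walk_measure G p x v) = 1"
    using sum_mult_lazy_walk_measure[OF adjacent_verts(1)[OF assms(1)], of "\<lambda>_. 1" p] by simp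
  then show ?thesis
    using assms(2,3) by (simp add: prob_mass_def lazy_walk_measure_def)
qed

lemma lazy_walk_measure_mix:
  assumes "t * (1 - p) = 1 - q"
  shows "lazy_walk_measure G q x = mix t x (lazy_walk_measure G p x)"
proof -
  have "t * p + (1 - t) = q"
    using assms by (simp add: algebra_simps)
  then show ?thesis
    by (auto simp: fun_eq_iff lazy_walk_measure_def mix_def simp flip: assms)
qed

lemma lazy_curvature_eq:
  assumes "adjacent x y"
  shows "lazy_curvature G p x y = 1 - wasserstein1 G (lazy_walk_measure G p x) (lazy_walk_measure G p y)"
  by (simp add: lazy_curvature_def gdist_adjacent[OF assms])

lemma lazy_curvature_mono:
  assumes xy: "adjacent x y" and p: "0 \<le> p" "p \<le> q" "q < 1"
  shows "lazy_curvature G p x y / (1 - p) \<le> lazy_curvature G q x y / (1 - q)"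
proof -
  define t where "t = (1 - q) / (1 - p)"
  have t: "0 < t" "t \<le> 1" "t * (1 - p) = 1 - q"
    using p by (simp_all add: t_def)
  have V: "x \<in> pverts G" "y \<in> pverts G"
    using adjacent_verts[OF xy] .
  have "prob_mass (lazy_walk_measure G p x)" "prob_mass (lazy_walk_measure G p y)"
    using xy p prob_mass_lazy_walk_measure[of _ _ p] graph.adj_sym by force+
  from wasserstein1_mix_le[OF this t(1,2) V]
  have "t * lazy_curvature G p x y \<le> lazy_curvature G q x y"
    unfolding lazy_walk_measure_mix[OF t(3), symmetric]
    by (simp add: lazy_curvature_eq[OF xy] gdist_adjacent[OF xy] algebra_simps)
  then have "t * lazy_curvature G p x y / (1 - q) \<le> lazy_curvature G q x y / (1 - q)"
    using p by (intro divide_right_mono) auto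
  then show ?thesis
    using p by (simp add: t_def)
qed

lemma lazy_curvature_le:
  fixes f :: "'a \<Rightarrow> real"
  assumes connected: "Digraph_Component.connected (with_proj G)" and xy: "adjacent x y"
    and degree: "card (graph.nbrs x) = d" "card (graph.nbrs y) = d"
    and lipschitz: "\<And>u v. adjacent u v \<Longrightarrow> f u - f v \<le> 1" and f: "f x - f y = 1"
    and p: "0 \<le> p" "p < 1"
  shows "lazy_curvature G p x y / (1 - p)
    \<le> 1 - ((\<Sum>v\<in>graph.nbrs x. f v) - (\<Sum>v\<in>graph.nbrs y. f v)) / real d"
proof -
  define \<Delta> where "\<Delta> = ((\<Sum>v\<in>graph.nbrs x. f v) - (\<Sum>v\<in>graph.nbrs y. f v)) / real d"
  let ?m = "lazy_walk_measure G p"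
  have V: "x \<in> pverts G" "y \<in> pverts G"
    using adjacent_verts[OF xy] .
  have "prob_mass (?m x)" "prob_mass (?m y)"
    using xy p prob_mass_lazy_walk_measure[of _ _ p] graph.adj_sym by force+
  then have "(\<Sum>v\<in>pverts G. f v * ?m x v) - (\<Sum>v\<in>pverts G. f v * ?m y v) \<le> wasserstein1 G (?m x) (?m y)"
    by (rule wasserstein1_ge) (rule kantorovich_le_plan_cost[OF connected lipschitz])
  then have "p * (f x - f y) + (1 - p) * \<Delta> \<le> wasserstein1 G (?m x) (?m y)"
    unfolding sum_mult_lazy_walk_measure[OF V(1)] sum_mult_lazy_walk_measure[OF V(2)] degree
    by (simp add: \<Delta>_def algebra_simps diff_divide_distrib)
  then have "lazy_curvature G p x y \<le> (1 - \<Delta>) * (1 - p)"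
    unfolding lazy_curvature_eq[OF xy] f by (simp add: algebra_simps)
  then show ?thesis
    using p by (simp add: \<Delta>_def divide_le_eq)
qed

end

subsection \<open>The limit\<close>

lemma mono_bounded_tendsto_at_left:
  fixes F :: "real \<Rightarrow> real"
  assumes mono: "\<And>p q. 0 \<le> p \<Longrightarrow> p \<le> q \<Longrightarrow> q < 1 \<Longrightarrow> F p \<le> F q"
    and bound: "\<And>p. 0 \<le> p \<Longrightarrow> p < 1 \<Longrightarrow> F p \<le> B"
  obtains l where "l \<le> B" "(F \<longlongrightarrow> l) (at_left 1)"
proof -
  define l where "l = (SUP p\<in>{0..<1}. F p)"
  have bdd: "bdd_above (F ` {0..<1})"
    using bound by (intro bdd_aboveI[of _ B]) auto
  have upper: "F p \<le> l" if "0 \<le> p" "p < 1" for p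
    unfolding l_def by (rule cSUP_upper[OF _ bdd]) (use that in auto)
  have "l \<le> B"
    unfolding l_def by (rule cSUP_least) (use bound in auto)
  moreover have "(F \<longlongrightarrow> l) (at_left 1)"
  proof (rule order_tendstoI)
    fix a assume "a < l"
    then obtain p where p: "p \<in> {0..<1}" "a < F p"
      unfolding l_def using less_cSUP_iff[OF _ bdd] by auto
    then have "a < F q" if "p < q" "q < 1" for q
      using mono[of p q] that by simp
    then show "\<forall>\<^sub>F q in at_left 1. a < F q"
      unfolding eventually_at_left_field using p by (intro exI[of _ p]) auto
  next
    fix a assume "l < a"
    then have "F q < a" if "0 < q" "q < 1" for q
      using upper[of q] that by simp
    then show "\<forall>\<^sub>F q in at_left 1. F q < a"
      unfolding eventually_at_left_field by (intro exI[of _ 0]) auto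
  qed
  ultimately show thesis
    by (rule that)
qed

theorem (in pair_graph) LLY_curvature_le:
  fixes f :: "'a \<Rightarrow> real"
  assumes "Digraph_Component.connected (with_proj G)" "adjacent x y"
    and "card (graph.nbrs x) = d" "card (graph.nbrs y) = d"
    and "\<And>u v. adjacent u v \<Longrightarrow> f u - f v \<le> 1" and "f x - f y = 1"
  shows "LLY_curvature G x y \<le> 1 - ((\<Sum>v\<in>graph.nbrs x. f v) - (\<Sum>v\<in>graph.nbrs y. f v)) / real d"
    (is "_ \<le> ?B")
proof -
  let ?F = "\<lambda>p. lazy_curvature G p x y / (1 - p)"
  obtain l where l: "l \<le> ?B" "(?F \<longlongrightarrow> l) (at_left 1)"
    using mono_bounded_tendsto_at_left[of ?F ?B, OF lazy_curvature_mono[OF assms(2)]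
        lazy_curvature_le[OF assms]] .
  have "Lim (at_left 1) ?F = l"
    by (rule tendsto_Lim[OF _ l(2)]) simp
  then show ?thesis
    using l(1) by (simp add: LLY_curvature_def)
qed

section \<open>The classification\<close>

subsection \<open>Isomorphisms of digraphs\<close>

lemma pair_wf_digraphI:
  assumes "\<And>u v. arc_adj G u v \<Longrightarrow> u \<in> pverts G \<and> v \<in> pverts G"
  shows "pair_wf_digraph G"
  by unfold_locales (use assms in \<open>auto simp: arc_adj_def\<close>)

lemma digraph_iso_if_graph_iso:
  assumes G: "pair_wf_digraph G" and H: "pair_wf_digraph H"
    and f: "graph_iso f (pverts G) (arc_adj G) (pverts H) (arc_adj H)"
  shows "digraph_iso (with_proj G) (with_proj H)"
proof -
  interpret G: pair_wf_digraph G by (rule G)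
  interpret H: pair_wf_digraph H by (rule H)
  have inj: "inj_on f (pverts G)" and verts: "f ` pverts G = pverts H"
    and arcs: "\<And>u v. u \<in> pverts G \<Longrightarrow> v \<in> pverts G \<Longrightarrow> (u, v) \<in> parcs G \<longleftrightarrow> (f u, f v) \<in> parcs H"
    using f by (auto simp: graph_iso_def bij_betw_def arc_adj_def)
  have parcs: "map_prod f f ` parcs G = parcs H"
  proof
    have "(f u, f v) \<in> parcs H" if uv: "(u, v) \<in> parcs G" for u v
      using arcs[OF G.in_arcsD1[OF uv] G.in_arcsD2[OF uv]] uv by (simp only:)
    then show "map_prod f f ` parcs G \<subseteq> parcs H"
      by auto
    show "parcs H \<subseteq> map_prod f f ` parcs G"
    proof (rule subrelI)
      fix a b assume ab: "(a, b) \<in> parcs H"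
      then have "a \<in> f ` pverts G" "b \<in> f ` pverts G"
        unfolding verts by (rule H.in_arcsD1, rule H.in_arcsD2)
      then obtain u v where "a = f u" "b = f v" "u \<in> pverts G" "v \<in> pverts G"
        by blast
      then show "(a, b) \<in> map_prod f f ` parcs G"
        using ab arcs by force
    qed
  qed
  have "parcs G \<subseteq> pverts G \<times> pverts G"
    using G.in_arcsD1 G.in_arcsD2 by auto
  then have "inj_on (map_prod f f) (parcs G)"
    by (rule inj_on_subset[OF map_prod_inj_on[OF inj inj]])
  then have "pre_digraph.digraph_isomorphism (with_proj G)
      \<lparr>iso_verts = f, iso_arcs = map_prod f f, iso_head = snd, iso_tail = fst\<rparr>"
    using inj G.wf_digraph_axioms by (simp add: pre_digraph.digraph_isomorphism_def)
  moreover have "with_proj H = app_iso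
      \<lparr>iso_verts = f, iso_arcs = map_prod f f, iso_head = snd, iso_tail = fst\<rparr> (with_proj G)"
    using verts parcs by (simp add: app_iso_def with_proj_def)
  ultimately show ?thesis
    unfolding digraph_iso_def by blast
qed

lemma pair_wf_digraph_line_graph: "pair_wf_digraph (line_graph K)"
  by (rule pair_wf_digraphI) (auto simp: arc_adj_def line_graph_def Let_def)

lemma pverts_line_graph:
  assumes "pair_wf_digraph K"
  shows "pverts (line_graph K) = edge_set (pverts K) (arc_adj K)"
proof -
  interpret pair_wf_digraph K by (rule assms)
  have "(u, v) \<in> parcs K \<longleftrightarrow> u \<in> pverts K \<and> v \<in> pverts K \<and> arc_adj K u v" for u v
    using in_arcsD1 in_arcsD2 by (auto simp: arc_adj_def)
  then show ?thesis
    by (simp add: line_graph_def Let_def edge_set_def)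
qed

lemma arc_adj_line_graph:
  "arc_adj (line_graph K) e f \<longleftrightarrow> e \<in> pverts (line_graph K) \<and> f \<in> pverts (line_graph K) \<and> meet e f"
  by (simp add: arc_adj_def line_graph_def Let_def meet_def)

lemma graph_iso_line_graph:
  assumes "pair_wf_digraph K" "graph_iso f V E (edge_set (pverts K) (arc_adj K)) meet"
  shows "graph_iso f V E (pverts (line_graph K)) (arc_adj (line_graph K))"
  using assms bij_betw_apply[of f V]
  by (auto simp: graph_iso_def arc_adj_line_graph pverts_line_graph)

subsection \<open>Concrete graphs\<close>

lemma arc_adj_mk_symmetric:
  "arc_adj (mk_symmetric (with_proj G)) u v \<longleftrightarrow> arc_adj G u v \<or> arc_adj G v u"
proof -
  have "parcs (mk_symmetric (with_proj G)) = parcs G \<union> (parcs G)\<inverse>"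
    by (force simp: parcs_mk_symmetric)
  then show ?thesis
    by (simp add: arc_adj_def)
qed

lemma arc_adj_mk_symmetric_UN:
  "arc_adj (mk_symmetric (with_proj \<lparr>pverts = W, parcs = (\<Union>i\<in>I. A i)\<rparr>)) u v \<longleftrightarrow>
    (\<exists>i\<in>I. \<exists>e\<in>A i. e = (u, v) \<or> e = (v, u))"
  unfolding arc_adj_mk_symmetric unfolding arc_adj_def by auto

lemma of_nat_mod_5: "(of_nat (n mod 5) :: 5) = of_nat n"
proof -
  have "(of_nat n :: 5) = of_nat (5 * (n div 5) + n mod 5)"
    by simp
  also have "\<dots> = of_nat 5 * of_nat (n div 5) + of_nat (n mod 5)"
    by (simp only: of_nat_add of_nat_mult)
  finally show ?thesis
    by simp
qed

lemma of_nat_5_eq_iff: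
  assumes "i < 5"
  shows "(of_nat i :: 5) = of_nat n \<longleftrightarrow> i = n mod 5"
proof -
  have less_5: "k = 0 \<or> k = 1 \<or> k = 2 \<or> k = 3 \<or> k = 4" if "k < 5" for k :: nat
    using that by auto
  have "(of_nat i :: 5) = of_nat j \<longleftrightarrow> i = j" if "j < 5" for j
    using less_5[OF assms] less_5[OF that] by (elim disjE) simp_all
  from this[of "n mod 5"] show ?thesis
    by (simp add: of_nat_mod_5)
qed

lemma of_nat_5_eq_simps:
  fixes i j h l :: nat
  assumes "i < 5" "j < 5"
  shows "(of_nat i :: 5) = of_nat j \<longleftrightarrow> i = j"
    "(of_nat i :: 5) = of_nat j + 1 \<longleftrightarrow> i = (j + 1) mod 5"
    "(of_nat i :: 5) = of_nat j + 2 \<longleftrightarrow> i = (j + 2) mod 5"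
    "(of_nat i :: 5) = of_nat h * of_nat l + of_nat j \<longleftrightarrow> i = (h * l + j) mod 5"
proof -
  note eq = of_nat_5_eq_iff[OF assms(1)]
  show "(of_nat i :: 5) = of_nat j \<longleftrightarrow> i = j"
    using eq[of j] assms(2) by simp
  show "(of_nat i :: 5) = of_nat j + 1 \<longleftrightarrow> i = (j + 1) mod 5"
    using eq[of "j + 1"] by (simp only: of_nat_add of_nat_1)
  show "(of_nat i :: 5) = of_nat j + 2 \<longleftrightarrow> i = (j + 2) mod 5"
    using eq[of "j + 2"] by (simp only: of_nat_add of_nat_numeral)
  show "(of_nat i :: 5) = of_nat h * of_nat l + of_nat j \<longleftrightarrow> i = (h * l + j) mod 5"
    using eq[of "h * l + j"] by (simp only: of_nat_add of_nat_mult)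
qed

lemma bij_betw_of_nat_5: "bij_betw (of_nat :: nat \<Rightarrow> 5) {..<5} UNIV"
proof (rule bij_betw_imageI)
  show "inj_on (of_nat :: nat \<Rightarrow> 5) {..<5}"
    by (rule inj_onI) (simp add: of_nat_5_eq_simps)
  then have "card ((of_nat :: nat \<Rightarrow> 5) ` {..<5}) = CARD(5)"
    by (simp add: card_image)
  then show "(of_nat :: nat \<Rightarrow> 5) ` {..<5} = UNIV"
    by (intro card_subset_eq) simp_all
qed

lemma obtain_of_nat_5:
  fixes k :: 5
  obtains i where "i < 5" "k = of_nat i"
proof -
  have "k \<in> of_nat ` {..<5}"
    unfolding bij_betw_imp_surj_on[OF bij_betw_of_nat_5] by (rule UNIV_I)
  then show thesis
    using that by auto
qed

lemma arc_adj_pentagon: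
  "arc_adj pentagon u v \<longleftrightarrow> u < 5 \<and> v < 5 \<and> (v = (u + 1) mod 5 \<or> u = (v + 1) mod 5)"
  unfolding pentagon_def arc_adj_mk_symmetric by (auto simp: arc_adj_def)

lemma pverts_pentagon: "pverts pentagon = {..<5}"
  by (simp add: pentagon_def)

lemma pair_wf_digraph_pentagon: "pair_wf_digraph pentagon"
  by (rule pair_wf_digraphI) (simp add: arc_adj_pentagon pverts_pentagon)

lemma pentagon_graph_iso: "graph_iso (of_nat :: nat \<Rightarrow> 5) (pverts pentagon) (arc_adj pentagon) UNIV cycle_adj"
  using bij_betw_of_nat_5
  by (simp add: graph_iso_def pverts_pentagon arc_adj_pentagon cycle_adj_def of_nat_5_eq_simps)

definition icosahedron_label :: "nat \<times> nat \<Rightarrow> bool \<times> 5 option" where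
  "icosahedron_label = (\<lambda>(r, i). (r \<ge> 2, if r = 1 \<or> r = 2 then Some (of_nat i) else None))"

lemma arc_adj_icosahedron:
  "arc_adj icosahedron (r, i) (s, j) \<longleftrightarrow> i < 5 \<and> j < 5 \<and>
    (r = 0 \<and> i = 0 \<and> s = 1 \<or> r = 1 \<and> s = 0 \<and> j = 0 \<or> r = 2 \<and> s = 3 \<and> j = 0 \<or> r = 3 \<and> i = 0 \<and> s = 2 \<or>
     (r = 1 \<and> s = 1 \<or> r = 2 \<and> s = 2) \<and> (j = (i + 1) mod 5 \<or> i = (j + 1) mod 5) \<or>
     r = 1 \<and> s = 2 \<and> (j = i \<or> j = (i + 1) mod 5) \<or> r = 2 \<and> s = 1 \<and> (i = j \<or> i = (j + 1) mod 5))"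
    (is "?L \<longleftrightarrow> ?R")
proof
  show "?L \<Longrightarrow> ?R"
    unfolding icosahedron_def arc_adj_mk_symmetric_UN by (elim bexE) auto
  show "?R \<Longrightarrow> ?L"
    unfolding icosahedron_def arc_adj_mk_symmetric_UN by (elim conjE disjE) (simp_all add: bex_disj_distrib)
qed

lemma pverts_icosahedron: "pverts icosahedron = {(0, 0), (3, 0)} \<union> {1, 2} \<times> {..<5}"
  by (simp add: icosahedron_def)

lemma pair_wf_digraph_icosahedron: "pair_wf_digraph icosahedron"
  by (rule pair_wf_digraphI) (auto simp: arc_adj_icosahedron pverts_icosahedron)

lemma icosahedron_graph_iso:
  "graph_iso icosahedron_label (pverts icosahedron) (arc_adj icosahedron) UNIV icosahedron_adj"
proof (rule graph_isoI)
  have "inj_on icosahedron_label (pverts icosahedron)"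
    by (rule inj_onI) (auto simp: pverts_icosahedron icosahedron_label_def of_nat_5_eq_simps)
  moreover have "w \<in> icosahedron_label ` pverts icosahedron" for w
  proof (cases w)
    case (Pair x k)
    show ?thesis
    proof (cases k)
      case None
      then show ?thesis
        using Pair by (intro image_eqI[of _ _ "(if x then 3 else 0, 0)"])
          (auto simp: icosahedron_label_def pverts_icosahedron)
    next
      case (Some j)
      obtain i where "i < 5" "j = of_nat i"
        by (rule obtain_of_nat_5)
      then show ?thesis
        using Pair Some by (intro image_eqI[of _ _ "(if x then 2 else 1, i)"])
          (auto simp: icosahedron_label_def pverts_icosahedron)
    qed
  qed
  ultimately show "bij_betw icosahedron_label (pverts icosahedron) UNIV"
    by (auto simp: bij_betw_def)
  fix u v assume "u \<in> pverts icosahedron" "v \<in> pverts icosahedron"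
  then show "arc_adj icosahedron u v \<longleftrightarrow> icosahedron_adj (icosahedron_label u) (icosahedron_label v)"
    by (auto simp: pverts_icosahedron arc_adj_icosahedron icosahedron_label_def cycle_adj_def of_nat_5_eq_simps)
qed

definition petersen_label :: "bool \<times> 5 \<Rightarrow> 5 set" where
  "petersen_label = (\<lambda>(x, i). if x then {2 * i + 2, 2 * i + 4} else {2 * i, 2 * i + 1})"

lemma petersen_label_iso:
  "graph_iso petersen_label UNIV petersen_adj {S. card S = 2} (\<lambda>S T. S \<inter> T = {})"
proof (rule graph_isoI)
  have "petersen_adj (x, i) (y, j) \<longleftrightarrow> petersen_label (x, i) \<inter> petersen_label (y, j) = {}" for x y i j
    by (cases i j rule: difference_cases_5; cases x; cases y)
      (auto simp: petersen_label_def cycle_adj_def algebra_simps)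
  then show "petersen_adj u v \<longleftrightarrow> petersen_label u \<inter> petersen_label v = {}" for u v
    by (cases u; cases v) simp
  have "(x, i) = (y, j)" if "petersen_label (x, i) = petersen_label (y, j)" for x y i j
    using that by (cases i j rule: difference_cases_5; cases x; cases y)
      (auto simp: petersen_label_def doubleton_eq_iff algebra_simps)
  then have "inj petersen_label"
    by (intro injI) auto
  moreover have "range petersen_label = {S. card S = 2}"
  proof (rule card_subset_eq)
    show "range petersen_label \<subseteq> {S. card S = 2}"
      by (auto simp: petersen_label_def)
    have "card {S :: 5 set. card S = 2} = CARD(5) choose 2"
      using n_subsets[of "UNIV :: 5 set" 2] by simp
    then show "card (range petersen_label) = card {S :: 5 set. card S = 2}"
      using \<open>inj petersen_label\<close> by (simp add: card_image choose_two)
  qed simp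
  ultimately show "bij_betw petersen_label UNIV {S. card S = 2}"
    by (simp add: bij_betw_def)
qed

lemma pair_wf_digraph_petersen: "pair_wf_digraph petersen"
  by (rule pair_wf_digraphI) (auto simp: arc_adj_def petersen_def)

lemma petersen_graph_iso:
  "graph_iso ((`) of_nat) (pverts petersen) (arc_adj petersen) {S :: 5 set. card S = 2} (\<lambda>S T. S \<inter> T = {})"
proof (rule graph_isoI)
  have inj: "inj_on (of_nat :: nat \<Rightarrow> 5) {..<5}" and image: "of_nat ` {..<5} = (UNIV :: 5 set)"
    using bij_betw_of_nat_5 by (simp_all add: bij_betw_def)
  have verts: "pverts petersen = {S \<in> Pow {..<5}. card S = 2}"
    by (simp add: petersen_def)
  have card: "card ((of_nat :: nat \<Rightarrow> 5) ` S) = card S" if "S \<subseteq> {..<5}" for S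
    by (rule card_image[OF inj_on_subset[OF inj that]])
  have "inj_on ((`) (of_nat :: nat \<Rightarrow> 5)) (pverts petersen)"
    unfolding verts by (rule inj_on_subset[OF inj_on_image_Pow[OF inj]]) blast
  moreover have "(`) of_nat ` pverts petersen = {S :: 5 set. card S = 2}"
  proof
    show "(`) of_nat ` pverts petersen \<subseteq> {S :: 5 set. card S = 2}"
      using card by (auto simp: verts)
    show "{S :: 5 set. card S = 2} \<subseteq> (`) of_nat ` pverts petersen"
    proof
      fix S :: "5 set" assume S: "S \<in> {S. card S = 2}"
      have "S \<subseteq> of_nat ` {..<5}"
        by (simp add: image)
      then obtain T where T: "T \<subseteq> {..<5}" "S = of_nat ` T"
        by (rule subset_imageE)
      then show "S \<in> (`) of_nat ` pverts petersen"
        using S card[OF T(1)] by (simp add: verts)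
    qed
  qed
  ultimately show "bij_betw ((`) of_nat) (pverts petersen) {S :: 5 set. card S = 2}"
    by (simp add: bij_betw_def)
  fix S T assume ST: "S \<in> pverts petersen" "T \<in> pverts petersen"
  then have "(of_nat :: nat \<Rightarrow> 5) ` (S \<inter> T) = of_nat ` S \<inter> of_nat ` T"
    by (intro inj_on_image_Int[OF inj]) (auto simp: verts)
  then have "S \<inter> T = {} \<longleftrightarrow> (of_nat :: nat \<Rightarrow> 5) ` S \<inter> of_nat ` T = {}"
    by (metis image_is_empty)
  then show "arc_adj petersen S T \<longleftrightarrow> (of_nat :: nat \<Rightarrow> 5) ` S \<inter> of_nat ` T = {}"
    using ST by (simp add: arc_adj_def petersen_def)
qed

definition hoffman_singleton_label :: "nat \<times> nat \<times> nat \<Rightarrow> bool \<times> 5 \<times> 5" where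
  "hoffman_singleton_label = (\<lambda>(t, h, j). (t = 1, of_nat h, of_nat j))"

lemma arc_adj_hoffman_singleton:
  "arc_adj hoffman_singleton (t, h, j) (t', i, l) \<longleftrightarrow> h < 5 \<and> j < 5 \<and> i < 5 \<and> l < 5 \<and>
    (t = 0 \<and> t' = 0 \<and> h = i \<and> (l = (j + 1) mod 5 \<or> j = (l + 1) mod 5) \<or>
     t = 1 \<and> t' = 1 \<and> h = i \<and> (l = (j + 2) mod 5 \<or> j = (l + 2) mod 5) \<or>
     t = 0 \<and> t' = 1 \<and> l = (h * i + j) mod 5 \<or> t = 1 \<and> t' = 0 \<and> j = (h * i + l) mod 5)"
  unfolding hoffman_singleton_def arc_adj_mk_symmetric by (auto simp: arc_adj_def mult.commute)

lemma pverts_hoffman_singleton: "pverts hoffman_singleton = {0, 1} \<times> {..<5} \<times> {..<5}"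
  by (simp add: hoffman_singleton_def)

lemma pair_wf_digraph_hoffman_singleton: "pair_wf_digraph hoffman_singleton"
  by (rule pair_wf_digraphI) (auto simp: arc_adj_hoffman_singleton pverts_hoffman_singleton)

lemma hoffman_singleton_graph_iso:
  "graph_iso hoffman_singleton_label (pverts hoffman_singleton) (arc_adj hoffman_singleton) UNIV robertson_adj"
proof (rule graph_isoI)
  have "inj_on hoffman_singleton_label (pverts hoffman_singleton)"
    by (rule inj_onI) (auto simp: pverts_hoffman_singleton hoffman_singleton_label_def of_nat_5_eq_simps)
  moreover have "w \<in> hoffman_singleton_label ` pverts hoffman_singleton" for w
  proof (cases w)
    case (fields x a b)
    obtain h j where "h < 5" "a = of_nat h" "j < 5" "b = of_nat j"
      using obtain_of_nat_5[of a] obtain_of_nat_5[of b] by metis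
    then show ?thesis
      using fields by (intro image_eqI[of _ _ "(if x then 1 else 0, h, j)"])
        (auto simp: hoffman_singleton_label_def pverts_hoffman_singleton)
  qed
  ultimately show "bij_betw hoffman_singleton_label (pverts hoffman_singleton) UNIV"
    by (auto simp: bij_betw_def)
  fix u v assume "u \<in> pverts hoffman_singleton" "v \<in> pverts hoffman_singleton"
  then show "arc_adj hoffman_singleton u v
      \<longleftrightarrow> robertson_adj (hoffman_singleton_label u) (hoffman_singleton_label v)"
    by (auto simp: pverts_hoffman_singleton arc_adj_hoffman_singleton hoffman_singleton_label_def
        robertson_adj_iff cycle_adj_def of_nat_5_eq_simps mult.commute)
qed

subsection \<open>Moore graphs as strongly regular graphs\<close>

lemma nbrs_graph_iso:
  assumes iso: "graph_iso g W F V E" and "finite_graph W F" "finite_graph V E" and u: "u \<in> W"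
  shows "g ` finite_graph.nbrs W F u = finite_graph.nbrs V E (g u)"
proof -
  interpret W: finite_graph W F by (rule assms(2))
  interpret V: finite_graph V E by (rule assms(3))
  have "g ` W = V" "\<And>v. v \<in> W \<Longrightarrow> F u v \<longleftrightarrow> E (g u) (g v)"
    using iso u by (auto simp: graph_iso_def bij_betw_def)
  then show ?thesis
    by (auto simp: W.nbrs_def V.nbrs_def)
qed

lemma nonadj_graph_iso:
  assumes iso: "graph_iso g W F V E" and "finite_graph W F" "finite_graph V E" and uv: "u \<in> W" "v \<in> W"
  shows "finite_graph.nonadj V E (g u) (g v) \<longleftrightarrow> finite_graph.nonadj W F u v"
proof -
  interpret W: finite_graph W F by (rule assms(2))
  interpret V: finite_graph V E by (rule assms(3))
  have "inj_on g W" "g ` W = V" "F u v \<longleftrightarrow> E (g u) (g v)"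
    using iso uv by (auto simp: graph_iso_def bij_betw_def)
  then show ?thesis
    using uv inj_on_eq_iff[of g W u v] by (auto simp: V.nonadj_def W.nonadj_def)
qed

lemma moore_graph_iso:
  assumes iso: "graph_iso g W F V E" and W: "finite_graph W F" and V: "moore_graph V E k"
  shows "moore_graph W F k"
proof -
  interpret V: moore_graph V E k by (rule V)
  interpret W: finite_graph W F by (rule W)
  have g: "inj_on g W" "g ` W = V"
    using iso by (auto simp: graph_iso_def bij_betw_def)
  note nbrs = nbrs_graph_iso[OF iso W V.finite_graph_axioms]
    and nonadj = nonadj_graph_iso[OF iso W V.finite_graph_axioms]
  have card: "card (g ` S) = card S" if "S \<subseteq> W" for S
    using that by (rule card_image[OF inj_on_subset[OF g(1)]])
  have common: "g ` (W.nbrs u \<inter> W.nbrs v) = V.nbrs (g u) \<inter> V.nbrs (g v)" if "u \<in> W" "v \<in> W" for u v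
    using inj_on_image_Int[OF g(1) W.nbrs_subset W.nbrs_subset] nbrs that by simp
  have card_common: "card (W.nbrs u \<inter> W.nbrs v) = 1" if uv: "W.nonadj u v" for u v
  proof -
    have "u \<in> W" "v \<in> W"
      using uv by (auto simp: W.nonadj_def)
    then have "card (g ` (W.nbrs u \<inter> W.nbrs v)) = 1"
      using V.card_common_nbrs_nonadj nonadj uv common by metis
    then show ?thesis
      by (simp add: card[OF le_infI1[OF W.nbrs_subset]])
  qed
  show ?thesis
  proof unfold_locales
    show "card (W.nbrs u) = k" if "u \<in> W" for u
      using card[OF W.nbrs_subset, of u] nbrs[OF that] V.regular[of "g u"] g(2) that by auto
    show "W.nbrs u \<inter> W.nbrs v = {}" if "u \<in> W" "v \<in> W.nbrs u" for u v
    proof -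
      have "v \<in> W" "g v \<in> V.nbrs (g u)"
        using that nbrs[OF that(1)] by auto
      then show ?thesis
        using common[OF that(1)] V.triangle_free[of "g u" "g v"] g(2) that(1) by (metis image_eqI image_is_empty)
    qed
    obtain a b where "V.nonadj a b"
      using V.not_complete by blast
    then show "\<exists>u v. W.nonadj u v"
      using nonadj g(2) by (metis V.nonadj_def imageE)
    fix u v assume uv: "W.nonadj u v"
    show "card (W.nbrs u \<inter> W.nbrs v) = 1" "W.nbrs u \<inter> W.nbrs v \<noteq> {}"
      using card_common[OF uv] by auto
    fix x y assume "x \<in> W.nbrs u \<inter> W.nbrs v" "y \<in> W.nbrs u \<inter> W.nbrs v" "x \<noteq> y"
    then show "F x y"
      using card_common[OF uv] by (metis card_1_singletonE singletonD)
  qed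
qed

lemma (in pair_graph) ex_short_awalk:
  assumes "diam_two_clique_mu_graphs (pverts G) (arc_adj G) c r" and uv: "u \<in> pverts G" "v \<in> pverts G"
  obtains p where "awalk u p v" "length p \<le> 2"
proof -
  interpret diam_two_clique_mu_graphs "pverts G" "arc_adj G" c r by (rule assms(1))
  consider "u = v" | "adjacent u v" | "graph.nonadj u v"
    using uv by (auto simp: graph.nonadj_def)
  then show thesis
  proof cases
    case 1
    then show thesis
      using that[of "[]"] uv by (simp add: awalk_Nil_iff)
  next
    case 2
    then show thesis
      using that[of "[(u, v)]"] awalk_length_1_iff[of u "[(u, v)]" v] by simp
  next
    case 3
    then obtain w where "adjacent u w" "adjacent v w"
      using common_nbrs_nonempty[OF 3] by auto
    then show thesis
      using that[of "[(u, w), (w, v)]"] awalk_length_2_iff[of u "[(u, w), (w, v)]" v] graph.adj_sym by simp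
  qed
qed

lemma (in pair_graph) connected_if_diam_two:
  assumes diam_two: "diam_two_clique_mu_graphs (pverts G) (arc_adj G) c r"
  shows "Digraph_Component.connected (with_proj G)"
  unfolding connected_def
proof (rule strongly_connectedI)
  interpret diam_two_clique_mu_graphs "pverts G" "arc_adj G" c r by (rule diam_two)
  show "verts (with_proj (mk_symmetric (with_proj G))) \<noteq> {}"
    using not_complete by (auto simp: graph.nonadj_def)
  fix u v assume "u \<in> verts (with_proj (mk_symmetric (with_proj G)))"
    "v \<in> verts (with_proj (mk_symmetric (with_proj G)))"
  then obtain p where "awalk u p v"
    using ex_short_awalk[OF diam_two, of u v] by auto
  then have "u \<rightarrow>\<^sup>*\<^bsub>with_proj G\<^esub> v"
    using reachable_awalk by blast
  then show "u \<rightarrow>\<^sup>*\<^bsub>with_proj (mk_symmetric (with_proj G))\<^esub> v"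
    using reachable_mk_symmetric_eq[OF pair_sym_arcs] by blast
qed

lemma (in pair_graph) diameter_eq_2:
  assumes diam_two: "diam_two_clique_mu_graphs (pverts G) (arc_adj G) c r"
  shows "diameter G = 2"
  unfolding diameter_def
proof (rule antisym)
  interpret diam_two_clique_mu_graphs "pverts G" "arc_adj G" c r by (rule diam_two)
  have "gdist G u v \<le> 2" if uv: "u \<in> pverts G" "v \<in> pverts G" for u v
  proof -
    obtain p where "awalk u p v" "length p \<le> 2"
      using ex_short_awalk[OF diam_two uv] .
    then have "gdist G u v \<le> ereal (real (length p))" "ereal (real (length p)) \<le> 2"
      using gdist_le by (auto simp: numeral_eq_ereal)
    then show ?thesis
      by (rule order_trans)
  qed
  then show "(SUP x\<in>pverts G. SUP y\<in>pverts G. gdist G x y) \<le> 2"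
    by (intro SUP_least)
  obtain u v where uv: "graph.nonadj u v"
    using not_complete by blast
  then have V: "u \<in> pverts G" "v \<in> pverts G"
    by (simp_all add: graph.nonadj_def)
  then have "gdist G u v = 2"
    using gdist_2_iff uv common_nbrs_nonempty[OF uv] by blast
  then show "2 \<le> (SUP x\<in>pverts G. SUP y\<in>pverts G. gdist G x y)"
    using V by (metis SUP_upper2 order_refl)
qed

lemma (in pair_graph) strongly_regular_if_moore:
  assumes "moore_graph (pverts G) (arc_adj G) k"
  shows "strongly_regular G (k * k + 1) k 0 1"
proof -
  interpret moore_graph "pverts G" "arc_adj G" k by (rule assms)
  have "card (common_neighbours G u v) = 0" if "(u, v) \<in> parcs G" for u v
  proof -
    have "adjacent u v"
      using that by (simp add: arc_adj_def)
    then have "graph.nbrs u \<inter> graph.nbrs v = {}"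
      using adjacent_verts by (intro triangle_free) auto
    then show ?thesis
      by (simp add: common_neighbours_eq)
  qed
  moreover have "card (common_neighbours G u v) = 1"
    if "u \<in> pverts G" "v \<in> pverts G" "gdist G u v = 2" for u v
    using that gdist_2_iff card_common_nbrs_nonadj by (simp add: common_neighbours_eq)
  ultimately have "amply_regular G (k * k + 1) k 0 1"
    using pair_graph_axioms complete_graph_iff not_complete card_verts regular
      connected_if_diam_two[OF diam_two_clique_mu_graphs_axioms]
    by (simp add: amply_regular_def out_degree_eq)
  then show ?thesis
    using diameter_eq_2[OF diam_two_clique_mu_graphs_axioms] by (simp add: strongly_regular_def)
qed

lemma ex_strongly_regular_copy:
  assumes "moore_graph V E k"
  obtains H :: "nat pair_pre_digraph" and g where "pair_graph H" "strongly_regular H (k * k + 1) k 0 1"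
    "graph_iso g (pverts H) (arc_adj H) V E"
proof -
  interpret moore_graph V E k by (rule assms)
  obtain g where g: "bij_betw g {0..<card V} V"
    using ex_bij_betw_nat_finite[OF finite_verts] by blast
  define H :: "nat pair_pre_digraph" where
    "H = \<lparr>pverts = {0..<card V}, parcs = {(i, j). i < card V \<and> j < card V \<and> E (g i) (g j)}\<rparr>"
  have H: "pverts H = {0..<card V}" "arc_adj H i j \<longleftrightarrow> i < card V \<and> j < card V \<and> E (g i) (g j)" for i j
    by (auto simp: H_def arc_adj_def)
  have "finite (parcs H)"
    by (rule finite_subset[of _ "{0..<card V} \<times> {0..<card V}"]) (auto simp: H_def)
  then have graph: "pair_graph H"
    by unfold_locales (auto simp: H_def symmetric_def adj_irrefl intro!: symI intro: adj_sym)
  have iso: "graph_iso g (pverts H) (arc_adj H) V E"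
    using g by (auto simp: graph_iso_def H)
  interpret H: pair_graph H by (rule graph)
  have "moore_graph (pverts H) (arc_adj H) k"
    using iso H.graph.finite_graph_axioms assms by (rule moore_graph_iso)
  then show thesis
    using that[OF graph _ iso] H.strongly_regular_if_moore by blast
qed

subsection \<open>The theorem\<close>

lemma (in pair_graph) common_nbrs_clique_if_terwilliger:
  assumes "terwilliger G" and uv: "graph.nonadj u v"
    and xy: "x \<in> graph.nbrs u \<inter> graph.nbrs v" "y \<in> graph.nbrs u \<inter> graph.nbrs v" "x \<noteq> y"
  shows "adjacent x y"
proof -
  let ?S = "common_neighbours G u v"
  have "u \<in> pverts G" "v \<in> pverts G"
    using uv by (simp_all add: graph.nonadj_def)
  moreover from this have "gdist G u v = 2"
    using gdist_2_iff uv xy(1) by blast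
  ultimately obtain \<beta> where "complete_digraph \<beta> (with_proj G \<restriction> ?S)"
    using assms(1) unfolding terwilliger_def by blast
  moreover have "x \<in> ?S" "y \<in> ?S"
    using xy by (simp_all only: common_neighbours_eq)
  ultimately have "(x, y) \<in> arcs_ends (with_proj G \<restriction> ?S)"
    using xy(3) by (simp add: complete_digraph_def induce_subgraph_verts)
  then show ?thesis
    by (auto simp: arcs_ends_def induce_subgraph_def arc_to_ends_def arc_adj_def)
qed

lemma amply_regular_clique_mu_graphsI:
  assumes ample: "amply_regular G n d \<alpha> \<beta>" and "terwilliger G"
  shows "amply_regular_clique_mu_graphs (pverts G) (arc_adj G) \<beta> d \<alpha>"
proof -
  interpret pair_graph G
    using ample by (simp add: amply_regular_def)
  have connected: "Digraph_Component.connected (with_proj G)"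
    using ample by (simp add: amply_regular_def)
  show ?thesis
  proof unfold_locales
    show "card (graph.nbrs u) = d" if "u \<in> pverts G" for u
      using ample that by (simp add: amply_regular_def out_degree_eq)
    show "card (graph.nbrs u \<inter> graph.nbrs v) = \<alpha>" if "u \<in> pverts G" "v \<in> graph.nbrs u" for u v
      using ample that by (simp add: amply_regular_def common_neighbours_eq arc_adj_def)
    show "card (graph.nbrs u \<inter> graph.nbrs v) = \<beta>"
      if uv: "graph.nonadj u v" "graph.nbrs u \<inter> graph.nbrs v \<noteq> {}" for u v
    proof -
      have "u \<in> pverts G" "v \<in> pverts G"
        using uv(1) by (simp_all add: graph.nonadj_def)
      moreover from this have "gdist G u v = 2"
        using gdist_2_iff uv by blast
      ultimately show ?thesis
        using ample by (simp add: amply_regular_def common_neighbours_eq)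
    qed
    show "\<exists>u v. graph.nonadj u v"
      using ample complete_graph_iff by (simp add: amply_regular_def)
    show "adjacent x y"
      if "graph.nonadj u v" "x \<in> graph.nbrs u \<inter> graph.nbrs v" "y \<in> graph.nbrs u \<inter> graph.nbrs v" "x \<noteq> y"
      for u v x y
      by (rule common_nbrs_clique_if_terwilliger[OF assms(2) that])
    show "S = pverts G" if "S \<subseteq> pverts G" "S \<noteq> {}" "\<And>u. u \<in> S \<Longrightarrow> graph.nbrs u \<subseteq> S" for S
      by (rule closed_subset_eq_if_connected[OF connected that])
  qed
qed

lemma positively_curved_graphI:
  assumes ample: "amply_regular G n d \<alpha> \<beta>" and "terwilliger G"
    and curvature: "\<And>x y. (x, y) \<in> parcs G \<Longrightarrow> LLY_curvature G x y > 0"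
  shows "positively_curved_graph (pverts G) (arc_adj G) \<beta> d \<alpha>"
proof -
  interpret pair_graph G
    using ample by (simp add: amply_regular_def)
  interpret amply_regular_clique_mu_graphs "pverts G" "arc_adj G" \<beta> d \<alpha>
    by (rule amply_regular_clique_mu_graphsI[OF assms(1,2)])
  have connected: "Digraph_Component.connected (with_proj G)"
    using ample by (simp add: amply_regular_def)
  show ?thesis
  proof unfold_locales
    fix x y and f :: "'a \<Rightarrow> real"
    assume x: "x \<in> pverts G" and y: "y \<in> graph.nbrs x" and f: "f x - f y = 1"
      and "\<forall>u\<in>pverts G. \<forall>v\<in>graph.nbrs u. f u - f v \<le> 1"
    then have lipschitz: "\<And>u v. adjacent u v \<Longrightarrow> f u - f v \<le> 1"
      using adjacent_verts in_nbrs_iff by blast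
    have xy: "adjacent x y" "y \<in> pverts G"
      using y by simp_all
    have "0 < LLY_curvature G x y"
      using curvature xy(1) by (simp add: arc_adj_def)
    also have "\<dots> \<le> 1 - ((\<Sum>u\<in>graph.nbrs x. f u) - (\<Sum>u\<in>graph.nbrs y. f u)) / real d"
      by (rule LLY_curvature_le[OF connected xy(1) degree[OF x] degree[OF xy(2)] lipschitz f])
    finally show "(\<Sum>u\<in>graph.nbrs x. f u) - (\<Sum>u\<in>graph.nbrs y. f u) < real d"
      using alpha_less by (simp add: divide_less_eq)
  qed
qed

lemma (in positively_curved_graph) icosahedron_iso_if_beta_ge_2:
  assumes "\<beta> \<ge> 2"
  obtains g where "graph_iso g UNIV icosahedron_adj V E"
proof -
  have "locally_pentagon_graph V E"
    using amply_regular_clique_mu_graphs_axioms beta_eq_2[OF assms degree_le] alpha_eq_2[OF assms degree_le]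
      degree_eq_5[OF assms degree_le] by (simp add: locally_pentagon_graph_def)
  then show thesis
    using locally_pentagon_graph.icosahedron_iso that by metis
qed

lemma (in curved_mu_one_graph) line_graph_iso:
  assumes K: "pair_wf_digraph K" and g: "graph_iso g (pverts K) (arc_adj K) lines meet"
  obtains f where "graph_iso f V E (pverts (line_graph K)) (arc_adj (line_graph K))"
proof -
  have "graph_iso (inv_into (pverts K) g) lines meet (pverts K) (arc_adj K)"
    by (rule graph_iso_inv_into[OF g])
  then have "graph_iso ((`) (inv_into (pverts K) g) \<circ> lines_through) V E (edge_set (pverts K) (arc_adj K)) meet"
    by (rule graph_iso_comp[OF edge_set_iso lines_through_iso])
  then show thesis
    using that graph_iso_line_graph[OF K] by blast
qed

theorem (in curved_mu_one_graph) iso_cases: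
  obtains (pentagon) f where "graph_iso f V E (pverts pentagon) (arc_adj pentagon)"
  | (petersen) f where "graph_iso f V E (pverts (line_graph petersen)) (arc_adj (line_graph petersen))"
  | (hoffman_singleton) f where
      "graph_iso f V E (pverts (line_graph hoffman_singleton)) (arc_adj (line_graph hoffman_singleton))"
  | (missing_moore_graph) f and H :: "nat pair_pre_digraph" where "strongly_regular H 3250 57 0 1"
      "graph_iso f V E (pverts (line_graph H)) (arc_adj (line_graph H))"
proof -
  interpret L: moore_graph lines meet "\<alpha> + 2"
    by (rule lines_moore)
  consider "\<alpha> + 2 = 2" | "\<alpha> + 2 = 3" | "\<alpha> + 2 = 7" | "\<alpha> + 2 = 57"
    using L.degree_cases by auto
  then show thesis
  proof cases
    case 1
    then obtain p :: "5 \<Rightarrow> 'a set" where "graph_iso p UNIV cycle_adj lines meet"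
      by (rule L.pentagon_iso)
    note labels = graph_iso_comp[OF graph_iso_inv_into[OF pentagon_edge_set_iso]
        graph_iso_comp[OF edge_set_iso[OF graph_iso_inv_into[OF this]] lines_through_iso]]
    show thesis
      by (rule pentagon[OF graph_iso_comp[OF graph_iso_inv_into[OF pentagon_graph_iso] labels]])
  next
    case 2
    then obtain g where "graph_iso g UNIV petersen_adj lines meet"
      by (rule L.petersen_iso)
    note graph_iso_comp[OF this graph_iso_comp[OF graph_iso_inv_into[OF petersen_label_iso] petersen_graph_iso]]
    then show thesis
      using line_graph_iso[OF pair_wf_digraph_petersen] petersen by metis
  next
    case 3
    then obtain g where "graph_iso g UNIV robertson_adj lines meet"
      by (rule L.hoffman_singleton_iso)
    note graph_iso_comp[OF this hoffman_singleton_graph_iso]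
    then show thesis
      using line_graph_iso[OF pair_wf_digraph_hoffman_singleton] hoffman_singleton by metis
  next
    case 4
    obtain H :: "nat pair_pre_digraph" and g where H: "pair_graph H" "strongly_regular H 3250 57 0 1"
        "graph_iso g (pverts H) (arc_adj H) lines meet"
      using ex_strongly_regular_copy[OF lines_moore] 4 by auto
    interpret H: pair_graph H by (rule H(1))
    show thesis
      using line_graph_iso[OF H.pair_wf_digraph_axioms H(3)] missing_moore_graph[OF H(2)] by metis
  qed
qed

theorem theorem1p5:
  fixes G :: "'a pair_pre_digraph" and n d \<alpha> \<beta> :: nat
  assumes "amply_regular G n d \<alpha> \<beta>"
    and "terwilliger G"
    and "\<And>x y. (x, y) \<in> parcs G \<Longrightarrow> LLY_curvature G x y > 0"
  shows "digraph_iso (with_proj G) (with_proj pentagon) \<or>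
    digraph_iso (with_proj G) (with_proj icosahedron) \<or>
    digraph_iso (with_proj G) (with_proj (line_graph petersen)) \<or>
    digraph_iso (with_proj G) (with_proj (line_graph hoffman_singleton)) \<or>
    (\<exists>H :: nat pair_pre_digraph. strongly_regular H 3250 57 0 1 \<and>
       digraph_iso (with_proj G) (with_proj (line_graph H)))"
proof -
  interpret pair_graph G
    using assms(1) by (simp add: amply_regular_def)
  interpret positively_curved_graph "pverts G" "arc_adj G" \<beta> d \<alpha>
    by (rule positively_curved_graphI[OF assms])
  note iso = digraph_iso_if_graph_iso[OF pair_wf_digraph_axioms]
  consider "\<beta> \<ge> 2" | "\<beta> = 1"
    using beta_pos by linarith
  then show ?thesis
  proof cases
    case 1
    then obtain g where "graph_iso g UNIV icosahedron_adj (pverts G) (arc_adj G)"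
      by (rule icosahedron_iso_if_beta_ge_2)
    from graph_iso_comp[OF graph_iso_inv_into[OF icosahedron_graph_iso] graph_iso_inv_into[OF this]]
    show ?thesis
      using iso[OF pair_wf_digraph_icosahedron] by blast
  next
    case 2
    then have "curved_mu_one_graph (pverts G) (arc_adj G) d \<alpha>"
      using positively_curved_graph_axioms amply_regular_clique_mu_graphs_axioms
      by (simp add: curved_mu_one_graph_def mu_one_graph_def)
    then show ?thesis
      by (cases rule: curved_mu_one_graph.iso_cases) (use iso pair_wf_digraph_pentagon pair_wf_digraph_line_graph in blast)+
  qed
qed

end
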